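(* Let $d,r:\mathbb{N}\to\mathbb{N}$ be functions such that $d$ is nondecreasing, takes only prime values at least $5$, $r$ is strictly increasing, and $3r(n)\le d(n)$ for all $n$. Let $\alpha_n=(1\;2\;\cdots\;d(n))$, $\beta_n=(1\;(1+r(n))\;(1+2r(n)))$, $\alpha=(\alpha_n)_n,\beta=(\beta_n)_n\in\prod_n\mathrm{Alt}(d(n))$, $G=\langle\alpha,\beta\rangle$, and let $L_\infty$ be the normal closure of $\beta$ in $G$. Let $\mu$ be an ergodic invariant random subgroup of $G$ whose support is contained in $\mathrm{Sub}(L_\infty)$. Then $\mu$ is cosofic in $G$.
   Context: $\mathbb{N}=\{1,2,\dots\}$. For a countable group $\Gamma$, $\mathrm{Sub}(\Gamma)\subseteq\{0,1\}^\Gamma$ is the space of subgroups with the product topology, on which $\Gamma$ acts by conjugation. An invariant random subgroup (IRS) is a conjugation-invariant Borel probability measure on $\mathrm{Sub}(\Gamma)$; the IRS form a compact convex set under the weak$^*$ topology, and an IRS is ergodic if it is an extreme point of this set. An IRS is finite-index if it is an atomic measure supported on finite-index subgroups, and cosofic if it is a weak$^*$ limit of finite-index IRS. *)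

theory Defs
  imports "HOL-Probability.Probability" "HOL-Algebra.Product_Groups" "HOL-Algebra.Sym_Groups"
    "HOL-Algebra.Generated_Groups"
begin

definition Subgrps :: "('a, 'b) monoid_scheme \<Rightarrow> 'a set set" where
  "Subgrps \<Gamma> = {H. subgroup H \<Gamma>}"

definition Sub_topology :: "('a, 'b) monoid_scheme \<Rightarrow> 'a set topology" where
  "Sub_topology \<Gamma> =
     pullback_topology (Subgrps \<Gamma>) (\<lambda>H. restrict (\<lambda>g. g \<in> H) (carrier \<Gamma>))
       (product_topology (\<lambda>_. discrete_topology (UNIV :: bool set)) (carrier \<Gamma>))"

definition Sub_borel :: "('a, 'b) monoid_scheme \<Rightarrow> 'a set measure" where
  "Sub_borel \<Gamma> = sigma (topspace (Sub_topology \<Gamma>)) {U. openin (Sub_topology \<Gamma>) U}"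

definition conjH :: "('a, 'b) monoid_scheme \<Rightarrow> 'a \<Rightarrow> 'a set \<Rightarrow> 'a set" where
  "conjH \<Gamma> g H = (\<lambda>h. g \<otimes>\<^bsub>\<Gamma>\<^esub> h \<otimes>\<^bsub>\<Gamma>\<^esub> inv\<^bsub>\<Gamma>\<^esub> g) ` H"

definition IRS :: "('a, 'b) monoid_scheme \<Rightarrow> 'a set measure \<Rightarrow> bool" where
  "IRS \<Gamma> \<mu> \<longleftrightarrow> sets \<mu> = sets (Sub_borel \<Gamma>) \<and> prob_space \<mu> \<and>
     (\<forall>g \<in> carrier \<Gamma>. distr \<mu> \<mu> (conjH \<Gamma> g) = \<mu>)"

definition ergodic_IRS :: "('a, 'b) monoid_scheme \<Rightarrow> 'a set measure \<Rightarrow> bool" where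
  "ergodic_IRS \<Gamma> \<mu> \<longleftrightarrow> IRS \<Gamma> \<mu> \<and>
     \<not> (\<exists>\<nu>1 \<nu>2 (t::real). IRS \<Gamma> \<nu>1 \<and> IRS \<Gamma> \<nu>2 \<and> \<nu>1 \<noteq> \<nu>2 \<and> 0 < t \<and> t < 1 \<and>
          (\<forall>A \<in> sets \<mu>. measure \<mu> A = t * measure \<nu>1 A + (1 - t) * measure \<nu>2 A))"

definition measure_support :: "'a topology \<Rightarrow> 'a measure \<Rightarrow> 'a set" where
  "measure_support X \<mu> =
     {x \<in> topspace X. \<forall>U. openin X U \<and> x \<in> U \<longrightarrow> emeasure \<mu> U > 0}"

definition finite_index_subgroup :: "('a, 'b) monoid_scheme \<Rightarrow> 'a set \<Rightarrow> bool" where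
  "finite_index_subgroup \<Gamma> H \<longleftrightarrow> subgroup H \<Gamma> \<and> finite (rcosets\<^bsub>\<Gamma>\<^esub> H)"

definition finite_index_IRS :: "('a, 'b) monoid_scheme \<Rightarrow> 'a set measure \<Rightarrow> bool" where
  "finite_index_IRS \<Gamma> \<mu> \<longleftrightarrow> IRS \<Gamma> \<mu> \<and>
     (\<exists>C. countable C \<and> C \<subseteq> {H. finite_index_subgroup \<Gamma> H} \<and> C \<in> sets \<mu> \<and> emeasure \<mu> C = 1)"

text \<open>Cosofic: in the weak* closure of the finite-index IRS, i.e. every basic weak*
  neighbourhood of mu (given by finitely many continuous functions and epsilon) contains
  a finite-index IRS.\<close>
definition cosofic :: "('a, 'b) monoid_scheme \<Rightarrow> 'a set measure \<Rightarrow> bool" where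
  "cosofic \<Gamma> \<mu> \<longleftrightarrow>
     (\<forall>F (\<epsilon>::real). finite F \<and> \<epsilon> > 0 \<and>
        (\<forall>f \<in> F. continuous_map (Sub_topology \<Gamma>) euclideanreal f) \<longrightarrow>
        (\<exists>\<nu>. finite_index_IRS \<Gamma> \<nu> \<and>
              (\<forall>f \<in> F. \<bar>(\<integral>H. f H \<partial>\<nu>) - (\<integral>H. f H \<partial>\<mu>)\<bar> < \<epsilon>)))"

definition AltProd :: "(nat \<Rightarrow> nat) \<Rightarrow> (nat \<Rightarrow> nat \<Rightarrow> nat) monoid" where
  "AltProd d = product_group UNIV (\<lambda>n. alt_group (d n))"

definition alpha :: "(nat \<Rightarrow> nat) \<Rightarrow> nat \<Rightarrow> nat \<Rightarrow> nat" where
  "alpha d = (\<lambda>n k. if 1 \<le> k \<and> k < d n then k + 1 else if k = d n then 1 else k)"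

definition beta :: "(nat \<Rightarrow> nat) \<Rightarrow> nat \<Rightarrow> nat \<Rightarrow> nat" where
  "beta r = (\<lambda>n k. if k = 1 then 1 + r n
                   else if k = 1 + r n then 1 + 2 * r n
                   else if k = 1 + 2 * r n then 1 else k)"

definition Ggrp :: "(nat \<Rightarrow> nat) \<Rightarrow> (nat \<Rightarrow> nat) \<Rightarrow> (nat \<Rightarrow> nat \<Rightarrow> nat) monoid" where
  "Ggrp d r = subgroup_generated (AltProd d) {alpha d, beta r}"

definition Linf :: "(nat \<Rightarrow> nat) \<Rightarrow> (nat \<Rightarrow> nat) \<Rightarrow> (nat \<Rightarrow> nat \<Rightarrow> nat) set" where
  "Linf d r = generate (Ggrp d r)
     {g \<otimes>\<^bsub>Ggrp d r\<^esub> beta r \<otimes>\<^bsub>Ggrp d r\<^esub> inv\<^bsub>Ggrp d r\<^esub> g | g. g \<in> carrier (Ggrp d r)}"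

end

theory Submission
  imports Defs "HOL-Algebra.Zassenhaus" "HOL-Library.Groups_Big_Fun" "HOL-Number_Theory.Cong"
begin

text \<open>
  The conjugates \<open>B i = \<alpha>\<^sup>i \<beta> \<alpha>\<^sup>-\<^sup>i\<close> with \<open>i\<close> in a window of length \<open>w = r N\<close> commute in every coordinate
  \<open>n \<ge> N\<close>. Moreover \<open>G\<close> contains all of \<open>Alt (d n)\<close> in each single coordinate, and
  \<open>G\<close> modulo the direct sum of these groups is the lamplighter group \<open>\<int>/3 \<wr> \<int>\<close>. Hence \<open>G\<close> maps onto the
  finite group \<open>(\<Prod>n<N. Alt (d n)) \<times> (\<int>/3 \<wr> \<int>/w)\<close>, with kernel \<open>K\<close> say, and the finite subgroup \<open>Y\<close> of
  \<open>L\<^sub>\<infinity>\<close> generated by the first \<open>N\<close> coordinates and the window \<open>B 0, \<dots>, B (w - 1)\<close> is mapped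
  isomorphically onto the kernel of the projection of this finite group to \<open>\<int>/w\<close>.

  Given an invariant random subgroup \<open>H\<close> contained in \<open>L\<^sub>\<infinity>\<close>, conjugate \<open>(H \<inter> Y) K\<close> by a uniformly chosen
  \<open>\<alpha>\<^sup>-\<^sup>j\<close>, \<open>0 \<le> j < w\<close>. Since \<open>H\<close> is invariant under \<open>Y\<close>, the law of the result is invariant under \<open>G\<close>. A given
  finite set of elements of \<open>L\<^sub>\<infinity>\<close> is conjugated into \<open>Y\<close> by \<open>\<alpha>\<^sup>j\<close> for all but a bounded number of \<open>j\<close>, and for
  those \<open>j\<close> the new random subgroup and the corresponding conjugate of \<open>H\<close> contain the same
  elements of the set. As \<open>w\<close> grows, these finite-index random subgroups converge to \<open>H\<close>.
\<close>

section \<open>The space of subgroups\<close>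

text \<open>Since \<alpha> does not normalize \<open>Y\<close>, the law of
  \<open>(H \<inter> Y) K\<close> for a single window is invariant only under \<open>Y K\<close>.
  This subgroup has index \<open>w\<close>, and the powers of \<alpha> represent its left cosets.
  Averaging over them is induction of an invariant law from a finite-index subgroup: left
  translation by any element of \<open>G\<close> merely permutes the cosets. Elements whose total
  exponent of \<alpha> is nonzero can never be conjugated into \<open>Y\<close>. They are harmless
  for another reason: \<open>H\<close> almost surely avoids them, and as soon as \<open>w\<close>
  exceeds the exponent their conjugates lie outside \<open>Y K\<close> as well. That
  \<open>G\<close> contains the alternating group of each single coordinate is what allows the first
  \<open>N\<close> coordinates to be prescribed independently of the lamps. It is proved by
  induction on the coordinate. Because \<open>r\<close> grows strictly, the commutator of \<beta>
  with its conjugate by the power \<open>r n\<close> of \<alpha> is trivial beyond coordinate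
  \<open>n\<close>, and the coordinates before \<open>n\<close> are removed by the induction
  hypothesis.\<close>

lemma topspace_Sub_topology [simp]: "topspace (Sub_topology \<Gamma>) = Subgrps \<Gamma>"
  by (auto simp: Sub_topology_def topspace_pullback_topology)

lemma openin_Sub_topology_cylinder:
  assumes "finite E" "E \<subseteq> carrier \<Gamma>"
  shows "openin (Sub_topology \<Gamma>) {H' \<in> Subgrps \<Gamma>. H' \<inter> E = H \<inter> E}"
proof -
  let ?S = "\<lambda>i. if i \<in> E then {i \<in> H} else (UNIV :: bool set)"
  have "openin (product_topology (\<lambda>_. discrete_topology (UNIV :: bool set)) (carrier \<Gamma>))
          (PiE (carrier \<Gamma>) ?S)"
    by (auto simp: openin_PiE_gen intro!: finite_subset[OF _ assms(1)])
  moreover have "{H' \<in> Subgrps \<Gamma>. H' \<inter> E = H \<inter> E} =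
      (\<lambda>H. restrict (\<lambda>g. g \<in> H) (carrier \<Gamma>)) -` (PiE (carrier \<Gamma>) ?S) \<inter> Subgrps \<Gamma>"
    using assms(2) by (auto simp: PiE_iff split: if_splits)
  ultimately show ?thesis
    unfolding Sub_topology_def openin_pullback_topology by blast
qed

text \<open>Two subgroups are close when they agree on a large finite set. This description replaces
  the pullback topology from here on; the product space itself returns only for its
  compactness.\<close>

lemma openin_Sub_topology_iff:
  "openin (Sub_topology \<Gamma>) U \<longleftrightarrow> U \<subseteq> Subgrps \<Gamma> \<and>
     (\<forall>H\<in>U. \<exists>E. finite E \<and> E \<subseteq> carrier \<Gamma> \<and> (\<forall>H'\<in>Subgrps \<Gamma>. H' \<inter> E = H \<inter> E \<longrightarrow> H' \<in> U))"
  (is "?L \<longleftrightarrow> ?R")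
proof
  let ?\<Phi> = "\<lambda>H. restrict (\<lambda>g. g \<in> H) (carrier \<Gamma>)"
  assume ?L
  then obtain V where V: "openin (product_topology (\<lambda>_. discrete_topology (UNIV :: bool set)) (carrier \<Gamma>)) V"
      "U = ?\<Phi> -` V \<inter> Subgrps \<Gamma>"
    unfolding Sub_topology_def openin_pullback_topology by blast
  have "\<exists>E. finite E \<and> E \<subseteq> carrier \<Gamma> \<and> (\<forall>H'\<in>Subgrps \<Gamma>. H' \<inter> E = H \<inter> E \<longrightarrow> H' \<in> U)"
    if "H \<in> U" for H
  proof -
    have "?\<Phi> H \<in> V" using that V by auto
    then obtain W where W: "finite {i \<in> carrier \<Gamma>. W i \<noteq> (UNIV :: bool set)}"
        "?\<Phi> H \<in> PiE (carrier \<Gamma>) W" "PiE (carrier \<Gamma>) W \<subseteq> V"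
      using V(1) unfolding openin_product_topology_alt by auto
    let ?E = "{i \<in> carrier \<Gamma>. W i \<noteq> (UNIV :: bool set)}"
    have "H' \<in> U" if "H' \<in> Subgrps \<Gamma>" "H' \<inter> ?E = H \<inter> ?E" for H'
    proof -
      have "?\<Phi> H' i \<in> W i" if "i \<in> carrier \<Gamma>" for i
      proof (cases "W i = UNIV")
        case False
        then have "i \<in> H' \<longleftrightarrow> i \<in> H"
          using that \<open>H' \<inter> ?E = H \<inter> ?E\<close> by blast
        then show ?thesis using W(2) that by (auto simp: PiE_iff)
      qed auto
      then have "?\<Phi> H' \<in> PiE (carrier \<Gamma>) W" by (auto simp: PiE_iff)
      then have "?\<Phi> H' \<in> V" using W(3) by blast
      then show ?thesis using V that by simp
    qed
    then show ?thesis using W(1) by (intro exI[of _ ?E] conjI ballI impI) simp_all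
  qed
  moreover have "U \<subseteq> Subgrps \<Gamma>" using V(2) by simp
  ultimately show ?R by simp
next
  assume R: ?R
  show ?L
  proof (subst openin_subopen, intro ballI)
    fix H assume H: "H \<in> U"
    then obtain E where E: "finite E" "E \<subseteq> carrier \<Gamma>"
        "\<forall>H'\<in>Subgrps \<Gamma>. H' \<inter> E = H \<inter> E \<longrightarrow> H' \<in> U"
      using R by blast
    show "\<exists>T. openin (Sub_topology \<Gamma>) T \<and> H \<in> T \<and> T \<subseteq> U"
      using openin_Sub_topology_cylinder[OF E(1,2), of H] E(3) H R
      by (intro exI[of _ "{H' \<in> Subgrps \<Gamma>. H' \<inter> E = H \<inter> E}"]) auto
  qed
qed

text \<open>This is closedness of the set of subgroups in the space of all subsets: the failure of
  an axiom involves at most three elements, and no subgroup agrees with \<open>X\<close> on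
  those.\<close>

lemma not_subgroup_finite_witness:
  assumes "group \<Gamma>" "X \<subseteq> carrier \<Gamma>" "\<not> subgroup X \<Gamma>"
  obtains E where "finite E" "E \<subseteq> carrier \<Gamma>" "\<And>H. subgroup H \<Gamma> \<Longrightarrow> H \<inter> E \<noteq> X \<inter> E"
proof -
  interpret group \<Gamma> by fact
  consider "\<one>\<^bsub>\<Gamma>\<^esub> \<notin> X"
    | x y where "x \<in> X" "y \<in> X" "x \<otimes>\<^bsub>\<Gamma>\<^esub> y \<notin> X"
    | x where "x \<in> X" "inv\<^bsub>\<Gamma>\<^esub> x \<notin> X"
    using assms(2,3) by (meson subgroup.intro)
  then show thesis
  proof cases
    case 1
    show ?thesis
      by (rule that[of "{\<one>\<^bsub>\<Gamma>\<^esub>}"]) (use 1 subgroup.one_closed in auto)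
  next
    case (2 x y)
    show ?thesis
    proof (rule that[of "{x, y, x \<otimes>\<^bsub>\<Gamma>\<^esub> y}"])
      fix H assume H: "subgroup H \<Gamma>"
      show "H \<inter> {x, y, x \<otimes>\<^bsub>\<Gamma>\<^esub> y} \<noteq> X \<inter> {x, y, x \<otimes>\<^bsub>\<Gamma>\<^esub> y}"
        using 2 subgroup.m_closed[OF H, of x y] by blast
    qed (use 2 assms(2) in auto)
  next
    case (3 x)
    show ?thesis
    proof (rule that[of "{x, inv\<^bsub>\<Gamma>\<^esub> x}"])
      fix H assume H: "subgroup H \<Gamma>"
      show "H \<inter> {x, inv\<^bsub>\<Gamma>\<^esub> x} \<noteq> X \<inter> {x, inv\<^bsub>\<Gamma>\<^esub> x}"
        using 3 subgroup.m_inv_closed[OF H, of x] by blast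
    qed (use 3 assms(2) in auto)
  qed
qed

text \<open>Compactness of the space of subgroups, with a finite set that may depend on the center
  of the cylinder.\<close>

lemma Subgrps_finite_cylinder_cover:
  assumes "group \<Gamma>"
    and E: "\<And>H. H \<in> Subgrps \<Gamma> \<Longrightarrow> finite (E H) \<and> E H \<subseteq> carrier \<Gamma>"
  obtains D where "finite D" "D \<subseteq> Subgrps \<Gamma>"
    "\<And>H'. H' \<in> Subgrps \<Gamma> \<Longrightarrow> \<exists>H\<in>D. H' \<inter> E H = H \<inter> E H"
proof -
  let ?X = "product_topology (\<lambda>_. discrete_topology (UNIV :: bool set)) (carrier \<Gamma>)"
  define S where "S x = {g \<in> carrier \<Gamma>. x g}" for x
  have "\<exists>F. finite F \<and> F \<subseteq> carrier \<Gamma> \<and>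
      (if subgroup (S x) \<Gamma> then F = E (S x) else (\<forall>H. subgroup H \<Gamma> \<longrightarrow> H \<inter> F \<noteq> S x \<inter> F))" for x
  proof (cases "subgroup (S x) \<Gamma>")
    case True
    then show ?thesis using E[of "S x"] by (auto simp: Subgrps_def)
  next
    case False
    then obtain F where "finite F" "F \<subseteq> carrier \<Gamma>" "\<And>H. subgroup H \<Gamma> \<Longrightarrow> H \<inter> F \<noteq> S x \<inter> F"
      by (rule not_subgroup_finite_witness[OF assms(1), rotated]) (auto simp: S_def)
    then show ?thesis using False by auto
  qed
  then obtain F where F: "\<And>x. finite (F x)" "\<And>x. F x \<subseteq> carrier \<Gamma>"
      "\<And>x. subgroup (S x) \<Gamma> \<Longrightarrow> F x = E (S x)"
      "\<And>x H. \<not> subgroup (S x) \<Gamma> \<Longrightarrow> subgroup H \<Gamma> \<Longrightarrow> H \<inter> F x \<noteq> S x \<inter> F x"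
    by metis
  define U where "U x = PiE (carrier \<Gamma>) (\<lambda>i. if i \<in> F x then {x i} else (UNIV :: bool set))" for x
  have openU: "openin ?X (U x)" for x
    unfolding U_def using F(1)[of x]
    by (auto simp: openin_PiE_gen intro!: finite_subset[OF _ F(1)[of x]])
  have "compact_space ?X"
    by (auto simp: compact_space_product_topology compact_space_discrete_topology)
  moreover have "topspace ?X \<subseteq> \<Union> (U ` topspace ?X)"
  proof
    fix x assume x: "x \<in> topspace ?X"
    then have "x \<in> U x" by (simp add: U_def PiE_iff)
    then show "x \<in> \<Union> (U ` topspace ?X)" using x by (rule UN_I[rotated])
  qed
  moreover have "\<forall>V\<in>U ` topspace ?X. openin ?X V" using openU by blast
  ultimately have "\<exists>\<F>. finite \<F> \<and> \<F> \<subseteq> U ` topspace ?X \<and> topspace ?X \<subseteq> \<Union> \<F>"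
    unfolding compact_space_alt by (elim allE[of _ "U ` topspace ?X"]) blast
  then obtain \<F> where \<F>: "finite \<F>" "\<F> \<subseteq> U ` topspace ?X" "topspace ?X \<subseteq> \<Union> \<F>"
    by blast
  obtain D0 where D0: "finite D0" "D0 \<subseteq> topspace ?X" "\<F> = U ` D0"
    using finite_subset_image[OF \<F>(1,2)] by blast
  show thesis
  proof (rule that[of "S ` {x \<in> D0. subgroup (S x) \<Gamma>}"])
    fix H' assume H': "H' \<in> Subgrps \<Gamma>"
    let ?y = "restrict (\<lambda>g. g \<in> H') (carrier \<Gamma>)"
    have "?y \<in> topspace ?X" by auto
    then obtain x where x: "x \<in> D0" "?y \<in> U x" using \<F> D0 by blast
    have agree: "H' \<inter> F x = S x \<inter> F x"
    proof -
      have "(i \<in> H') = x i" if "i \<in> F x" for i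
        using x(2) that F(2)[of x] by (auto simp: U_def PiE_iff split: if_splits)
      then show ?thesis using F(2)[of x] by (auto simp: S_def)
    qed
    then have "subgroup (S x) \<Gamma>" using F(4) H' by (auto simp: Subgrps_def)
    then show "\<exists>H\<in>S ` {x \<in> D0. subgroup (S x) \<Gamma>}. H' \<inter> E H = H \<inter> E H"
      using agree F(3) x by auto
  qed (use D0 in \<open>auto simp: Subgrps_def\<close>)
qed

text \<open>A Lebesgue number argument: finitely many cylinders cover the space such that on each of
  them \<open>f\<close> stays within \<open>\<epsilon> / 2\<close> of its value at the center, and
  agreement on the union of their finite sets puts \<open>H\<close> and \<open>H'\<close> into a
  common cylinder.\<close>

lemma Sub_continuous_uniform:
  assumes "group \<Gamma>" "continuous_map (Sub_topology \<Gamma>) euclideanreal f" "\<epsilon> > 0"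
  obtains E where "finite E" "E \<subseteq> carrier \<Gamma>"
    "\<And>H H'. H \<in> Subgrps \<Gamma> \<Longrightarrow> H' \<in> Subgrps \<Gamma> \<Longrightarrow> H \<inter> E = H' \<inter> E \<Longrightarrow> \<bar>f H - f H'\<bar> < \<epsilon>"
proof -
  have "\<exists>E. finite E \<and> E \<subseteq> carrier \<Gamma> \<and>
      (\<forall>H'\<in>Subgrps \<Gamma>. H' \<inter> E = H \<inter> E \<longrightarrow> \<bar>f H' - f H\<bar> < \<epsilon> / 2)" if "H \<in> Subgrps \<Gamma>" for H
  proof -
    have "openin (Sub_topology \<Gamma>) {H' \<in> Subgrps \<Gamma>. f H' \<in> ball (f H) (\<epsilon> / 2)}"
      using openin_continuous_map_preimage[OF assms(2), of "ball (f H) (\<epsilon> / 2)"] by simp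
    moreover have "H \<in> {H' \<in> Subgrps \<Gamma>. f H' \<in> ball (f H) (\<epsilon> / 2)}"
      using that assms(3) by simp
    ultimately obtain E where "finite E" "E \<subseteq> carrier \<Gamma>"
        "\<forall>H'\<in>Subgrps \<Gamma>. H' \<inter> E = H \<inter> E \<longrightarrow> H' \<in> {H' \<in> Subgrps \<Gamma>. f H' \<in> ball (f H) (\<epsilon> / 2)}"
      unfolding openin_Sub_topology_iff by meson
    then show ?thesis by (intro exI[of _ E]) (auto simp: dist_real_def abs_minus_commute)
  qed
  then obtain E where E: "\<And>H. H \<in> Subgrps \<Gamma> \<Longrightarrow> finite (E H) \<and> E H \<subseteq> carrier \<Gamma> \<and>
      (\<forall>H'\<in>Subgrps \<Gamma>. H' \<inter> E H = H \<inter> E H \<longrightarrow> \<bar>f H' - f H\<bar> < \<epsilon> / 2)"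
    by metis
  obtain D where D: "finite D" "D \<subseteq> Subgrps \<Gamma>"
      "\<And>H'. H' \<in> Subgrps \<Gamma> \<Longrightarrow> \<exists>H\<in>D. H' \<inter> E H = H \<inter> E H"
    using Subgrps_finite_cylinder_cover[OF assms(1), of E] E by blast
  show thesis
  proof (rule that[of "\<Union> (E ` D)"])
    fix H H' assume H: "H \<in> Subgrps \<Gamma>" "H' \<in> Subgrps \<Gamma>" "H \<inter> \<Union> (E ` D) = H' \<inter> \<Union> (E ` D)"
    obtain H0 where H0: "H0 \<in> D" "H \<inter> E H0 = H0 \<inter> E H0" using D(3)[OF H(1)] by blast
    moreover have "H' \<inter> E H0 = H0 \<inter> E H0" using H(3) H0 by blast
    ultimately have "\<bar>f H - f H0\<bar> < \<epsilon> / 2" "\<bar>f H' - f H0\<bar> < \<epsilon> / 2"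
      using E[of H0] D(2) H by auto
    then show "\<bar>f H - f H'\<bar> < \<epsilon>" by linarith
  next
    show "finite (\<Union> (E ` D))" using D E by blast
    show "\<Union> (E ` D) \<subseteq> carrier \<Gamma>" using D(2) E by blast
  qed
qed

lemma Sub_continuous_bounded:
  assumes "group \<Gamma>" "continuous_map (Sub_topology \<Gamma>) euclideanreal f"
  obtains B where "\<And>H. H \<in> Subgrps \<Gamma> \<Longrightarrow> \<bar>f H\<bar> \<le> B"
proof -
  obtain E where E: "finite E" "E \<subseteq> carrier \<Gamma>"
      "\<And>H H'. H \<in> Subgrps \<Gamma> \<Longrightarrow> H' \<in> Subgrps \<Gamma> \<Longrightarrow> H \<inter> E = H' \<inter> E \<Longrightarrow> \<bar>f H - f H'\<bar> < 1"
    by (rule Sub_continuous_uniform[OF assms zero_less_one]) blast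
  obtain D where D: "finite D" "D \<subseteq> Subgrps \<Gamma>"
      "\<And>H'. H' \<in> Subgrps \<Gamma> \<Longrightarrow> \<exists>H\<in>D. H' \<inter> E = H \<inter> E"
    using Subgrps_finite_cylinder_cover[OF assms(1), of "\<lambda>_. E"] E by blast
  show thesis
  proof (rule that)
    fix H assume H: "H \<in> Subgrps \<Gamma>"
    obtain H0 where H0: "H0 \<in> D" "H \<inter> E = H0 \<inter> E" using D(3)[OF H] by blast
    then have "\<bar>f H - f H0\<bar> < 1" using E(3) H D by auto
    moreover have "\<bar>f H0\<bar> \<le> (\<Sum>H\<in>D. \<bar>f H\<bar>)"
      using D H0 by (intro member_le_sum) auto
    ultimately show "\<bar>f H\<bar> \<le> (\<Sum>H\<in>D. \<bar>f H\<bar>) + 1" by linarith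
  qed
qed

section \<open>Borel sets, supports and the conjugation action\<close>

lemma openin_Sub_topology_subset: "openin (Sub_topology \<Gamma>) U \<Longrightarrow> U \<subseteq> Subgrps \<Gamma>"
  using openin_subset[of "Sub_topology \<Gamma>"] by simp

lemma space_Sub_borel [simp]: "space (Sub_borel \<Gamma>) = Subgrps \<Gamma>"
  unfolding Sub_borel_def by (subst space_measure_of) (use openin_Sub_topology_subset in auto)

lemma sets_Sub_borel: "sets (Sub_borel \<Gamma>) = sigma_sets (Subgrps \<Gamma>) {U. openin (Sub_topology \<Gamma>) U}"
  unfolding Sub_borel_def by (subst sets_measure_of) (use openin_Sub_topology_subset in auto)

lemma openin_sets_Sub_borel: "openin (Sub_topology \<Gamma>) U \<Longrightarrow> U \<in> sets (Sub_borel \<Gamma>)"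
  by (auto simp: sets_Sub_borel)

lemma continuous_map_Sub_measurable:
  assumes "continuous_map (Sub_topology \<Gamma>) euclideanreal f"
  shows "f \<in> borel_measurable (Sub_borel \<Gamma>)"
proof (rule borel_measurableI)
  fix S :: "real set" assume "open S"
  then have "openin (Sub_topology \<Gamma>) {H \<in> Subgrps \<Gamma>. f H \<in> S}"
    using openin_continuous_map_preimage[OF assms, of S] by simp
  then show "f -` S \<inter> space (Sub_borel \<Gamma>) \<in> sets (Sub_borel \<Gamma>)"
    by (intro openin_sets_Sub_borel) (simp add: vimage_def Int_def conj_commute)
qed

text \<open>The subgroups containing \<open>g\<close> form a clopen, hence compact set that misses
  the support, so finitely many null cylinders cover it. Each finite set \<open>E H\<close> contains
  \<open>g\<close>, so that membership of \<open>g\<close> is constant on every cylinder.\<close>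

lemma IRS_AE_in_support:
  assumes "group \<Gamma>" "IRS \<Gamma> \<mu>" "g \<in> carrier \<Gamma>"
    and "\<And>H. H \<in> measure_support (Sub_topology \<Gamma>) \<mu> \<Longrightarrow> g \<notin> H"
  shows "AE H in \<mu>. g \<notin> H"
proof -
  have sets: "sets \<mu> = sets (Sub_borel \<Gamma>)" using assms(2) by (simp add: IRS_def)
  then have space: "space \<mu> = Subgrps \<Gamma>" by (metis sets_eq_imp_space_eq space_Sub_borel)
  have "\<exists>E. finite E \<and> E \<subseteq> carrier \<Gamma> \<and>
      (g \<in> H \<longrightarrow> {H' \<in> Subgrps \<Gamma>. H' \<inter> E = H \<inter> E} \<in> null_sets \<mu>) \<and> g \<in> E" if "H \<in> Subgrps \<Gamma>" for H
  proof (cases "g \<in> H")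
    case True
    then have "H \<notin> measure_support (Sub_topology \<Gamma>) \<mu>" using assms(4) by blast
    then have "\<exists>U. (openin (Sub_topology \<Gamma>) U \<and> H \<in> U) \<and> \<not> 0 < emeasure \<mu> U"
      using that unfolding measure_support_def by simp
    then obtain U where U: "openin (Sub_topology \<Gamma>) U" "H \<in> U" "emeasure \<mu> U = 0"
      by (auto simp: not_gr_zero)
    then obtain E where E: "finite E" "E \<subseteq> carrier \<Gamma>"
        "\<forall>H'\<in>Subgrps \<Gamma>. H' \<inter> E = H \<inter> E \<longrightarrow> H' \<in> U"
      unfolding openin_Sub_topology_iff by blast
    have "U \<in> null_sets \<mu>" using U openin_sets_Sub_borel sets by (auto simp: null_sets_def)
    moreover have "{H' \<in> Subgrps \<Gamma>. H' \<inter> insert g E = H \<inter> insert g E} \<in> sets \<mu>"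
      unfolding sets using E assms(3)
      by (intro openin_sets_Sub_borel openin_Sub_topology_cylinder) auto
    moreover have "{H' \<in> Subgrps \<Gamma>. H' \<inter> insert g E = H \<inter> insert g E} \<subseteq> U"
      using E(3) by blast
    ultimately have "{H' \<in> Subgrps \<Gamma>. H' \<inter> insert g E = H \<inter> insert g E} \<in> null_sets \<mu>"
      by (rule null_sets_subset)
    then show ?thesis using E assms(3)
      by (intro exI[of _ "insert g E"] conjI impI) simp_all
  next
    case False
    then show ?thesis using assms(3) by (intro exI[of _ "{g}"] conjI impI) simp_all
  qed
  then have "\<exists>E. \<forall>H\<in>Subgrps \<Gamma>. finite (E H) \<and> E H \<subseteq> carrier \<Gamma> \<and>
      (g \<in> H \<longrightarrow> {H' \<in> Subgrps \<Gamma>. H' \<inter> E H = H \<inter> E H} \<in> null_sets \<mu>) \<and> g \<in> E H"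
    by (intro bchoice ballI)
  then obtain E where E: "\<And>H. H \<in> Subgrps \<Gamma> \<Longrightarrow> finite (E H) \<and> E H \<subseteq> carrier \<Gamma> \<and>
      (g \<in> H \<longrightarrow> {H' \<in> Subgrps \<Gamma>. H' \<inter> E H = H \<inter> E H} \<in> null_sets \<mu>) \<and> g \<in> E H"
    by blast
  obtain D where D: "finite D" "D \<subseteq> Subgrps \<Gamma>"
      "\<And>H'. H' \<in> Subgrps \<Gamma> \<Longrightarrow> \<exists>H\<in>D. H' \<inter> E H = H \<inter> E H"
    using Subgrps_finite_cylinder_cover[OF assms(1), of E] E by blast
  have "(\<Union>H\<in>{H \<in> D. g \<in> H}. {H' \<in> Subgrps \<Gamma>. H' \<inter> E H = H \<inter> E H}) \<in> null_sets \<mu>"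
    using D E by (intro null_sets.finite_UN) auto
  moreover have "{H \<in> space \<mu>. \<not> g \<notin> H} \<subseteq>
      (\<Union>H\<in>{H \<in> D. g \<in> H}. {H' \<in> Subgrps \<Gamma>. H' \<inter> E H = H \<inter> E H})"
  proof
    fix H' assume "H' \<in> {H \<in> space \<mu>. \<not> g \<notin> H}"
    then have H': "H' \<in> Subgrps \<Gamma>" "g \<in> H'" using space by auto
    obtain H where H: "H \<in> D" "H' \<inter> E H = H \<inter> E H" using D(3)[OF H'(1)] by blast
    then have "g \<in> H" using E[of H] D(2) H' by blast
    then show "H' \<in> (\<Union>H\<in>{H \<in> D. g \<in> H}. {H' \<in> Subgrps \<Gamma>. H' \<inter> E H = H \<inter> E H})"
      using H H' by blast
  qed
  ultimately show ?thesis by (rule AE_I')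
qed

lemma (in group) mult_inv_cancel [simp]:
  assumes "x \<in> carrier G" "y \<in> carrier G"
  shows "x \<otimes> (inv x \<otimes> y) = y" "inv x \<otimes> (x \<otimes> y) = y"
  using assms by (simp_all flip: m_assoc)

lemma conjH_Subgrps:
  assumes "group \<Gamma>" "g \<in> carrier \<Gamma>" "H \<in> Subgrps \<Gamma>"
  shows "conjH \<Gamma> g H \<in> Subgrps \<Gamma>"
proof -
  interpret group \<Gamma> by fact
  have "(\<lambda>h. g \<otimes>\<^bsub>\<Gamma>\<^esub> h \<otimes>\<^bsub>\<Gamma>\<^esub> inv\<^bsub>\<Gamma>\<^esub> g) \<in> hom \<Gamma> \<Gamma>"
    using assms(2) by (auto simp: hom_def m_assoc)
  then interpret group_hom \<Gamma> \<Gamma> "\<lambda>h. g \<otimes>\<^bsub>\<Gamma>\<^esub> h \<otimes>\<^bsub>\<Gamma>\<^esub> inv\<^bsub>\<Gamma>\<^esub> g"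
    by unfold_locales
  show ?thesis using assms(3) subgroup_img_is_subgroup by (auto simp: Subgrps_def conjH_def)
qed

lemma mem_conjH_iff:
  assumes "group \<Gamma>" "g \<in> carrier \<Gamma>" "H \<subseteq> carrier \<Gamma>" "x \<in> carrier \<Gamma>"
  shows "x \<in> conjH \<Gamma> g H \<longleftrightarrow> inv\<^bsub>\<Gamma>\<^esub> g \<otimes>\<^bsub>\<Gamma>\<^esub> x \<otimes>\<^bsub>\<Gamma>\<^esub> g \<in> H"
proof -
  interpret group \<Gamma> by fact
  have *: "x = g \<otimes>\<^bsub>\<Gamma>\<^esub> (inv\<^bsub>\<Gamma>\<^esub> g \<otimes>\<^bsub>\<Gamma>\<^esub> x \<otimes>\<^bsub>\<Gamma>\<^esub> g) \<otimes>\<^bsub>\<Gamma>\<^esub> inv\<^bsub>\<Gamma>\<^esub> g"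
    using assms by (simp add: m_assoc)
  have "inv\<^bsub>\<Gamma>\<^esub> g \<otimes>\<^bsub>\<Gamma>\<^esub> (g \<otimes>\<^bsub>\<Gamma>\<^esub> h \<otimes>\<^bsub>\<Gamma>\<^esub> inv\<^bsub>\<Gamma>\<^esub> g) \<otimes>\<^bsub>\<Gamma>\<^esub> g = h" if "h \<in> H" for h
    using assms that by (subgoal_tac "h \<in> carrier \<Gamma>") (auto simp: m_assoc)
  then show ?thesis using * unfolding conjH_def by (metis (no_types, lifting) image_iff)
qed

text \<open>Conjugation is continuous: agreement on \<open>E\<close> after conjugation by
  \<open>g\<close> is agreement on the finite set of all \<open>g^-1 x g\<close> with
  \<open>x\<close> in \<open>E\<close> before it.\<close>

lemma conjH_measurable:
  assumes "group \<Gamma>" "g \<in> carrier \<Gamma>"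
  shows "conjH \<Gamma> g \<in> measurable (Sub_borel \<Gamma>) (Sub_borel \<Gamma>)"
proof (rule measurable_sigma_sets[OF sets_Sub_borel])
  interpret group \<Gamma> by fact
  show "conjH \<Gamma> g \<in> space (Sub_borel \<Gamma>) \<rightarrow> Subgrps \<Gamma>"
    using conjH_Subgrps[OF assms] by auto
  fix U assume "U \<in> {U. openin (Sub_topology \<Gamma>) U}"
  then have U: "openin (Sub_topology \<Gamma>) U" by simp
  show "conjH \<Gamma> g -` U \<inter> space (Sub_borel \<Gamma>) \<in> sets (Sub_borel \<Gamma>)"
  proof (rule openin_sets_Sub_borel, subst openin_Sub_topology_iff, intro conjI ballI)
    fix H assume "H \<in> conjH \<Gamma> g -` U \<inter> space (Sub_borel \<Gamma>)"
    then have H: "H \<in> Subgrps \<Gamma>" "conjH \<Gamma> g H \<in> U" by auto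
    then obtain E where E: "finite E" "E \<subseteq> carrier \<Gamma>"
        "\<forall>H'\<in>Subgrps \<Gamma>. H' \<inter> E = conjH \<Gamma> g H \<inter> E \<longrightarrow> H' \<in> U"
      using U unfolding openin_Sub_topology_iff by blast
    let ?E = "(\<lambda>x. inv\<^bsub>\<Gamma>\<^esub> g \<otimes>\<^bsub>\<Gamma>\<^esub> x \<otimes>\<^bsub>\<Gamma>\<^esub> g) ` E"
    have "conjH \<Gamma> g H' \<in> U" if H': "H' \<in> Subgrps \<Gamma>" "H' \<inter> ?E = H \<inter> ?E" for H'
    proof -
      have "H \<subseteq> carrier \<Gamma>" "H' \<subseteq> carrier \<Gamma>"
        using H H' by (simp_all add: Subgrps_def subgroup.subset)
      note sub = this
      have "x \<in> conjH \<Gamma> g H' \<longleftrightarrow> x \<in> conjH \<Gamma> g H" if x: "x \<in> E" for x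
      proof -
        have "inv\<^bsub>\<Gamma>\<^esub> g \<otimes>\<^bsub>\<Gamma>\<^esub> x \<otimes>\<^bsub>\<Gamma>\<^esub> g \<in> ?E" using x by (rule imageI)
        then have "inv\<^bsub>\<Gamma>\<^esub> g \<otimes>\<^bsub>\<Gamma>\<^esub> x \<otimes>\<^bsub>\<Gamma>\<^esub> g \<in> H' \<longleftrightarrow> inv\<^bsub>\<Gamma>\<^esub> g \<otimes>\<^bsub>\<Gamma>\<^esub> x \<otimes>\<^bsub>\<Gamma>\<^esub> g \<in> H"
          using H'(2) by blast
        moreover have "x \<in> carrier \<Gamma>" using x E(2) by blast
        ultimately show ?thesis using mem_conjH_iff[OF assms] sub by simp
      qed
      then have "conjH \<Gamma> g H' \<inter> E = conjH \<Gamma> g H \<inter> E" by blast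
      then show ?thesis using E(3) conjH_Subgrps[OF assms H'(1)] by blast
    qed
    then show "\<exists>E. finite E \<and> E \<subseteq> carrier \<Gamma> \<and>
        (\<forall>H'\<in>Subgrps \<Gamma>. H' \<inter> E = H \<inter> E \<longrightarrow> H' \<in> conjH \<Gamma> g -` U \<inter> space (Sub_borel \<Gamma>))"
      using E(1,2) assms(2) by (intro exI[of _ ?E] conjI ballI impI) auto
  qed auto
qed (use openin_Sub_topology_subset in auto)

section \<open>Finite-index approximation through windows\<close>

lemma conjH_mult:
  assumes "group \<Gamma>" "g \<in> carrier \<Gamma>" "h \<in> carrier \<Gamma>" "A \<subseteq> carrier \<Gamma>"
  shows "conjH \<Gamma> g (conjH \<Gamma> h A) = conjH \<Gamma> (g \<otimes>\<^bsub>\<Gamma>\<^esub> h) A"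
proof -
  interpret group \<Gamma> by fact
  show ?thesis
    unfolding conjH_def image_image
    by (intro image_cong refl) (use assms in \<open>auto simp: m_assoc inv_mult_group subset_iff\<close>)
qed

lemma conjH_subset_carrier:
  assumes "group \<Gamma>" "g \<in> carrier \<Gamma>" "A \<subseteq> carrier \<Gamma>"
  shows "conjH \<Gamma> g A \<subseteq> carrier \<Gamma>"
proof -
  interpret group \<Gamma> by fact
  show ?thesis using assms by (auto simp: conjH_def)
qed

lemma conjH_self:
  assumes "group \<Gamma>" "subgroup A \<Gamma>" "g \<in> A"
  shows "conjH \<Gamma> g A = A"
proof -
  interpret group \<Gamma> by fact
  have A: "A \<subseteq> carrier \<Gamma>" using assms(2) by (rule subgroup.subset)
  have "x \<in> conjH \<Gamma> g A \<longleftrightarrow> x \<in> A" if x: "x \<in> carrier \<Gamma>" for x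
  proof -
    have "x = g \<otimes>\<^bsub>\<Gamma>\<^esub> (inv\<^bsub>\<Gamma>\<^esub> g \<otimes>\<^bsub>\<Gamma>\<^esub> x \<otimes>\<^bsub>\<Gamma>\<^esub> g) \<otimes>\<^bsub>\<Gamma>\<^esub> inv\<^bsub>\<Gamma>\<^esub> g"
      using A assms x by (auto simp: m_assoc subset_iff)
    then have "inv\<^bsub>\<Gamma>\<^esub> g \<otimes>\<^bsub>\<Gamma>\<^esub> x \<otimes>\<^bsub>\<Gamma>\<^esub> g \<in> A \<longleftrightarrow> x \<in> A"
      using assms(2,3) by (metis subgroup.m_closed subgroup.m_inv_closed)
    then show ?thesis using mem_conjH_iff[OF assms(1) _ A x] A assms(3) by blast
  qed
  moreover have "conjH \<Gamma> g A \<subseteq> carrier \<Gamma>"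
    using A assms(3) by (intro conjH_subset_carrier[OF assms(1)]) auto
  ultimately show ?thesis using A by blast
qed

lemma conjH_set_mult:
  assumes "group \<Gamma>" "g \<in> carrier \<Gamma>" "A \<subseteq> carrier \<Gamma>" "B \<subseteq> carrier \<Gamma>"
  shows "conjH \<Gamma> g (A <#>\<^bsub>\<Gamma>\<^esub> B) = conjH \<Gamma> g A <#>\<^bsub>\<Gamma>\<^esub> conjH \<Gamma> g B"
proof -
  interpret group \<Gamma> by fact
  have "g \<otimes>\<^bsub>\<Gamma>\<^esub> (a \<otimes>\<^bsub>\<Gamma>\<^esub> b) \<otimes>\<^bsub>\<Gamma>\<^esub> inv\<^bsub>\<Gamma>\<^esub> g =
      (g \<otimes>\<^bsub>\<Gamma>\<^esub> a \<otimes>\<^bsub>\<Gamma>\<^esub> inv\<^bsub>\<Gamma>\<^esub> g) \<otimes>\<^bsub>\<Gamma>\<^esub> (g \<otimes>\<^bsub>\<Gamma>\<^esub> b \<otimes>\<^bsub>\<Gamma>\<^esub> inv\<^bsub>\<Gamma>\<^esub> g)"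
    if "a \<in> A" "b \<in> B" for a b
  proof -
    have "a \<in> carrier \<Gamma>" "b \<in> carrier \<Gamma>" using that assms by auto
    then show ?thesis using assms(2) by (simp add: m_assoc)
  qed
  then show ?thesis
    unfolding conjH_def set_mult_def by (auto simp: image_iff) metis+
qed

lemma conjH_normal:
  assumes "K \<lhd> \<Gamma>" "g \<in> carrier \<Gamma>"
  shows "conjH \<Gamma> g K = K"
proof -
  interpret normal K \<Gamma> by fact
  have "x \<in> conjH \<Gamma> g K" if "x \<in> K" for x
  proof -
    have "inv\<^bsub>\<Gamma>\<^esub> g \<otimes>\<^bsub>\<Gamma>\<^esub> x \<otimes>\<^bsub>\<Gamma>\<^esub> g \<in> K" using inv_op_closed1[OF assms(2) that] .
    then show ?thesis using mem_conjH_iff[OF is_group assms(2) subset] that subset by blast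
  qed
  moreover have "conjH \<Gamma> g K \<subseteq> K"
    using inv_op_closed2[OF assms(2)] by (auto simp: conjH_def)
  ultimately show ?thesis by blast
qed

text \<open>A right coset of \<open>S\<close> is determined by the value of \<open>\<phi>\<close> at
  any of its elements, so there are at most as many cosets as values. Any invariant with finitely
  many values will do, homomorphism or not.\<close>

lemma (in group) finite_rcosets_factor:
  assumes "subgroup S G" "finite (\<phi> ` carrier G)"
    and "\<And>g h. g \<in> carrier G \<Longrightarrow> h \<in> carrier G \<Longrightarrow> \<phi> g = \<phi> h \<Longrightarrow> g \<otimes> inv h \<in> S"
  shows "finite (rcosets S)"
proof -
  define \<psi> where "\<psi> v = S #> (SOME g. g \<in> carrier G \<and> \<phi> g = v)" for v
  have "S #> g = \<psi> (\<phi> g)" if g: "g \<in> carrier G" for g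
  proof -
    define h where "h = (SOME h. h \<in> carrier G \<and> \<phi> h = \<phi> g)"
    have h: "h \<in> carrier G" "\<phi> h = \<phi> g"
      using someI[of "\<lambda>h. h \<in> carrier G \<and> \<phi> h = \<phi> g" g] g by (auto simp: h_def)
    then have "h \<otimes> inv g \<in> S" using assms(3) g by simp
    then have "h \<otimes> inv g \<otimes> g \<in> S #> g"
      by (rule rcosI[OF _ subgroup.subset[OF assms(1)] g])
    then have "h \<in> S #> g" using h g by (simp add: m_assoc)
    then have "S #> g = S #> h" by (rule repr_independence[OF _ g assms(1)])
    then show ?thesis unfolding \<psi>_def h_def .
  qed
  then have "rcosets S \<subseteq> \<psi> ` \<phi> ` carrier G"
    unfolding RCOSETS_def by blast
  then show ?thesis using assms(2) finite_subset by blast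
qed

lemma (in group) finite_rcosets_mono:
  assumes "subgroup S G" "subgroup K G" "K \<subseteq> S" "finite (rcosets K)"
  shows "finite (rcosets S)"
proof (rule finite_rcosets_factor[OF assms(1), of "\<lambda>g. K #> g"])
  show "finite ((#>) K ` carrier G)"
    using assms(4) by (rule finite_subset[rotated]) (auto simp: RCOSETS_def)
  fix g h assume gh: "g \<in> carrier G" "h \<in> carrier G" "K #> g = K #> h"
  then have "g \<in> K #> h" using rcos_self[OF gh(1) assms(2)] by simp
  then obtain k where "k \<in> K" "g = k \<otimes> h" by (auto simp: r_coset_def)
  moreover have "k \<in> carrier G" using \<open>k \<in> K\<close> subgroup.subset[OF assms(2)] by blast
  ultimately show "g \<otimes> inv h \<in> S" using assms(3) gh by (auto simp: m_assoc)
qed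

text \<open>By \<open>cover\<close> and \<open>uniq\<close> the elements \<open>t j\<close> with
  \<open>j < w\<close> represent the left cosets of \<open>Y K\<close>, and \<open>Y\<close> is a
  complement of the normal subgroup \<open>K\<close> in it. The averaging argument uses this
  configuration alone and nothing about permutations.\<close>

locale irs_window = group \<Gamma> for \<Gamma> (structure) +
  fixes \<mu> :: "'a set measure" and K Y :: "'a set" and t :: "nat \<Rightarrow> 'a" and w :: nat
  assumes IRS: "IRS \<Gamma> \<mu>"
    and K: "K \<lhd> \<Gamma>" "finite (rcosets K)"
    and Y: "subgroup Y \<Gamma>" "Y \<inter> K = {\<one>}"
    and w: "0 < w"
    and t: "\<And>j. t j \<in> carrier \<Gamma>"
    and cover: "\<And>g. g \<in> carrier \<Gamma> \<Longrightarrow> \<exists>j<w. \<exists>y\<in>Y. \<exists>k\<in>K. g = t j \<otimes> y \<otimes> k"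
    and uniq: "\<And>i j y k. i < w \<Longrightarrow> j < w \<Longrightarrow> y \<in> Y \<Longrightarrow> k \<in> K \<Longrightarrow> t j = t i \<otimes> y \<otimes> k \<Longrightarrow> i = j"
begin

definition \<Theta> :: "nat \<Rightarrow> 'a set \<Rightarrow> 'a set" where
  "\<Theta> j H = conjH \<Gamma> (t j) (K <#> (H \<inter> Y))"

lemma K_sub: "subgroup K \<Gamma>" using K(1) by (rule normal_imp_subgroup)

text \<open>Since \<open>Y\<close> meets \<open>K\<close> trivially, it embeds into the finite set
  of cosets of \<open>K\<close>.\<close>

lemma finite_Y: "finite Y"
proof -
  have "inj_on (\<lambda>y. K #> y) Y"
  proof (rule inj_onI)
    fix x y assume xy: "x \<in> Y" "y \<in> Y" "K #> x = K #> y"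
    then have c: "x \<in> carrier \<Gamma>" "y \<in> carrier \<Gamma>" using subgroup.subset[OF Y(1)] by auto
    then have "x \<in> K #> y" using rcos_self[OF c(1) K_sub] xy by simp
    then obtain k where k: "k \<in> K" "x = k \<otimes> y" by (auto simp: r_coset_def)
    then have "k \<in> carrier \<Gamma>" using subgroup.subset[OF K_sub] by auto
    then have "k = x \<otimes> inv y" using k c by (simp add: m_assoc)
    then have "k \<in> Y" using xy Y(1) by (simp add: subgroup.m_closed subgroup.m_inv_closed)
    then have "k = \<one>" using k Y by auto
    then show "x = y" using k c by simp
  qed
  moreover have "(\<lambda>y. K #> y) ` Y \<subseteq> rcosets K"
    using subgroup.subset[OF Y(1)] by (auto simp: RCOSETS_def)
  ultimately show ?thesis using K(2) by (metis finite_subset finite_imageD)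
qed

lemma sets_\<mu> [simp]: "sets \<mu> = sets (Sub_borel \<Gamma>)" using IRS by (simp add: IRS_def)
lemma space_\<mu> [simp]: "space \<mu> = Subgrps \<Gamma>" using sets_\<mu> by (metis sets_eq_imp_space_eq space_Sub_borel)

sublocale prob_space \<mu> using IRS by (simp add: IRS_def)

lemma block_subgroup:
  assumes "H \<in> Subgrps \<Gamma>" shows "subgroup (K <#> (H \<inter> Y)) \<Gamma>"
  using assms Y(1) K(1) by (intro mult_norm_subgroup subgroups_Inter_pair) (auto simp: Subgrps_def)

lemma K_subset_block:
  assumes "H \<in> Subgrps \<Gamma>" shows "K \<subseteq> K <#> (H \<inter> Y)"
proof
  fix k assume k: "k \<in> K"
  have "\<one> \<in> H \<inter> Y" using assms Y(1) by (auto simp: Subgrps_def subgroup.one_closed)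
  moreover have "k = k \<otimes> \<one>" using k subgroup.subset[OF K_sub] by auto
  ultimately show "k \<in> K <#> (H \<inter> Y)" using k unfolding set_mult_def by blast
qed

lemma \<Theta>_Subgrps: "H \<in> Subgrps \<Gamma> \<Longrightarrow> \<Theta> j H \<in> Subgrps \<Gamma>"
  unfolding \<Theta>_def by (rule conjH_Subgrps[OF is_group t]) (simp add: block_subgroup Subgrps_def[of \<Gamma>])

lemma \<Theta>_finite_index:
  assumes "H \<in> Subgrps \<Gamma>" shows "finite_index_subgroup \<Gamma> (\<Theta> j H)"
proof -
  have s: "subgroup (\<Theta> j H) \<Gamma>" using \<Theta>_Subgrps[OF assms] by (simp add: Subgrps_def)
  have "conjH \<Gamma> (t j) K \<subseteq> \<Theta> j H"
    unfolding \<Theta>_def conjH_def using K_subset_block[OF assms] by (rule image_mono)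
  then have "K \<subseteq> \<Theta> j H" using conjH_normal[OF K(1) t] by simp
  then show ?thesis
    unfolding finite_index_subgroup_def using s finite_rcosets_mono[OF s K_sub _ K(2)] by blast
qed

text \<open>The value depends on \<open>H\<close> only through \<open>H \<inter> Y\<close>, one of
  finitely many subsets of \<open>Y\<close>, so every preimage is a finite union of
  cylinders.\<close>

lemma \<Theta>_measurable: "\<Theta> j \<in> measurable (Sub_borel \<Gamma>) (Sub_borel \<Gamma>)"
proof (rule measurableI)
  fix A assume "A \<in> sets (Sub_borel \<Gamma>)"
  have "\<Theta> j (H \<inter> Y) = \<Theta> j H" for H by (simp add: \<Theta>_def Int_assoc)
  then have "\<Theta> j -` A \<inter> space (Sub_borel \<Gamma>) =
      (\<Union>S\<in>{S \<in> Pow Y. \<Theta> j S \<in> A}. {H \<in> Subgrps \<Gamma>. H \<inter> Y = S \<inter> Y})"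
    by (auto simp: \<Theta>_def)
  also have "\<dots> \<in> sets (Sub_borel \<Gamma>)"
    using finite_Y subgroup.subset[OF Y(1)]
    by (intro sets.finite_UN openin_sets_Sub_borel openin_Sub_topology_cylinder) auto
  finally show "\<Theta> j -` A \<inter> space (Sub_borel \<Gamma>) \<in> sets (Sub_borel \<Gamma>)" .
qed (use \<Theta>_Subgrps in auto)

text \<open>The block \<open>K (H \<inter> Y)\<close> contains \<open>K\<close>, so conjugation by
  \<open>k\<close> fixes it. Conjugation by \<open>y\<close> preserves both \<open>K\<close> and
  \<open>Y\<close> and therefore acts only on \<open>H\<close>. What remains of \<open>g\<close> is
  the change of coset from \<open>t j\<close> to \<open>t i\<close>.\<close>

lemma conjH_\<Theta>:
  assumes "H \<in> Subgrps \<Gamma>" "g \<in> carrier \<Gamma>" "y \<in> Y" "k \<in> K" "g \<otimes> t j = t i \<otimes> y \<otimes> k"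
  shows "conjH \<Gamma> g (\<Theta> j H) = \<Theta> i (conjH \<Gamma> y H)"
proof -
  let ?A = "K <#> (H \<inter> Y)"
  have A: "subgroup ?A \<Gamma>" using assms(1) by (rule block_subgroup)
  then have Ac: "?A \<subseteq> carrier \<Gamma>" by (rule subgroup.subset)
  have yc: "y \<in> carrier \<Gamma>" using assms Y(1) subgroup.subset by blast
  have kc: "k \<in> carrier \<Gamma>" using assms K_sub subgroup.subset by blast
  have Hc: "H \<subseteq> carrier \<Gamma>" using assms(1) by (simp add: Subgrps_def subgroup.subset)
  have "conjH \<Gamma> g (\<Theta> j H) = conjH \<Gamma> (t i \<otimes> y \<otimes> k) ?A"
    unfolding \<Theta>_def using conjH_mult[OF is_group assms(2) t Ac] assms(5) by simp
  also have "\<dots> = conjH \<Gamma> (t i) (conjH \<Gamma> y (conjH \<Gamma> k ?A))"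
    using conjH_mult[OF is_group] conjH_subset_carrier[OF is_group] Ac yc kc t
    by (simp add: m_assoc)
  also have "conjH \<Gamma> k ?A = ?A"
    using K_subset_block[OF assms(1)] assms(4) by (intro conjH_self[OF is_group A]) auto
  also have "conjH \<Gamma> y ?A = conjH \<Gamma> y K <#> conjH \<Gamma> y (H \<inter> Y)"
    using Hc yc subgroup.subset[OF K_sub] by (intro conjH_set_mult[OF is_group]) auto
  also have "conjH \<Gamma> y K = K" by (rule conjH_normal[OF K(1) yc])
  also have "conjH \<Gamma> y (H \<inter> Y) = conjH \<Gamma> y H \<inter> conjH \<Gamma> y Y"
  proof -
    have "inj_on (\<lambda>h. y \<otimes> h \<otimes> inv y) (carrier \<Gamma>)"
      using yc by (auto intro!: inj_onI)
    then show ?thesis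
      unfolding conjH_def by (rule inj_on_image_Int) (use Hc subgroup.subset[OF Y(1)] in auto)
  qed
  also have "conjH \<Gamma> y Y = Y" by (rule conjH_self[OF is_group Y(1) assms(3)])
  finally show ?thesis unfolding \<Theta>_def .
qed

definition law :: "nat \<Rightarrow> 'a set measure" where "law j = distr \<mu> (Sub_borel \<Gamma>) (\<Theta> j)"

lemma \<Theta>_measurable' [measurable]: "\<Theta> j \<in> measurable \<mu> (Sub_borel \<Gamma>)"
  using \<Theta>_measurable[of j] measurable_cong_sets[OF sets_\<mu> refl] by blast

lemma conj_measurable':
  "g \<in> carrier \<Gamma> \<Longrightarrow> conjH \<Gamma> g \<in> measurable \<mu> \<mu>"
  using conjH_measurable[OF is_group, of g] measurable_cong_sets[OF sets_\<mu> sets_\<mu>] by blast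

text \<open>The factor \<open>y\<close> that \<open>conjH_\<Theta>\<close> leaves on
  \<open>H\<close> is absorbed by the invariance of \<mu>.\<close>

lemma distr_law:
  assumes "g \<in> carrier \<Gamma>" "y \<in> Y" "k \<in> K" "g \<otimes> t j = t i \<otimes> y \<otimes> k"
  shows "distr (law j) (Sub_borel \<Gamma>) (conjH \<Gamma> g) = law i"
proof -
  have yc: "y \<in> carrier \<Gamma>" using assms Y(1) subgroup.subset by blast
  have "distr (law j) (Sub_borel \<Gamma>) (conjH \<Gamma> g) = distr \<mu> (Sub_borel \<Gamma>) (conjH \<Gamma> g \<circ> \<Theta> j)"
    unfolding law_def by (rule distr_distr[OF conjH_measurable[OF is_group assms(1)] \<Theta>_measurable'])
  also have "\<dots> = distr \<mu> (Sub_borel \<Gamma>) (\<Theta> i \<circ> conjH \<Gamma> y)"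
    by (rule distr_cong) (use conjH_\<Theta> assms in auto)
  also have "\<dots> = distr (distr \<mu> \<mu> (conjH \<Gamma> y)) (Sub_borel \<Gamma>) (\<Theta> i)"
    by (rule distr_distr[OF \<Theta>_measurable' conj_measurable'[OF yc], symmetric])
  also have "distr \<mu> \<mu> (conjH \<Gamma> y) = \<mu>" using IRS yc by (simp add: IRS_def)
  finally show ?thesis unfolding law_def .
qed

definition \<nu> :: "'a set measure" where
  "\<nu> = measure_pmf (pmf_of_set {..<w}) \<bind> law"

lemma prob_space_law: "prob_space (law j)"
  unfolding law_def by (rule prob_space_distr[OF \<Theta>_measurable'])

lemma law_kernel: "law \<in> measurable (measure_pmf (pmf_of_set {..<w})) (subprob_algebra (Sub_borel \<Gamma>))"
proof -
  have "sets (law j) = sets (Sub_borel \<Gamma>)" for j by (simp add: law_def)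
  then show ?thesis
    by (auto simp: space_subprob_algebra prob_space_imp_subprob_space[OF prob_space_law])
qed

lemma sets_\<nu> [simp]: "sets \<nu> = sets (Sub_borel \<Gamma>)"
  unfolding \<nu>_def by (rule sets_bind) (auto simp: law_def)

lemma emeasure_\<nu>:
  assumes "A \<in> sets (Sub_borel \<Gamma>)"
  shows "emeasure \<nu> A = (\<Sum>j<w. emeasure (law j) A) / w"
  unfolding \<nu>_def
  by (subst emeasure_bind[OF _ law_kernel assms], simp, subst nn_integral_pmf_of_set) (use w in auto)

lemma prob_space_\<nu>: "prob_space \<nu>"
proof
  have "emeasure \<nu> (Subgrps \<Gamma>) = (\<Sum>j<w. emeasure (law j) (space (law j))) / w"
    by (subst emeasure_\<nu>) (use sets.top[of "Sub_borel \<Gamma>"] in \<open>auto simp: law_def\<close>)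
  also have "\<dots> = of_nat w / of_nat w"
    using prob_space.emeasure_space_1[OF prob_space_law] by simp
  also have "\<dots> = 1" using w by (intro ennreal_divide_self) (auto simp: of_nat_less_top)
  also have "Subgrps \<Gamma> = space \<nu>" using sets_\<nu> by (metis sets_eq_imp_space_eq space_Sub_borel)
  finally show "emeasure \<nu> (space \<nu>) = 1" .
qed

text \<open>Left translation by \<open>g\<close> permutes the left cosets of \<open>Y K\<close>; on
  the finite index set injectivity is enough.\<close>

lemma translate_permutes:
  assumes "g \<in> carrier \<Gamma>"
  obtains \<sigma> where "bij_betw \<sigma> {..<w} {..<w}"
    "\<And>j. j < w \<Longrightarrow> \<exists>y\<in>Y. \<exists>k\<in>K. g \<otimes> t j = t (\<sigma> j) \<otimes> y \<otimes> k"
proof -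
  have "\<forall>j. \<exists>i<w. \<exists>y\<in>Y. \<exists>k\<in>K. g \<otimes> t j = t i \<otimes> y \<otimes> k"
    using cover assms t by simp
  then obtain \<sigma> where \<sigma>: "\<And>j. \<sigma> j < w" "\<And>j. \<exists>y\<in>Y. \<exists>k\<in>K. g \<otimes> t j = t (\<sigma> j) \<otimes> y \<otimes> k"
    by metis
  have "inj_on \<sigma> {..<w}"
  proof (rule inj_onI)
    fix i j assume ij: "i \<in> {..<w}" "j \<in> {..<w}" "\<sigma> i = \<sigma> j"
    obtain y k where yk: "y \<in> Y" "k \<in> K" "g \<otimes> t i = t (\<sigma> j) \<otimes> y \<otimes> k" using \<sigma>(2)[of i] ij by auto
    obtain y' k' where yk': "y' \<in> Y" "k' \<in> K" "g \<otimes> t j = t (\<sigma> j) \<otimes> y' \<otimes> k'" using \<sigma>(2)[of j] by auto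
    have c: "y \<in> carrier \<Gamma>" "y' \<in> carrier \<Gamma>" "k \<in> carrier \<Gamma>" "k' \<in> carrier \<Gamma>"
      using yk yk' subgroup.subset[OF Y(1)] subgroup.subset[OF K_sub] by auto
    \<comment> \<open>Cancelling \<open>g\<close> gives \<open>t j = t i k^-1 ?z k'\<close>. Moving
      the factor \<open>k^-1\<close> past \<open>?z\<close> replaces it by its conjugate, which
      stays in the normal subgroup \<open>K\<close>.\<close>
    let ?z = "inv y \<otimes> y'"
    let ?k = "inv ?z \<otimes> inv k \<otimes> ?z \<otimes> k'"
    have zY: "?z \<in> Y" using yk yk' Y(1) by (simp add: subgroup.m_closed subgroup.m_inv_closed)
    have kK: "?k \<in> K"
      using yk yk' c K_sub normal.inv_op_closed1[OF K(1), of ?z "inv k"]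
      by (simp add: subgroup.m_closed subgroup.m_inv_closed)
    have "t i = inv g \<otimes> (t (\<sigma> j) \<otimes> y \<otimes> k)" using yk(3) assms t by (metis inv_solve_left m_closed c(1,3))
    moreover have "t j = inv g \<otimes> (t (\<sigma> j) \<otimes> y' \<otimes> k')" using yk'(3) assms t by (metis inv_solve_left m_closed c(2,4))
    ultimately have "t j = t i \<otimes> ?z \<otimes> ?k" using c t assms by (simp add: m_assoc inv_mult_group)
    then show "i = j" using uniq zY kK ij by blast
  qed
  moreover have "\<sigma> ` {..<w} \<subseteq> {..<w}" using \<sigma>(1) by auto
  ultimately have "bij_betw \<sigma> {..<w} {..<w}"
    by (simp add: bij_betw_def endo_inj_surj)
  then show thesis using that \<sigma>(2) by blast
qed

lemma IRS_\<nu>: "IRS \<Gamma> \<nu>"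
proof -
  have "distr \<nu> \<nu> (conjH \<Gamma> g) = \<nu>" if g: "g \<in> carrier \<Gamma>" for g
  proof (rule measure_eqI)
    fix A assume "A \<in> sets (distr \<nu> \<nu> (conjH \<Gamma> g))"
    then have A: "A \<in> sets (Sub_borel \<Gamma>)" by simp
    obtain \<sigma> where \<sigma>: "bij_betw \<sigma> {..<w} {..<w}"
        "\<And>j. j < w \<Longrightarrow> \<exists>y\<in>Y. \<exists>k\<in>K. g \<otimes> t j = t (\<sigma> j) \<otimes> y \<otimes> k"
      using translate_permutes[OF g] by blast
    have space: "space \<nu> = Subgrps \<Gamma>" using sets_\<nu> by (metis sets_eq_imp_space_eq space_Sub_borel)
    have m: "conjH \<Gamma> g \<in> measurable (Sub_borel \<Gamma>) (Sub_borel \<Gamma>)" by (rule conjH_measurable[OF is_group g])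
    then have "conjH \<Gamma> g \<in> measurable \<nu> \<nu>" using measurable_cong_sets[OF sets_\<nu> sets_\<nu>] by blast
    then have "emeasure (distr \<nu> \<nu> (conjH \<Gamma> g)) A = emeasure \<nu> (conjH \<Gamma> g -` A \<inter> Subgrps \<Gamma>)"
      using A by (subst emeasure_distr) (auto simp: space)
    also have "\<dots> = (\<Sum>j<w. emeasure (law j) (conjH \<Gamma> g -` A \<inter> Subgrps \<Gamma>)) / w"
      using measurable_sets[OF m A] by (intro emeasure_\<nu>) simp
    also have "(\<Sum>j<w. emeasure (law j) (conjH \<Gamma> g -` A \<inter> Subgrps \<Gamma>)) = (\<Sum>j<w. emeasure (law (\<sigma> j)) A)"
    proof (rule sum.cong[OF refl])
      fix j assume "j \<in> {..<w}"
      then have "distr (law j) (Sub_borel \<Gamma>) (conjH \<Gamma> g) = law (\<sigma> j)"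
        using \<sigma>(2)[of j] distr_law[OF g] by auto
      then have "emeasure (law (\<sigma> j)) A = emeasure (distr (law j) (Sub_borel \<Gamma>) (conjH \<Gamma> g)) A" by simp
      also have "\<dots> = emeasure (law j) (conjH \<Gamma> g -` A \<inter> Subgrps \<Gamma>)"
        using m A by (subst emeasure_distr) (auto simp: law_def)
      finally show "emeasure (law j) (conjH \<Gamma> g -` A \<inter> Subgrps \<Gamma>) = emeasure (law (\<sigma> j)) A" by simp
    qed
    also have "\<dots> = (\<Sum>j<w. emeasure (law j) A)" by (rule sum.reindex_bij_betw[OF \<sigma>(1)])
    also have "\<dots> / w = emeasure \<nu> A" using emeasure_\<nu>[OF A] by simp
    finally show "emeasure (distr \<nu> \<nu> (conjH \<Gamma> g)) A = emeasure \<nu> A" .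
  qed simp
  then show ?thesis unfolding IRS_def using prob_space_\<nu> by simp
qed

text \<open>Singletons are closed, since two different subgroups are told apart by a single
  element.\<close>

lemma finite_Sub_borel:
  assumes "finite C" "C \<subseteq> Subgrps \<Gamma>"
  shows "C \<in> sets (Sub_borel \<Gamma>)"
proof -
  have "{H} \<in> sets (Sub_borel \<Gamma>)" if H: "H \<in> Subgrps \<Gamma>" for H
  proof -
    have "openin (Sub_topology \<Gamma>) (Subgrps \<Gamma> - {H})"
      unfolding openin_Sub_topology_iff
    proof (intro conjI ballI)
      fix H' assume H': "H' \<in> Subgrps \<Gamma> - {H}"
      have "H \<subseteq> carrier \<Gamma>" "H' \<subseteq> carrier \<Gamma>"
        using H H' by (simp_all add: Subgrps_def subgroup.subset)
      then obtain g where g: "g \<in> carrier \<Gamma>" "g \<in> H \<longleftrightarrow> g \<notin> H'" using H' by blast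
      then have "H'' \<in> Subgrps \<Gamma> - {H}" if "H'' \<in> Subgrps \<Gamma>" "H'' \<inter> {g} = H' \<inter> {g}" for H''
        using that by blast
      then show "\<exists>E. finite E \<and> E \<subseteq> carrier \<Gamma> \<and>
          (\<forall>H''\<in>Subgrps \<Gamma>. H'' \<inter> E = H' \<inter> E \<longrightarrow> H'' \<in> Subgrps \<Gamma> - {H})"
        using g(1) by (intro exI[of _ "{g}"] conjI ballI impI) simp_all
    qed blast
    then have "Subgrps \<Gamma> - (Subgrps \<Gamma> - {H}) \<in> sets (Sub_borel \<Gamma>)"
      by (intro sets.compl_sets[of _ "Sub_borel \<Gamma>", simplified] openin_sets_Sub_borel)
    moreover have "Subgrps \<Gamma> - (Subgrps \<Gamma> - {H}) = {H}" using H by blast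
    ultimately show ?thesis by simp
  qed
  then have "(\<Union>H\<in>C. {H}) \<in> sets (Sub_borel \<Gamma>)"
    using assms by (intro sets.finite_UN) auto
  then show ?thesis by simp
qed

text \<open>Each \<open>\<Theta> j\<close> is determined by \<open>H \<inter> Y\<close> and so takes
  finitely many values, all of finite index because they contain \<open>K\<close>.\<close>

lemma finite_index_IRS_\<nu>: "finite_index_IRS \<Gamma> \<nu>"
proof -
  define C where "C = (\<Union>j<w. \<Theta> j ` Subgrps \<Gamma>)"
  have "\<Theta> j ` Subgrps \<Gamma> \<subseteq> \<Theta> j ` Pow Y" for j
  proof (rule image_subsetI)
    fix H
    show "\<Theta> j H \<in> \<Theta> j ` Pow Y"
      by (rule image_eqI[of _ _ "H \<inter> Y"]) (simp_all add: \<Theta>_def Int_assoc)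
  qed
  then have "finite (\<Theta> j ` Subgrps \<Gamma>)" for j
    using finite_Y by (meson finite_Pow_iff finite_imageI finite_subset)
  then have fin: "finite C" unfolding C_def by simp
  have C: "C \<in> sets (Sub_borel \<Gamma>)"
    using fin \<Theta>_Subgrps by (intro finite_Sub_borel) (auto simp: C_def)
  have "emeasure (law j) C = 1" if "j < w" for j
  proof -
    have "emeasure (law j) C = emeasure \<mu> (\<Theta> j -` C \<inter> space \<mu>)"
      unfolding law_def using C by (intro emeasure_distr) simp_all
    also have "\<Theta> j -` C \<inter> space \<mu> = space \<mu>" using that by (auto simp: C_def)
    finally show ?thesis by (simp only: emeasure_space_1)
  qed
  then have "emeasure \<nu> C = of_nat w / of_nat w" using emeasure_\<nu>[OF C] by simp
  also have "\<dots> = 1" using w by (intro ennreal_divide_self) (auto simp: of_nat_less_top)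
  finally have "emeasure \<nu> C = 1" .
  moreover have "C \<subseteq> {H. finite_index_subgroup \<Gamma> H}" using \<Theta>_finite_index by (auto simp: C_def)
  moreover have "countable C" using fin by (rule countable_finite)
  ultimately show ?thesis unfolding finite_index_IRS_def using IRS_\<nu> C by auto
qed

lemma integral_\<nu>:
  assumes "f \<in> borel_measurable (Sub_borel \<Gamma>)" "\<And>H. H \<in> Subgrps \<Gamma> \<Longrightarrow> \<bar>f H\<bar> \<le> (B::real)"
  shows "integral\<^sup>L \<nu> f = (\<Sum>j<w. \<integral>H. f (\<Theta> j H) \<partial>\<mu>) / w"
proof -
  have "integral\<^sup>L \<nu> f = (\<integral>j. integral\<^sup>L (law j) f \<partial>measure_pmf (pmf_of_set {..<w}))"
    unfolding \<nu>_def
  proof (rule integral_bind[OF assms(1) _ law_kernel, of B 1])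
    show "AE j in measure_pmf (pmf_of_set {..<w}). emeasure (law j) (space (law j)) \<le> ennreal 1"
      using prob_space.emeasure_space_1[OF prob_space_law] by simp
  qed (use assms(2) in \<open>auto intro: measure_pmf.finite_measure_axioms\<close>)
  also have "\<dots> = (\<Sum>j<w. integral\<^sup>L (law j) f) / w"
    by (subst integral_pmf_of_set) (use w in auto)
  also have "\<dots> = (\<Sum>j<w. \<integral>H. f (\<Theta> j H) \<partial>\<mu>) / w"
    unfolding law_def by (subst integral_distr[OF \<Theta>_measurable' assms(1)]) simp
  finally show ?thesis .
qed

lemma integral_conj:
  assumes "f \<in> borel_measurable (Sub_borel \<Gamma>)" "g \<in> carrier \<Gamma>"
  shows "(\<integral>H. f (conjH \<Gamma> g H) \<partial>\<mu>) = integral\<^sup>L \<mu> (f :: _ \<Rightarrow> real)"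
proof -
  have f: "f \<in> borel_measurable \<mu>" using assms(1) measurable_cong_sets[OF sets_\<mu> refl] by blast
  have "integral\<^sup>L \<mu> f = integral\<^sup>L (distr \<mu> \<mu> (conjH \<Gamma> g)) f" using IRS assms(2) by (simp add: IRS_def)
  also have "\<dots> = (\<integral>H. f (conjH \<Gamma> g H) \<partial>\<mu>)"
    by (rule integral_distr[OF conj_measurable'[OF assms(2)] f])
  finally show ?thesis by simp
qed

text \<open>If the conjugate of \<open>x\<close> lies in \<open>Y\<close>, the claim is that
  \<open>K (H \<inter> Y)\<close> meets \<open>Y\<close> in exactly \<open>H \<inter> Y\<close>,
  which follows from the triviality of \<open>Y \<inter> K\<close>. In the other case neither side
  contains \<open>x\<close>.\<close>

lemma \<Theta>_agrees:
  assumes H: "H \<in> Subgrps \<Gamma>" and x: "x \<in> carrier \<Gamma>"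
    and "inv (t j) \<otimes> x \<otimes> t j \<in> Y \<or> x \<notin> conjH \<Gamma> (t j) H \<and> inv (t j) \<otimes> x \<otimes> t j \<notin> K <#> Y"
  shows "x \<in> \<Theta> j H \<longleftrightarrow> x \<in> conjH \<Gamma> (t j) H"
proof -
  have Hc: "H \<subseteq> carrier \<Gamma>" using H by (simp add: Subgrps_def subgroup.subset)
  let ?z = "inv (t j) \<otimes> x \<otimes> t j"
  have 1: "x \<in> \<Theta> j H \<longleftrightarrow> ?z \<in> K <#> (H \<inter> Y)"
    unfolding \<Theta>_def
    by (rule mem_conjH_iff[OF is_group t subgroup.subset[OF block_subgroup[OF H]] x])
  have 2: "x \<in> conjH \<Gamma> (t j) H \<longleftrightarrow> ?z \<in> H"
    by (rule mem_conjH_iff[OF is_group t Hc x])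
  show ?thesis
  proof (cases "?z \<in> Y")
    case True
    have "?z \<in> H" if z: "?z \<in> K <#> (H \<inter> Y)"
    proof -
      obtain k h where kh: "k \<in> K" "h \<in> H" "h \<in> Y" "?z = k \<otimes> h"
        using z unfolding set_mult_def by blast
      have c: "k \<in> carrier \<Gamma>" "h \<in> carrier \<Gamma>" using kh Hc subgroup.subset[OF K_sub] by auto
      then have "k = ?z \<otimes> inv h" using kh(4) by (simp add: m_assoc)
      then have "k \<in> Y" using True kh(3) Y(1) by (simp add: subgroup.m_closed subgroup.m_inv_closed)
      then have "k = \<one>" using kh(1) Y(2) by auto
      then show ?thesis using kh c by simp
    qed
    moreover have "?z \<in> K <#> (H \<inter> Y)" if "?z \<in> H"
    proof -
      have "\<one> \<in> K" using K_sub by (rule subgroup.one_closed)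
      moreover have "?z = \<one> \<otimes> ?z" using x t by simp
      ultimately show ?thesis using that True unfolding set_mult_def by blast
    qed
    ultimately show ?thesis using 1 2 by blast
  next
    case False
    then have "x \<notin> conjH \<Gamma> (t j) H" "?z \<notin> K <#> Y" using assms(3) by auto
    moreover have "K <#> (H \<inter> Y) \<subseteq> K <#> Y" by (auto simp: set_mult_def)
    ultimately show ?thesis using 1 by blast
  qed
qed

lemma AE_conj:
  assumes "AE H in \<mu>. P H" "g \<in> carrier \<Gamma>"
  shows "AE H in \<mu>. P (conjH \<Gamma> g H)"
proof -
  have "distr \<mu> \<mu> (conjH \<Gamma> g) = \<mu>" using IRS assms(2) by (simp add: IRS_def)
  then have "AE H in distr \<mu> \<mu> (conjH \<Gamma> g). P H" using assms(1) by (simp only:)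
  then show ?thesis by (rule AE_distrD[OF conj_measurable'[OF assms(2)]])
qed

text \<open>The two integrals are coupled through the same \<open>H\<close>: invariance of \<mu>
  replaces \<open>f H\<close> by \<open>f (conjH \<Gamma> (t j) H)\<close>, which is then compared
  with \<open>f (\<Theta> j H)\<close>. An index outside \<open>J\<close> costs at most \<epsilon>,
  an index in \<open>J\<close> at most \<open>2 * B\<close>.\<close>

lemma integral_\<nu>_approx:
  assumes f: "f \<in> borel_measurable (Sub_borel \<Gamma>)"
    and B: "\<And>H. H \<in> Subgrps \<Gamma> \<Longrightarrow> \<bar>f H\<bar> \<le> (B::real)"
    and E: "finite E" "E \<subseteq> carrier \<Gamma>" "0 \<le> \<epsilon>"
      "\<And>H H'. H \<in> Subgrps \<Gamma> \<Longrightarrow> H' \<in> Subgrps \<Gamma> \<Longrightarrow> H \<inter> E = H' \<inter> E \<Longrightarrow> \<bar>f H - f H'\<bar> < \<epsilon>"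
    and J: "J \<subseteq> {..<w}"
      "\<And>j x. j < w \<Longrightarrow> j \<notin> J \<Longrightarrow> x \<in> E \<Longrightarrow> inv (t j) \<otimes> x \<otimes> t j \<in> Y \<or>
         (AE H in \<mu>. x \<notin> H) \<and> inv (t j) \<otimes> x \<otimes> t j \<notin> K <#> Y"
  shows "\<bar>integral\<^sup>L \<nu> f - integral\<^sup>L \<mu> f\<bar> \<le> \<epsilon> + 2 * B * (card J / w)"
proof -
  have mf: "f \<in> borel_measurable \<mu>" using f measurable_cong_sets[OF sets_\<mu> refl] by blast
  have int1: "integrable \<mu> (\<lambda>H. f (\<Theta> j H))" for j
    using B \<Theta>_Subgrps
    by (intro integrable_const_bound[of _ B] measurable_compose[OF \<Theta>_measurable' f] AE_I2) auto
  have int2: "integrable \<mu> (\<lambda>H. f (conjH \<Gamma> (t j) H))" for j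
    using B conjH_Subgrps[OF is_group t]
    by (intro integrable_const_bound[of _ B] measurable_compose[OF conj_measurable'[OF t] mf] AE_I2) auto
  define \<Delta> where "\<Delta> j = (\<integral>H. f (\<Theta> j H) - f (conjH \<Gamma> (t j) H) \<partial>\<mu>)" for j
  have \<Delta>: "\<Delta> j = (\<integral>H. f (\<Theta> j H) \<partial>\<mu>) - integral\<^sup>L \<mu> f" for j
    unfolding \<Delta>_def using int1 int2 integral_conj[OF f t] by simp
  have bound: "\<bar>\<Delta> j\<bar> \<le> C" if "AE H in \<mu>. \<bar>f (\<Theta> j H) - f (conjH \<Gamma> (t j) H)\<bar> \<le> C" for j C
  proof -
    have "\<bar>\<Delta> j\<bar> \<le> (\<integral>H. \<bar>f (\<Theta> j H) - f (conjH \<Gamma> (t j) H)\<bar> \<partial>\<mu>)"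
      unfolding \<Delta>_def by (rule integral_abs_bound)
    also have "\<dots> \<le> C"
      using that int1 int2 by (intro integral_le_const integrable_abs Bochner_Integration.integrable_diff)
    finally show ?thesis .
  qed
  have good: "\<bar>\<Delta> j\<bar> \<le> \<epsilon>" if j: "j < w" "j \<notin> J" for j
  proof (rule bound)
    have "AE H in \<mu>. \<forall>x\<in>E. x \<in> \<Theta> j H \<longleftrightarrow> x \<in> conjH \<Gamma> (t j) H"
    proof (rule AE_finite_allI[OF E(1)])
      fix x assume x: "x \<in> E"
      then have xc: "x \<in> carrier \<Gamma>" using E(2) by blast
      have "AE H in \<mu>. inv (t j) \<otimes> x \<otimes> t j \<in> Y \<or>
          x \<notin> conjH \<Gamma> (t j) H \<and> inv (t j) \<otimes> x \<otimes> t j \<notin> K <#> Y"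
        using J(2)[OF j x]
      proof
        assume "(AE H in \<mu>. x \<notin> H) \<and> inv (t j) \<otimes> x \<otimes> t j \<notin> K <#> Y"
        moreover from this have "AE H in \<mu>. x \<notin> conjH \<Gamma> (t j) H"
          by (intro AE_conj[of "\<lambda>H. x \<notin> H", OF _ t]) blast
        ultimately show ?thesis by simp
      qed simp
      then show "AE H in \<mu>. x \<in> \<Theta> j H \<longleftrightarrow> x \<in> conjH \<Gamma> (t j) H"
        by (rule AE_mp) (intro AE_I2 impI, use \<Theta>_agrees[OF _ xc] in auto)
    qed
    then show "AE H in \<mu>. \<bar>f (\<Theta> j H) - f (conjH \<Gamma> (t j) H)\<bar> \<le> \<epsilon>"
    proof (rule AE_mp, intro AE_I2 impI)
      fix H assume H: "H \<in> space \<mu>" "\<forall>x\<in>E. x \<in> \<Theta> j H \<longleftrightarrow> x \<in> conjH \<Gamma> (t j) H"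
      then have "\<Theta> j H \<inter> E = conjH \<Gamma> (t j) H \<inter> E" by blast
      then show "\<bar>f (\<Theta> j H) - f (conjH \<Gamma> (t j) H)\<bar> \<le> \<epsilon>"
        using H(1) E(4)[OF \<Theta>_Subgrps conjH_Subgrps[OF is_group t]] by (simp add: less_imp_le)
    qed
  qed
  have bad: "\<bar>\<Delta> j\<bar> \<le> 2 * B" for j
  proof (rule bound, intro AE_I2)
    fix H assume "H \<in> space \<mu>"
    then have "\<bar>f (\<Theta> j H)\<bar> \<le> B" "\<bar>f (conjH \<Gamma> (t j) H)\<bar> \<le> B"
      using B \<Theta>_Subgrps conjH_Subgrps[OF is_group t] by auto
    then show "\<bar>f (\<Theta> j H) - f (conjH \<Gamma> (t j) H)\<bar> \<le> 2 * B" by linarith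
  qed
  have "integral\<^sup>L \<nu> f - integral\<^sup>L \<mu> f = (\<Sum>j<w. \<Delta> j) / w"
    using w integral_\<nu>[OF f B] by (simp add: \<Delta> sum_subtractf diff_divide_distrib)
  also have "\<bar>\<dots>\<bar> \<le> (\<Sum>j<w. \<bar>\<Delta> j\<bar>) / w"
    using w by (simp add: divide_right_mono sum_abs)
  also have "(\<Sum>j<w. \<bar>\<Delta> j\<bar>) = (\<Sum>j\<in>{..<w} - J. \<bar>\<Delta> j\<bar>) + (\<Sum>j\<in>J. \<bar>\<Delta> j\<bar>)"
    by (rule sum.subset_diff[OF J(1)]) simp
  also have "(\<Sum>j\<in>{..<w} - J. \<bar>\<Delta> j\<bar>) \<le> card ({..<w} - J) * \<epsilon>"
    using good by (intro sum_bounded_above) auto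
  also have "card ({..<w} - J) * \<epsilon> \<le> w * \<epsilon>"
    using E(3) card_mono[of "{..<w}" "{..<w} - J"] by (intro mult_right_mono) auto
  also have "(\<Sum>j\<in>J. \<bar>\<Delta> j\<bar>) \<le> card J * (2 * B)"
    using bad by (intro sum_bounded_above) auto
  finally have "\<bar>integral\<^sup>L \<nu> f - integral\<^sup>L \<mu> f\<bar> \<le> (w * \<epsilon> + card J * (2 * B)) / w"
    using w by (simp add: divide_right_mono)
  also have "\<dots> = \<epsilon> + 2 * B * (card J / w)" using w by (simp add: field_simps)
  finally show ?thesis .
qed

end

text \<open>The finitely many test functions are bounded and uniformly continuous, so one finite set
  \<open>E\<close> and one proportion \<open>\<delta>\<close> of bad indices decide whether the
  averaged law lies in the given neighbourhood.\<close>

lemma cosofic_by_windows: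
  assumes "group \<Gamma>"
    and windows: "\<And>E \<delta>. finite E \<Longrightarrow> E \<subseteq> carrier \<Gamma> \<Longrightarrow> \<delta> > 0 \<Longrightarrow>
      \<exists>K Y t w J. irs_window \<Gamma> \<mu> K Y t w \<and> J \<subseteq> {..<w} \<and> card J / w < (\<delta>::real) \<and>
        (\<forall>j x. j < w \<longrightarrow> j \<notin> J \<longrightarrow> x \<in> E \<longrightarrow>
           inv\<^bsub>\<Gamma>\<^esub> (t j) \<otimes>\<^bsub>\<Gamma>\<^esub> x \<otimes>\<^bsub>\<Gamma>\<^esub> t j \<in> Y \<or>
           (AE H in \<mu>. x \<notin> H) \<and> inv\<^bsub>\<Gamma>\<^esub> (t j) \<otimes>\<^bsub>\<Gamma>\<^esub> x \<otimes>\<^bsub>\<Gamma>\<^esub> t j \<notin> K <#>\<^bsub>\<Gamma>\<^esub> Y)"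
  shows "cosofic \<Gamma> \<mu>"
  unfolding cosofic_def
proof (intro allI impI, elim conjE)
  fix F and \<epsilon> :: real
  assume F: "finite F" "\<forall>f\<in>F. continuous_map (Sub_topology \<Gamma>) euclideanreal f" and \<epsilon>: "\<epsilon> > 0"
  have "\<forall>f\<in>F. \<exists>E. finite E \<and> E \<subseteq> carrier \<Gamma> \<and> (\<forall>H\<in>Subgrps \<Gamma>. \<forall>H'\<in>Subgrps \<Gamma>.
      H \<inter> E = H' \<inter> E \<longrightarrow> \<bar>f H - f H'\<bar> < \<epsilon> / 2)"
  proof
    fix f assume "f \<in> F"
    then have f: "continuous_map (Sub_topology \<Gamma>) euclideanreal f" using F by blast
    obtain E where "finite E" "E \<subseteq> carrier \<Gamma>"
        "\<And>H H'. H \<in> Subgrps \<Gamma> \<Longrightarrow> H' \<in> Subgrps \<Gamma> \<Longrightarrow> H \<inter> E = H' \<inter> E \<Longrightarrow> \<bar>f H - f H'\<bar> < \<epsilon> / 2"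
      by (rule Sub_continuous_uniform[OF assms(1) f half_gt_zero[OF \<epsilon>]]) blast
    then show "\<exists>E. finite E \<and> E \<subseteq> carrier \<Gamma> \<and> (\<forall>H\<in>Subgrps \<Gamma>. \<forall>H'\<in>Subgrps \<Gamma>.
      H \<inter> E = H' \<inter> E \<longrightarrow> \<bar>f H - f H'\<bar> < \<epsilon> / 2)"
      by (intro exI[of _ E] conjI ballI impI) simp_all
  qed
  from bchoice[OF this] obtain E where
    "\<forall>f\<in>F. finite (E f) \<and> E f \<subseteq> carrier \<Gamma> \<and> (\<forall>H\<in>Subgrps \<Gamma>. \<forall>H'\<in>Subgrps \<Gamma>.
      H \<inter> E f = H' \<inter> E f \<longrightarrow> \<bar>f H - f H'\<bar> < \<epsilon> / 2)" ..
  then have E: "\<And>f. f \<in> F \<Longrightarrow> finite (E f)" "\<And>f. f \<in> F \<Longrightarrow> E f \<subseteq> carrier \<Gamma>"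
      "\<And>f H H'. f \<in> F \<Longrightarrow> H \<in> Subgrps \<Gamma> \<Longrightarrow> H' \<in> Subgrps \<Gamma> \<Longrightarrow> H \<inter> E f = H' \<inter> E f \<Longrightarrow> \<bar>f H - f H'\<bar> < \<epsilon> / 2"
    by simp_all
  have "\<forall>f\<in>F. \<exists>B. \<forall>H\<in>Subgrps \<Gamma>. \<bar>f H\<bar> \<le> B"
  proof
    fix f assume "f \<in> F"
    then have f: "continuous_map (Sub_topology \<Gamma>) euclideanreal f" using F by blast
    obtain B where "\<And>H. H \<in> Subgrps \<Gamma> \<Longrightarrow> \<bar>f H\<bar> \<le> B"
      by (rule Sub_continuous_bounded[OF assms(1) f]) blast
    then show "\<exists>B. \<forall>H\<in>Subgrps \<Gamma>. \<bar>f H\<bar> \<le> B" by blast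
  qed
  from bchoice[OF this] obtain B where B: "\<And>f H. f \<in> F \<Longrightarrow> H \<in> Subgrps \<Gamma> \<Longrightarrow> \<bar>f H\<bar> \<le> B f"
    by blast
  \<comment> \<open>The summand 1 makes \<open>B'\<close> positive also for an empty
    \<open>F\<close> or vanishing bounds, so that it can be divided by.\<close>
  define B' where "B' = (\<Sum>f\<in>F. \<bar>B f\<bar>) + 1"
  have B': "\<bar>f H\<bar> \<le> B'" if "f \<in> F" "H \<in> Subgrps \<Gamma>" for f H
  proof -
    have "\<bar>B f\<bar> \<le> (\<Sum>f\<in>F. \<bar>B f\<bar>)" using F(1) that by (intro member_le_sum) auto
    then show ?thesis using B[OF that] unfolding B'_def by linarith
  qed
  have "B' > 0" unfolding B'_def by (simp add: add_nonneg_pos sum_nonneg)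
  \<comment> \<open>Half of the tolerance is spent on the good indices. The bad ones cost less than
    \<open>2 * B' * (\<epsilon> / (4 * B'))\<close>, the other half.\<close>
  have "finite (\<Union> (E ` F))" "\<Union> (E ` F) \<subseteq> carrier \<Gamma>" "\<epsilon> / (4 * B') > 0"
    using F(1) E(1) \<epsilon> \<open>B' > 0\<close> UN_least[of F E, OF E(2)] by simp_all
  from windows[OF this] obtain K Y t w J where W: "irs_window \<Gamma> \<mu> K Y t w" and J: "J \<subseteq> {..<w}"
      "card J / w < \<epsilon> / (4 * B')"
      "\<forall>j x. j < w \<longrightarrow> j \<notin> J \<longrightarrow> x \<in> \<Union> (E ` F) \<longrightarrow>
           inv\<^bsub>\<Gamma>\<^esub> (t j) \<otimes>\<^bsub>\<Gamma>\<^esub> x \<otimes>\<^bsub>\<Gamma>\<^esub> t j \<in> Y \<or>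
           (AE H in \<mu>. x \<notin> H) \<and> inv\<^bsub>\<Gamma>\<^esub> (t j) \<otimes>\<^bsub>\<Gamma>\<^esub> x \<otimes>\<^bsub>\<Gamma>\<^esub> t j \<notin> K <#>\<^bsub>\<Gamma>\<^esub> Y"
    by (elim exE conjE)
  interpret irs_window \<Gamma> \<mu> K Y t w by (rule W)
  have "\<bar>(\<integral>H. f H \<partial>\<nu>) - (\<integral>H. f H \<partial>\<mu>)\<bar> < \<epsilon>" if f: "f \<in> F" for f
  proof -
    have "\<bar>integral\<^sup>L \<nu> f - integral\<^sup>L \<mu> f\<bar> \<le> \<epsilon> / 2 + 2 * B' * (card J / w)"
    proof (rule integral_\<nu>_approx[of f B' "E f"])
      show "f \<in> borel_measurable (Sub_borel \<Gamma>)"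
        using F(2) f by (intro continuous_map_Sub_measurable) blast
      fix j x assume "j < w" "j \<notin> J" "x \<in> E f"
      then show "inv\<^bsub>\<Gamma>\<^esub> (t j) \<otimes>\<^bsub>\<Gamma>\<^esub> x \<otimes>\<^bsub>\<Gamma>\<^esub> t j \<in> Y \<or>
           (AE H in \<mu>. x \<notin> H) \<and> inv\<^bsub>\<Gamma>\<^esub> (t j) \<otimes>\<^bsub>\<Gamma>\<^esub> x \<otimes>\<^bsub>\<Gamma>\<^esub> t j \<notin> K <#>\<^bsub>\<Gamma>\<^esub> Y"
        using J(3) f by blast
    qed (use E B' J f \<epsilon> in auto)
    also have "2 * B' * (card J / w) < 2 * B' * (\<epsilon> / (4 * B'))"
      using J(2) \<open>B' > 0\<close> by (intro mult_strict_left_mono) auto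
    also have "\<epsilon> / 2 + 2 * B' * (\<epsilon> / (4 * B')) = \<epsilon>" using \<open>B' > 0\<close> by (simp add: field_simps)
    finally show ?thesis by simp
  qed
  then show "\<exists>\<nu>. finite_index_IRS \<Gamma> \<nu> \<and> (\<forall>f\<in>F. \<bar>(\<integral>H. f H \<partial>\<nu>) - (\<integral>H. f H \<partial>\<mu>)\<bar> < \<epsilon>)"
    using finite_index_IRS_\<nu> by blast
qed

section \<open>The group generated by the two sequences\<close>

text \<open>The sign is multiplicative, and an odd power of -1 is not 1. With the odd exponents
  \<open>d n\<close> and 3 this places both generators in the alternating groups.\<close>

lemma evenperm_odd_order:
  assumes "permutation p" "odd k" "p ^^ k = id"
  shows "evenperm p"
proof -
  have "permutation (p ^^ m) \<and> sign (p ^^ m) = sign p ^ m" for m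
    using assms(1)
    by (induction m) (auto simp: permutation_id sign_id sign_compose permutation_compose)
  then have "sign p ^ k = 1" using assms(3) by (metis sign_id)
  then show ?thesis using assms(2) by (auto simp: sign_def split: if_splits)
qed

locale neumann_group =
  fixes d r :: "nat \<Rightarrow> nat"
  assumes prime_d: "\<And>n. prime (d n)"
    and d_ge_5: "\<And>n. d n \<ge> 5"
    and strict_mono_r: "strict_mono r"
    and r_pos: "\<And>n. r n \<ge> 1"
    and r_le: "\<And>n. 3 * r n \<le> d n"
begin

abbreviation G where "G \<equiv> Ggrp d r"

text \<open>Coordinates adapted to both generators: \<open>i\<close> is a position, and
  \<open>c\<close>, read modulo 3, selects one of three copies of the line, offset from each other
  by \<open>r n\<close>. The rotation moves \<open>i\<close>, while \<beta> advances
  \<open>c\<close> at position 0. Integer arguments avoid case distinctions where the cycle closes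
  up.\<close>

definition pt :: "nat \<Rightarrow> int \<Rightarrow> int \<Rightarrow> nat" where
  "pt n i c = 1 + nat ((i + (c mod 3) * int (r n)) mod int (d n))"

lemma d_pos [simp]: "0 < d n" using d_ge_5[of n] by simp

lemma r_less: "3 * r n < d n"
proof -
  have "3 * r n \<noteq> d n"
  proof
    assume *: "3 * r n = d n"
    then have "3 dvd d n" by (metis dvd_triv_left)
    then show False using prime_d[of n] d_ge_5[of n] by (auto simp: prime_nat_iff)
  qed
  then show ?thesis using r_le[of n] by simp
qed

lemma r_mono: "m < n \<Longrightarrow> r m < r n" using strict_mono_r by (simp add: strict_mono_def)

lemma r_ge: "n \<le> r n" using strict_mono_r by (rule strict_mono_imp_increasing)

lemma pt_range: "pt n i c \<in> {1..d n}"
proof -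
  have "0 \<le> (i + (c mod 3) * int (r n)) mod int (d n)" "(i + (c mod 3) * int (r n)) mod int (d n) < int (d n)"
    by simp_all
  then show ?thesis unfolding pt_def by (simp only: atLeastAtMost_iff) linarith
qed

lemma pt_surj:
  assumes "x \<in> {1..d n}" shows "x = pt n (int x - 1) 0"
proof -
  have "(int x - 1) mod int (d n) = int x - 1" using assms by simp
  then show ?thesis using assms unfolding pt_def by auto
qed

lemma pt_cong_mod: "pt n (i + int (d n) * k) c = pt n i c"
proof -
  have "(i + int (d n) * k + (c mod 3) * int (r n)) mod int (d n) =
      (i + (c mod 3) * int (r n) + int (d n) * k) mod int (d n)" by (simp add: ac_simps)
  also have "\<dots> = (i + (c mod 3) * int (r n)) mod int (d n)" by (rule mod_mult_self2)
  finally show ?thesis unfolding pt_def by simp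
qed

lemma pt_eq_iff_dvd:
  "pt n i c = pt n i' c' \<longleftrightarrow> int (d n) dvd (i + (c mod 3) * int (r n)) - (i' + (c' mod 3) * int (r n))"
proof -
  have "pt n i c = pt n i' c' \<longleftrightarrow>
      (i + (c mod 3) * int (r n)) mod int (d n) = (i' + (c' mod 3) * int (r n)) mod int (d n)"
    unfolding pt_def by (simp add: eq_nat_nat_iff)
  then show ?thesis by (simp add: mod_eq_dvd_iff)
qed

lemma pt_cong: "c mod 3 = c' mod 3 \<Longrightarrow> pt n i c = pt n i c'"
  by (simp add: pt_def)

lemma pt_plus_3 [simp]: "pt n i (c + 3) = pt n i c" "pt n i (3 + c) = pt n i c"
  by (rule pt_cong, simp)+

text \<open>The bound \<open>3 * r n \<le> d n\<close> enters here. The offsets differ by at most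
  \<open>2 * r n\<close> and the positions by less than \<open>r n\<close>, so the total
  displacement is smaller than \<open>d n\<close> and a congruence becomes an equality. Then
  \<open>i - i'\<close> is a multiple of \<open>r n\<close> of smaller absolute value, hence
  zero.\<close>

lemma pt_eq_iff:
  assumes "\<bar>i - i'\<bar> < int (r n)"
  shows "pt n i c = pt n i' c' \<longleftrightarrow> i = i' \<and> c mod 3 = c' mod 3"
proof
  define \<Delta> where "\<Delta> = c mod 3 - c' mod 3"
  have \<Delta>: "\<Delta> \<in> {-2, -1, 0, 1, 2}" unfolding \<Delta>_def by auto presburger
  assume "pt n i c = pt n i' c'"
  then have dvd: "int (d n) dvd (i - i') + \<Delta> * int (r n)"
    unfolding pt_eq_iff_dvd \<Delta>_def by (simp add: algebra_simps)
  have "\<bar>(i - i') + \<Delta> * int (r n)\<bar> < int (d n)"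
    using assms \<Delta> r_le[of n] by auto
  then have "(i - i') + \<Delta> * int (r n) = 0"
    using dvd_imp_le_int[OF _ dvd] by force
  then have "\<Delta> = 0 \<and> i = i'" using assms \<Delta> by auto
  then show "i = i' \<and> c mod 3 = c' mod 3" by (simp add: \<Delta>_def)
qed (auto intro: pt_cong)

lemma alpha_pt: "alpha d n (pt n i c) = pt n (i + 1) c"
proof -
  define a where "a = i + (c mod 3) * int (r n)"
  define m where "m = a mod int (d n)"
  have m: "0 \<le> m" "m < int (d n)" by (simp_all add: m_def)
  have "(a + 1) mod int (d n) = (m + 1) mod int (d n)" by (simp add: m_def mod_add_left_eq)
  also have "\<dots> = (if m + 1 = int (d n) then 0 else m + 1)" using m by auto
  finally have *: "pt n (i + 1) c = 1 + nat (if m + 1 = int (d n) then 0 else m + 1)"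
    by (simp add: pt_def a_def algebra_simps)
  have "pt n i c = 1 + nat m" by (simp add: pt_def a_def m_def)
  then show ?thesis unfolding * using m by (auto simp: alpha_def)
qed

lemma pt_0: "pt n 0 c = 1 + nat (c mod 3) * r n"
proof -
  have "(c mod 3) * int (r n) \<le> 2 * int (r n)"
    by (intro mult_right_mono) (presburger, simp)
  then have "(c mod 3) * int (r n) < int (d n)" using r_le[of n] r_pos[of n] by linarith
  then have "((c mod 3) * int (r n)) mod int (d n) = (c mod 3) * int (r n)" by simp
  then show ?thesis by (simp add: pt_def nat_mult_distrib)
qed

lemma beta_pt: "beta r n (pt n 0 c) = pt n 0 (c + 1)"
proof -
  have "c mod 3 = 0 \<or> c mod 3 = 1 \<or> c mod 3 = 2" by presburger
  then show ?thesis
  proof (elim disjE)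
    assume "c mod 3 = 0"
    then have "(c + 1) mod 3 = 1" by presburger
    then show ?thesis using \<open>c mod 3 = 0\<close> r_pos[of n] by (simp add: pt_0 beta_def)
  next
    assume "c mod 3 = 1"
    then have "(c + 1) mod 3 = 2" by presburger
    then show ?thesis using \<open>c mod 3 = 1\<close> r_pos[of n] by (simp add: pt_0 beta_def)
  next
    assume "c mod 3 = 2"
    then have "(c + 1) mod 3 = 0" by presburger
    then show ?thesis using \<open>c mod 3 = 2\<close> r_pos[of n] by (simp add: pt_0 beta_def)
  qed
qed

lemma beta_fix:
  assumes "\<And>c. x \<noteq> pt n 0 c" shows "beta r n x = x"
  using assms[of 0] assms[of 1] assms[of 2] by (simp add: pt_0 beta_def)

lemma beta_fix_pt:
  assumes "i \<noteq> 0" "\<bar>i\<bar> < int (r n)" shows "beta r n (pt n i c) = pt n i c"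
  using assms by (intro beta_fix) (simp add: pt_eq_iff)

text \<open>The integer power \<open>i\<close> of \<alpha>, in closed form, so that adding exponents
  is a computation with \<open>pt\<close>.\<close>

definition rot :: "int \<Rightarrow> nat \<Rightarrow> nat \<Rightarrow> nat" where
  "rot i n x = (if x \<in> {1..d n} then pt n (int x - 1 + i) 0 else x)"

lemma rot_pt: "rot i n (pt n j c) = pt n (j + i) c"
proof -
  have "pt n (int (pt n j c) - 1 + i) 0 = pt n (j + i) c"
  proof -
    have "int (pt n j c) - 1 = (j + (c mod 3) * int (r n)) mod int (d n)" by (simp add: pt_def)
    then have "(int (pt n j c) - 1 + i) mod int (d n) = (j + i + (c mod 3) * int (r n)) mod int (d n)"
      by (simp add: mod_add_right_eq ac_simps)
    then show ?thesis by (simp add: pt_def)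
  qed
  then show ?thesis using pt_range[of n j c] by (simp add: rot_def)
qed

lemma rot_fix: "x \<notin> {1..d n} \<Longrightarrow> rot i n x = x"
  by (auto simp: rot_def)

lemma perm_eqI:
  assumes "\<And>x. x \<notin> {1..d n} \<Longrightarrow> p x = q x" "\<And>i. p (pt n i 0) = q (pt n i 0)"
  shows "p = q"
proof
  fix x
  show "p x = q x"
    using assms pt_surj[of x n] by (cases "x \<in> {1..d n}") metis+
qed

lemma rot_rot: "rot i n \<circ> rot j n = rot (i + j) n"
  by (rule perm_eqI[of n]) (simp_all add: rot_fix rot_pt algebra_simps)

lemma rot_0: "rot 0 n = id"
  by (rule perm_eqI[of n]) (simp_all add: rot_fix rot_pt)

lemma rot_1: "rot 1 = alpha d"
proof
  fix n show "rot 1 n = alpha d n"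
    by (rule perm_eqI[of n]) (auto simp: rot_fix rot_pt alpha_pt, auto simp: alpha_def Suc_le_eq)
qed

lemma rot_period: "rot (i + int (d n) * k) n = rot i n"
  by (rule perm_eqI[of n]) (auto simp: rot_fix rot_pt add.assoc[symmetric] pt_cong_mod)

lemma rot_permutes: "rot i n permutes {1..d n}"
proof (rule bij_imp_permutes)
  show "bij_betw (rot i n) {1..d n} {1..d n}"
  proof (rule bij_betw_byWitness[where f' = "rot (- i) n"])
    have "rot (- i) n \<circ> rot i n = id" "rot i n \<circ> rot (- i) n = id" by (simp_all add: rot_rot rot_0)
    then show "\<forall>a\<in>{1..d n}. rot (- i) n (rot i n a) = a" "\<forall>a\<in>{1..d n}. rot i n (rot (- i) n a) = a"
      by (metis comp_apply id_apply)+
    show "rot i n ` {1..d n} \<subseteq> {1..d n}" "rot (- i) n ` {1..d n} \<subseteq> {1..d n}"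
      using pt_range by (auto simp: rot_def simp del: atLeastAtMost_iff)
  qed
qed (rule rot_fix)

lemma rot_funpow: "rot i n ^^ k = rot (int k * i) n"
  by (induction k) (simp_all add: rot_0 rot_rot algebra_simps)

lemma odd_d: "odd (d n)"
  using prime_d[of n] d_ge_5[of n] by (intro prime_odd_nat) auto

lemma alpha_in: "alpha d n \<in> carrier (alt_group (d n))"
proof -
  have "alpha d n ^^ d n = id"
    using rot_period[of 0 n 1] by (simp add: rot_1[symmetric] rot_funpow rot_0)
  then have "evenperm (alpha d n)"
    using odd_d[of n] rot_permutes[of 1 n]
    by (intro evenperm_odd_order[of _ "d n"]) (auto simp: rot_1 intro: permutes_imp_permutation)
  then show ?thesis using rot_permutes[of 1 n] by (simp add: alt_group_carrier rot_1)
qed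

lemma beta_cube: "beta r n \<circ> beta r n \<circ> beta r n = id"
proof
  fix x
  show "(beta r n \<circ> beta r n \<circ> beta r n) x = id x"
  proof (cases "\<exists>c. x = pt n 0 c")
    case True
    then show ?thesis by (auto simp: beta_pt add.assoc)
  next
    case False
    then have "beta r n x = x" by (intro beta_fix) blast
    then show ?thesis by simp
  qed
qed

lemma beta_fix_out: "x \<notin> {1..d n} \<Longrightarrow> beta r n x = x"
  using pt_range by (intro beta_fix) metis

lemma beta_permutes: "beta r n permutes {1..d n}"
proof (rule bij_imp_permutes)
  have range: "beta r n x \<in> {1..d n}" if "x \<in> {1..d n}" for x
    using that beta_pt pt_range beta_fix by metis
  show "bij_betw (beta r n) {1..d n} {1..d n}"
  proof (rule bij_betw_byWitness[where f' = "beta r n \<circ> beta r n"])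
    show "\<forall>a\<in>{1..d n}. (beta r n \<circ> beta r n) (beta r n a) = a" "\<forall>a\<in>{1..d n}. beta r n ((beta r n \<circ> beta r n) a) = a"
      using beta_cube by (metis comp_apply id_apply)+
  qed (use range in auto)
qed (rule beta_fix_out)

lemma beta_in: "beta r n \<in> carrier (alt_group (d n))"
proof -
  have "beta r n ^^ 3 = id" using beta_cube[of n] by (simp add: numeral_3_eq_3 comp_assoc)
  then have "evenperm (beta r n)"
    using beta_permutes[of n]
    by (intro evenperm_odd_order[of _ 3]) (auto intro: permutes_imp_permutation)
  then show ?thesis using beta_permutes[of n] by (simp add: alt_group_carrier)
qed

section \<open>The group operations of \<open>G\<close> and the conjugates of \<beta>\<close>

lemma group_AltProd: "group (AltProd d)"
  unfolding AltProd_def by (rule product_group) (rule alt_group_is_group)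

sublocale G: group G
  unfolding Ggrp_def using group_AltProd by (rule group.group_subgroup_generated)

lemma mult_G: "g \<otimes>\<^bsub>G\<^esub> h = (\<lambda>n. g n \<circ> h n)"
  by (simp add: Ggrp_def AltProd_def alt_group_mult restrict_def)

lemma one_G: "\<one>\<^bsub>G\<^esub> = (\<lambda>n. id)"
  by (simp add: Ggrp_def AltProd_def alt_group_one restrict_def)

lemma carrier_G: "carrier G = generate (AltProd d) {alpha d, beta r}"
proof -
  have "alpha d \<in> carrier (AltProd d)" "beta r \<in> carrier (AltProd d)"
    using alpha_in beta_in by (auto simp: AltProd_def)
  then have "carrier (AltProd d) \<inter> {alpha d, beta r} = {alpha d, beta r}" by blast
  then show ?thesis unfolding Ggrp_def carrier_subgroup_generated by simp
qed

lemma alpha_G: "alpha d \<in> carrier G" and beta_G: "beta r \<in> carrier G"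
  unfolding carrier_G by (auto intro: generate.incl)

lemma G_AltProd: "g \<in> carrier G \<Longrightarrow> g \<in> carrier (AltProd d)"
  unfolding Ggrp_def using group.carrier_subgroup_generated_subset[OF group_AltProd] by blast

lemma G_permutes:
  assumes "g \<in> carrier G" shows "g n permutes {1..d n}"
  using G_AltProd[OF assms] by (auto simp: AltProd_def PiE_iff alt_group_carrier)

lemma inv_G:
  assumes "g \<in> carrier G" shows "inv\<^bsub>G\<^esub> g = (\<lambda>n. inv' (g n))"
proof (rule G.inv_equality[OF _ assms])
  have "(inv\<^bsub>G\<^esub> g) n = inv' (g n)" for n
  proof -
    have "(inv\<^bsub>G\<^esub> g) n \<circ> g n = id"
      using G.l_inv[OF assms] by (metis mult_G one_G)
    then show ?thesis
      using permutes_inv_o(1)[OF G_permutes[OF assms, of n]] by (metis comp_assoc comp_id id_comp)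
  qed
  then have "inv\<^bsub>G\<^esub> g = (\<lambda>n. inv' (g n))" by (rule ext)
  then show "(\<lambda>n. inv' (g n)) \<in> carrier G" using G.inv_closed[OF assms] by simp
  show "(\<lambda>n. inv' (g n)) \<otimes>\<^bsub>G\<^esub> g = \<one>\<^bsub>G\<^esub>"
    using permutes_inv_o(2)[OF G_permutes[OF assms]] by (simp add: mult_G one_G)
qed

lemma G_induct [consumes 1, case_names one alpha beta inv mult]:
  assumes "g \<in> carrier G" "P \<one>\<^bsub>G\<^esub>" "P (alpha d)" "P (beta r)"
    "\<And>g. g \<in> carrier G \<Longrightarrow> P g \<Longrightarrow> P (inv\<^bsub>G\<^esub> g)"
    "\<And>g h. g \<in> carrier G \<Longrightarrow> h \<in> carrier G \<Longrightarrow> P g \<Longrightarrow> P h \<Longrightarrow> P (g \<otimes>\<^bsub>G\<^esub> h)"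
  shows "P g"
proof -
  have "g \<in> generate (AltProd d) {alpha d, beta r}" using assms(1) by (simp add: carrier_G)
  then show ?thesis
  proof (induction rule: generate.induct)
    case one
    then show ?case using assms(2) by (simp add: Ggrp_def)
  next
    case (incl h)
    then show ?case using assms(3,4) by auto
  next
    case (inv h)
    then have "h \<in> carrier G" "P h" using alpha_G beta_G assms(3,4) by auto
    then have "P (inv\<^bsub>G\<^esub> h)" using assms(5) by blast
    moreover have "inv\<^bsub>G\<^esub> h = inv\<^bsub>AltProd d\<^esub> h"
      using \<open>h \<in> carrier G\<close> unfolding Ggrp_def by (rule group.inv_subgroup_generated[OF group_AltProd])
    ultimately show ?case by simp
  next
    case (eng h1 h2)
    then have "P (h1 \<otimes>\<^bsub>G\<^esub> h2)" using assms(6) by (simp add: carrier_G)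
    then show ?case by (simp add: Ggrp_def)
  qed
qed

lemma rot_mult: "rot i \<otimes>\<^bsub>G\<^esub> rot j = rot (i + j)"
  by (simp add: mult_G rot_rot)

lemma rot_zero: "rot 0 = \<one>\<^bsub>G\<^esub>"
  by (auto simp: one_G rot_0)

lemma rot_G: "rot i \<in> carrier G"
proof -
  have nat: "rot (int k) \<in> carrier G" for k
  proof (induction k)
    case (Suc k)
    have "rot (int (Suc k)) = rot (int k) \<otimes>\<^bsub>G\<^esub> rot 1" by (simp add: rot_mult add.commute)
    then show ?case using Suc alpha_G by (simp add: rot_1)
  qed (simp add: rot_zero)
  have "rot (- int k) \<in> carrier G" for k
  proof -
    have "inv\<^bsub>G\<^esub> (rot (int k)) = rot (- int k)"
    proof -
      have "rot (- int k) = (inv\<^bsub>G\<^esub> (rot (int k)) \<otimes>\<^bsub>G\<^esub> rot (int k)) \<otimes>\<^bsub>G\<^esub> rot (- int k)"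
        unfolding G.l_inv[OF nat] by (simp add: one_G mult_G)
      also have "\<dots> = inv\<^bsub>G\<^esub> (rot (int k)) \<otimes>\<^bsub>G\<^esub> (rot (int k) \<otimes>\<^bsub>G\<^esub> rot (- int k))"
        by (simp add: mult_G comp_assoc)
      finally show ?thesis using nat by (simp add: rot_mult rot_zero)
    qed
    then show ?thesis using G.inv_closed[OF nat] by metis
  qed
  then show ?thesis using nat by (metis int_cases2)
qed

lemma inv_rot: "inv\<^bsub>G\<^esub> (rot i) = rot (- i)"
  by (rule G.inv_equality) (simp_all add: rot_G rot_mult rot_zero)

definition B :: "int \<Rightarrow> nat \<Rightarrow> nat \<Rightarrow> nat" where
  "B i = rot i \<otimes>\<^bsub>G\<^esub> beta r \<otimes>\<^bsub>G\<^esub> rot (- i)"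

lemma B_G: "B i \<in> carrier G"
  unfolding B_def using rot_G beta_G by simp

lemma B_0: "B 0 = beta r"
  using beta_G by (simp add: B_def rot_zero)

lemma rot_B: "rot j \<otimes>\<^bsub>G\<^esub> B i \<otimes>\<^bsub>G\<^esub> rot (- j) = B (i + j)"
  unfolding B_def mult_G by (auto simp: comp_assoc rot_rot) (simp add: comp_assoc[symmetric] rot_rot add.commute)

lemma B_pt: "B i n (pt n i c) = pt n i (c + 1)"
  by (simp add: B_def mult_G rot_pt beta_pt)

lemma B_fix:
  assumes "\<And>c. x \<noteq> pt n i c" shows "B i n x = x"
proof (cases "x \<in> {1..d n}")
  case True
  have "rot (- i) n x \<noteq> pt n 0 c" for c
  proof
    assume "rot (- i) n x = pt n 0 c"
    then have "rot i n (rot (- i) n x) = pt n i c" by (simp add: rot_pt)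
    moreover have "rot i n (rot (- i) n x) = x" using rot_rot[of i n "- i"] by (metis add.right_inverse comp_apply id_apply rot_0)
    ultimately show False using assms by simp
  qed
  then have "beta r n (rot (- i) n x) = rot (- i) n x" by (rule beta_fix)
  then show ?thesis using rot_rot[of i n "- i"]
    by (simp add: B_def mult_G) (metis add.right_inverse comp_apply id_apply rot_0)
next
  case False
  then show ?thesis by (simp add: B_def mult_G rot_fix beta_fix_out)
qed

lemma B_cube: "B i \<otimes>\<^bsub>G\<^esub> B i \<otimes>\<^bsub>G\<^esub> B i = \<one>\<^bsub>G\<^esub>"
proof -
  have "B i n (B i n (B i n x)) = x" for n x
  proof (cases "\<exists>c. x = pt n i c")
    case True
    then show ?thesis by (auto simp: B_pt add.assoc)
  next
    case False
    then have "B i n x = x" by (intro B_fix) blast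
    then show ?thesis by simp
  qed
  then show ?thesis by (simp add: mult_G one_G fun_eq_iff)
qed

subsection \<open>Alternating groups in single coordinates\<close>

definition trunc :: "nat \<Rightarrow> (nat \<Rightarrow> nat \<Rightarrow> nat) \<Rightarrow> nat \<Rightarrow> nat \<Rightarrow> nat" where
  "trunc N g = (\<lambda>m. if m < N then g m else id)"

definition coord :: "nat \<Rightarrow> (nat \<Rightarrow> nat \<Rightarrow> nat) \<Rightarrow> nat \<Rightarrow> nat \<Rightarrow> nat" where
  "coord n g = (\<lambda>m. if m = n then g m else id)"

text \<open>The aim is that this is all of \<open>carrier G\<close>. It is closed under products,
  inverses and conjugation, and membership depends on coordinate \<open>n\<close> alone, so it can
  serve as a modulus for computing with 3-cycles.\<close>

definition isolated :: "nat \<Rightarrow> (nat \<Rightarrow> nat \<Rightarrow> nat) set" where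
  "isolated n = {g \<in> carrier G. coord n g \<in> carrier G}"

lemma coord_mult: "coord n (g \<otimes>\<^bsub>G\<^esub> h) = coord n g \<otimes>\<^bsub>G\<^esub> coord n h"
  by (auto simp: coord_def mult_G)

lemma coord_inv:
  assumes "g \<in> carrier G" shows "coord n (inv\<^bsub>G\<^esub> g) = (\<lambda>m. inv' (coord n g m))"
  using assms by (auto simp: coord_def inv_G)

lemma isolated_mult: "g \<in> isolated n \<Longrightarrow> h \<in> isolated n \<Longrightarrow> g \<otimes>\<^bsub>G\<^esub> h \<in> isolated n"
  by (simp add: isolated_def coord_mult)

lemma isolated_G: "g \<in> isolated n \<Longrightarrow> g \<in> carrier G"
  by (simp add: isolated_def)

lemma isolated_inv:
  assumes "g \<in> isolated n" shows "inv\<^bsub>G\<^esub> g \<in> isolated n"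
proof -
  have g: "g \<in> carrier G" "coord n g \<in> carrier G" using assms by (auto simp: isolated_def)
  have "coord n (inv\<^bsub>G\<^esub> g) = inv\<^bsub>G\<^esub> (coord n g)" using coord_inv[OF g(1)] inv_G[OF g(2)] by simp
  then show ?thesis using g by (simp add: isolated_def)
qed

lemma isolated_cong:
  assumes "g \<in> isolated n" "h \<in> carrier G" "h n = g n" shows "h \<in> isolated n"
proof -
  have "coord n h = coord n g" using assms(3) by (auto simp: coord_def)
  then show ?thesis using assms by (simp add: isolated_def)
qed

lemma isolated_conj:
  assumes "g \<in> isolated n" "h \<in> carrier G" shows "h \<otimes>\<^bsub>G\<^esub> g \<otimes>\<^bsub>G\<^esub> inv\<^bsub>G\<^esub> h \<in> isolated n"
proof -
  have g: "g \<in> carrier G" "coord n g \<in> carrier G" using assms by (auto simp: isolated_def)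
  have "coord n (h \<otimes>\<^bsub>G\<^esub> g \<otimes>\<^bsub>G\<^esub> inv\<^bsub>G\<^esub> h) = h \<otimes>\<^bsub>G\<^esub> coord n g \<otimes>\<^bsub>G\<^esub> inv\<^bsub>G\<^esub> h"
    using permutes_inv_o(1)[OF G_permutes[OF assms(2)]]
    by (auto simp: coord_def mult_G inv_G[OF assms(2)])
  then show ?thesis using g assms(2) by (simp add: isolated_def)
qed

lemma isolated_rot_conj:
  assumes "g \<in> isolated n" shows "rot i \<otimes>\<^bsub>G\<^esub> g \<otimes>\<^bsub>G\<^esub> rot (- i) \<in> isolated n"
  using isolated_conj[OF assms rot_G[of i]] by (simp add: inv_rot)

text \<open>In the coordinate \<open>n\<close> the element \<open>B (j * r n)\<close> is the 3-cycle of the consecutive labels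
  \<open>j, j + 1, j + 2\<close>.\<close>

definition lab :: "nat \<Rightarrow> int \<Rightarrow> nat" where "lab n j = pt n (j * int (r n)) 0"

abbreviation X :: "nat \<Rightarrow> int \<Rightarrow> nat \<Rightarrow> nat \<Rightarrow> nat" where "X n j \<equiv> B (j * int (r n))"

text \<open>Multiplication by \<open>r n\<close> thus permutes the residues modulo
  \<open>d n\<close>, which makes the labels a renumbering of all points of coordinate
  \<open>n\<close>.\<close>

lemma coprime_r_d: "coprime (int (r n)) (int (d n))"
proof -
  have "\<not> d n dvd r n" using r_less[of n] r_pos[of n] by (auto dest: dvd_imp_le)
  then have "coprime (d n) (r n)" using prime_d by (rule prime_imp_coprime[rotated])
  then show ?thesis by (simp add: coprime_commute)
qed

lemma lab_eq_iff: "lab n j = lab n k \<longleftrightarrow> int (d n) dvd j - k"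
proof -
  have "lab n j = lab n k \<longleftrightarrow> int (d n) dvd (j - k) * int (r n)"
    unfolding lab_def pt_eq_iff_dvd by (simp add: left_diff_distrib)
  also have "\<dots> \<longleftrightarrow> int (d n) dvd j - k"
    using coprime_r_d[of n] by (simp add: coprime_dvd_mult_left_iff coprime_commute)
  finally show ?thesis .
qed

lemma lab_neq:
  assumes "j \<noteq> k" "\<bar>j - k\<bar> < int (d n)" shows "lab n j \<noteq> lab n k"
  unfolding lab_eq_iff using assms zdvd_not_zless by (metis diff_eq_diff_eq dvd_abs_iff right_minus_eq zero_less_abs_iff)

lemma pt_lab: "0 \<le> c \<Longrightarrow> c < 3 \<Longrightarrow> pt n (j * int (r n)) c = lab n (j + c)"
  by (simp add: lab_def pt_def algebra_simps)

lemma X_lab: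
  "X n j n (lab n j) = lab n (j + 1)"
  "X n j n (lab n (j + 1)) = lab n (j + 2)"
  "X n j n (lab n (j + 2)) = lab n j"
proof -
  show "X n j n (lab n j) = lab n (j + 1)"
    using B_pt[of "j * int (r n)" n 0] pt_lab[of 0 n j] pt_lab[of 1 n j] by simp
  show "X n j n (lab n (j + 1)) = lab n (j + 2)"
    using B_pt[of "j * int (r n)" n 1] pt_lab[of 1 n j] pt_lab[of 2 n j] by simp
  show "X n j n (lab n (j + 2)) = lab n j"
    using B_pt[of "j * int (r n)" n 2] pt_lab[of 2 n j] pt_lab[of 0 n j] pt_plus_3(1)[of n _ 0] by simp
qed

lemma X_fix:
  assumes "x \<noteq> lab n j" "x \<noteq> lab n (j + 1)" "x \<noteq> lab n (j + 2)"
  shows "X n j n x = x"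
proof (rule B_fix)
  fix c
  have "pt n (j * int (r n)) c = pt n (j * int (r n)) (c mod 3)" by (rule pt_cong) simp
  also have "\<dots> = lab n (j + c mod 3)" by (rule pt_lab) simp_all
  finally have "pt n (j * int (r n)) c = lab n (j + c mod 3)" .
  moreover have "c mod 3 = 0 \<or> c mod 3 = 1 \<or> c mod 3 = 2" by presburger
  ultimately show "x \<noteq> pt n (j * int (r n)) c"
    using assms by auto
qed

lemma X_fix_lab:
  assumes "k < j \<or> j + 2 < k" "\<bar>k - j\<bar> < int (d n)" "\<bar>k - (j + 2)\<bar> < int (d n)"
  shows "X n j n (lab n k) = lab n k"
  using assms by (intro X_fix lab_neq) auto

lemma lab_surj:
  assumes "x \<in> {1..d n}" obtains k where "0 \<le> k" "k < int (d n)" "x = lab n k"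
proof -
  obtain s where s: "[int (r n) * s = 1] (mod int (d n))"
    using cong_solve_coprime_int[OF coprime_r_d[of n]] by blast
  define k where "k = ((int x - 1) * s) mod int (d n)"
  have "[k * int (r n) = ((int x - 1) * s) * int (r n)] (mod int (d n))"
    unfolding k_def cong_def by (simp add: mod_mult_left_eq)
  also have "[((int x - 1) * s) * int (r n) = (int x - 1) * 1] (mod int (d n))"
    using cong_scalar_left[OF s, of "int x - 1"] by (simp add: ac_simps)
  finally have "pt n (k * int (r n)) 0 = pt n (int x - 1) 0"
    unfolding pt_def cong_def by simp
  then have "x = lab n k" using pt_surj[OF assms] by (simp add: lab_def)
  moreover have "0 \<le> k" "k < int (d n)" by (simp_all add: k_def)
  ultimately show thesis using that by blast
qed

lemma G_fix_out: "g \<in> carrier G \<Longrightarrow> x \<notin> {1..d n} \<Longrightarrow> g n x = x"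
  using G_permutes permutes_not_in by metis

lemma G_coord_eqI:
  assumes "g \<in> carrier G" "h \<in> carrier G"
    "\<And>k. 0 \<le> k \<Longrightarrow> k < int (d n) \<Longrightarrow> g n (lab n k) = h n (lab n k)"
  shows "g n = h n"
proof
  fix x
  show "g n x = h n x"
  proof (cases "x \<in> {1..d n}")
    case True
    then obtain k where "0 \<le> k" "k < int (d n)" "x = lab n k" by (rule lab_surj)
    then show ?thesis using assms(3) by simp
  next
    case False
    then show ?thesis using G_fix_out[OF assms(1) False] G_fix_out[OF assms(2) False] by simp
  qed
qed

text \<open>In coordinates beyond \<open>n\<close> the two factors have disjoint supports, so the
  commutator is trivial there. Dividing by the truncation, which lies in \<open>G\<close> by
  assumption, clears the coordinates before \<open>n\<close>.\<close>

lemma consecutive_commutator_isolated: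
  assumes tr: "\<And>g. g \<in> carrier G \<Longrightarrow> trunc n g \<in> carrier G"
  shows "X n 0 \<otimes>\<^bsub>G\<^esub> X n 1 \<otimes>\<^bsub>G\<^esub> inv\<^bsub>G\<^esub> (X n 0) \<otimes>\<^bsub>G\<^esub> inv\<^bsub>G\<^esub> (X n 1) \<in> isolated n" (is "?c \<in> _")
proof -
  have c: "?c \<in> carrier G" using B_G by simp
  have "?c m = id" if "n < m" for m
  proof -
    let ?p = "X n 0 m" and ?q = "X n 1 m"
    have "?p \<circ> ?q = ?q \<circ> ?p"
    proof
      fix x
      \<comment> \<open>The two conjugates sit at the positions 0 and \<open>r n\<close>, whose
        distance is less than \<open>r m\<close> by strict monotonicity.\<close>
      have disj: "pt m 0 c \<noteq> pt m (int (r n)) c'" for c c'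
        using r_mono[OF that] r_pos[of n] by (simp add: pt_eq_iff)
      consider c where "x = pt m 0 c" | c where "x = pt m (int (r n)) c"
        | "\<And>c. x \<noteq> pt m 0 c" "\<And>c. x \<noteq> pt m (int (r n)) c" by blast
      then show "(?p \<circ> ?q) x = (?q \<circ> ?p) x"
      proof cases
        case (1 c)
        then show ?thesis using disj B_pt[of 0 m] B_fix[of "pt m 0 _" m "int (r n)"] by simp
      next
        case (2 c)
        then show ?thesis
          using disj[symmetric] B_pt[of "int (r n)" m] B_fix[of "pt m (int (r n)) _" m 0] by simp
      next
        case 3
        then show ?thesis using B_fix[of x m 0] B_fix[of x m "int (r n)"] by simp
      qed
    qed
    moreover have "?p \<circ> inv' ?p = id" "?q \<circ> inv' ?q = id"
      using permutes_inv_o(1) G_permutes[OF B_G] by blast+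
    ultimately have "?p \<circ> ?q \<circ> inv' ?p \<circ> inv' ?q = id"
      by (metis comp_assoc comp_id)
    then show ?thesis by (simp add: mult_G inv_G[OF B_G])
  qed
  note later = this
  have "(inv\<^bsub>G\<^esub> (trunc n ?c) \<otimes>\<^bsub>G\<^esub> ?c) m = coord n ?c m" for m
  proof -
    have "(inv\<^bsub>G\<^esub> (trunc n ?c) \<otimes>\<^bsub>G\<^esub> ?c) m = inv' (trunc n ?c m) \<circ> ?c m"
      unfolding inv_G[OF tr[OF c]] mult_G[of _ ?c] ..
    moreover have "inv' (?c m) \<circ> ?c m = id" by (rule permutes_inv_o(2)[OF G_permutes[OF c]])
    ultimately show ?thesis using later[of m]
      by (cases m n rule: linorder_cases) (simp_all only: trunc_def coord_def if_True if_False
        less_irrefl less_not_sym less_imp_neq comp_id id_comp inv_id simp_thms less_imp_neq[symmetric])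
  qed
  then have "inv\<^bsub>G\<^esub> (trunc n ?c) \<otimes>\<^bsub>G\<^esub> ?c = coord n ?c" by (rule ext)
  moreover have "inv\<^bsub>G\<^esub> (trunc n ?c) \<otimes>\<^bsub>G\<^esub> ?c \<in> carrier G"
    by (intro G.m_closed G.inv_closed tr c)
  ultimately show ?thesis using c unfolding isolated_def by simp
qed

text \<open>Two consecutive 3-cycles \<open>x, y\<close> satisfy \<open>y x\<inverse> y\<inverse> x = x y\<close>, so that \<open>x y\<close> is a conjugate of
  their commutator.\<close>

lemma consecutive_product_isolated:
  assumes "\<And>g. g \<in> carrier G \<Longrightarrow> trunc n g \<in> carrier G"
  shows "X n j \<otimes>\<^bsub>G\<^esub> X n (j + 1) \<in> isolated n"
proof -
  let ?x = "X n 0" and ?y = "X n 1"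
  have xy: "?x \<in> carrier G" "?y \<in> carrier G" by (rule B_G)+
  have inv: "inv\<^bsub>G\<^esub> (X n k) = X n k \<otimes>\<^bsub>G\<^esub> X n k" for k
    using B_cube B_G by (intro G.inv_equality) simp_all
  have "inv\<^bsub>G\<^esub> ?x \<otimes>\<^bsub>G\<^esub> (?x \<otimes>\<^bsub>G\<^esub> ?y \<otimes>\<^bsub>G\<^esub> inv\<^bsub>G\<^esub> ?x \<otimes>\<^bsub>G\<^esub> inv\<^bsub>G\<^esub> ?y) \<otimes>\<^bsub>G\<^esub> inv\<^bsub>G\<^esub> (inv\<^bsub>G\<^esub> ?x) \<in> isolated n"
    using xy by (intro isolated_conj consecutive_commutator_isolated assms) simp_all
  also have "inv\<^bsub>G\<^esub> ?x \<otimes>\<^bsub>G\<^esub> (?x \<otimes>\<^bsub>G\<^esub> ?y \<otimes>\<^bsub>G\<^esub> inv\<^bsub>G\<^esub> ?x \<otimes>\<^bsub>G\<^esub> inv\<^bsub>G\<^esub> ?y) \<otimes>\<^bsub>G\<^esub> inv\<^bsub>G\<^esub> (inv\<^bsub>G\<^esub> ?x)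
      = (inv\<^bsub>G\<^esub> ?x \<otimes>\<^bsub>G\<^esub> ?x) \<otimes>\<^bsub>G\<^esub> (?y \<otimes>\<^bsub>G\<^esub> inv\<^bsub>G\<^esub> ?x \<otimes>\<^bsub>G\<^esub> inv\<^bsub>G\<^esub> ?y \<otimes>\<^bsub>G\<^esub> ?x)"
    using xy by (simp only: G.m_assoc G.inv_inv G.m_closed G.inv_closed)
  also have "\<dots> = ?y \<otimes>\<^bsub>G\<^esub> inv\<^bsub>G\<^esub> ?x \<otimes>\<^bsub>G\<^esub> inv\<^bsub>G\<^esub> ?y \<otimes>\<^bsub>G\<^esub> ?x" using xy by simp
  finally have iso: "?y \<otimes>\<^bsub>G\<^esub> inv\<^bsub>G\<^esub> ?x \<otimes>\<^bsub>G\<^esub> inv\<^bsub>G\<^esub> ?y \<otimes>\<^bsub>G\<^esub> ?x \<in> isolated n" .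
  \<comment> \<open>The identity is claimed only in coordinate \<open>n\<close>, the only one that
    matters for \<open>isolated n\<close>. There it concerns the labels 0 to 3, which are distinct
    because \<open>d n\<close> is at least 5; both sides fix all other labels.\<close>
  have "(?x \<otimes>\<^bsub>G\<^esub> ?y) n = (?y \<otimes>\<^bsub>G\<^esub> inv\<^bsub>G\<^esub> ?x \<otimes>\<^bsub>G\<^esub> inv\<^bsub>G\<^esub> ?y \<otimes>\<^bsub>G\<^esub> ?x) n"
  proof (rule G_coord_eqI[where g = "?x \<otimes>\<^bsub>G\<^esub> ?y"
        and h = "?y \<otimes>\<^bsub>G\<^esub> inv\<^bsub>G\<^esub> ?x \<otimes>\<^bsub>G\<^esub> inv\<^bsub>G\<^esub> ?y \<otimes>\<^bsub>G\<^esub> ?x" and n = n])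
    fix k assume k: "0 \<le> k" "k < int (d n)"
    have X0: "X n 0 n (lab n 0) = lab n 1" "X n 0 n (lab n 1) = lab n 2" "X n 0 n (lab n 2) = lab n 0"
      "X n 1 n (lab n 1) = lab n 2" "X n 1 n (lab n 2) = lab n 3" "X n 1 n (lab n 3) = lab n 1"
      using X_lab[of 0 n] X_lab[of 1 n] by simp_all
    have X1: "X n 0 n (lab n 3) = lab n 3" "X n 1 n (lab n 0) = lab n 0"
      using d_ge_5[of n] by (intro X_fix_lab; simp)+
    have X2: "X n 0 n (lab n k) = lab n k \<and> X n 1 n (lab n k) = lab n k" if "3 < k"
      using that k by (intro conjI X_fix_lab) simp_all
    have "k = 0 \<or> k = 1 \<or> k = 2 \<or> k = 3 \<or> 3 < k" using k by linarith
    then show "(?x \<otimes>\<^bsub>G\<^esub> ?y) n (lab n k) = (?y \<otimes>\<^bsub>G\<^esub> inv\<^bsub>G\<^esub> ?x \<otimes>\<^bsub>G\<^esub> inv\<^bsub>G\<^esub> ?y \<otimes>\<^bsub>G\<^esub> ?x) n (lab n k)"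
      unfolding inv mult_G using X0 X1 X2 by (elim disjE) (simp_all only: comp_apply simp_thms)
  qed (use xy in simp_all)
  then have "?x \<otimes>\<^bsub>G\<^esub> ?y \<in> isolated n" using isolated_cong[OF iso G.m_closed[OF xy]] by blast
  then have "rot (j * int (r n)) \<otimes>\<^bsub>G\<^esub> (?x \<otimes>\<^bsub>G\<^esub> ?y) \<otimes>\<^bsub>G\<^esub> rot (- (j * int (r n))) \<in> isolated n"
    by (rule isolated_rot_conj)
  also have "rot (j * int (r n)) \<otimes>\<^bsub>G\<^esub> (?x \<otimes>\<^bsub>G\<^esub> ?y) \<otimes>\<^bsub>G\<^esub> rot (- (j * int (r n))) =
      (rot (j * int (r n)) \<otimes>\<^bsub>G\<^esub> ?x \<otimes>\<^bsub>G\<^esub> rot (- (j * int (r n)))) \<otimes>\<^bsub>G\<^esub> (rot (j * int (r n)) \<otimes>\<^bsub>G\<^esub> ?y \<otimes>\<^bsub>G\<^esub> rot (- (j * int (r n))))"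
    unfolding inv_rot[symmetric] using xy rot_G[of "j * int (r n)"] by (simp add: G.m_assoc)
  also have "\<dots> = X n j \<otimes>\<^bsub>G\<^esub> X n (j + 1)" unfolding rot_B by (simp add: algebra_simps)
  finally show ?thesis .
qed

text \<open>Modulo \<open>isolated n\<close> each \<open>X n (j + 1)\<close> is the inverse of
  \<open>X n j\<close>, so \<open>X n j\<close> depends only on the parity of \<open>j\<close>.
  Since \<open>d n\<close> is odd, going once around the cycle identifies \<open>X n 0\<close> with
  its own inverse. An element whose square and cube are both trivial is trivial.\<close>

lemma beta_isolated:
  assumes "\<And>g. g \<in> carrier G \<Longrightarrow> trunc n g \<in> carrier G"
  shows "beta r \<in> isolated n"
proof -
  have prod: "X n j \<otimes>\<^bsub>G\<^esub> X n (j + 1) \<in> isolated n" for j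
    by (rule consecutive_product_isolated) (rule assms)
  have step: "X n j \<otimes>\<^bsub>G\<^esub> inv\<^bsub>G\<^esub> (X n (j + 2)) \<in> isolated n" for j
  proof -
    let ?a = "X n j" and ?b = "X n (j + 1)" and ?c = "X n (j + 2)"
    have c: "?a \<in> carrier G" "?b \<in> carrier G" "?c \<in> carrier G" by (rule B_G)+
    have "inv\<^bsub>G\<^esub> ?b \<otimes>\<^bsub>G\<^esub> (?b \<otimes>\<^bsub>G\<^esub> ?c) \<otimes>\<^bsub>G\<^esub> inv\<^bsub>G\<^esub> (inv\<^bsub>G\<^esub> ?b) \<in> isolated n"
      using prod[of "j + 1"] c by (intro isolated_conj) (simp_all add: add.assoc)
    also have "inv\<^bsub>G\<^esub> ?b \<otimes>\<^bsub>G\<^esub> (?b \<otimes>\<^bsub>G\<^esub> ?c) \<otimes>\<^bsub>G\<^esub> inv\<^bsub>G\<^esub> (inv\<^bsub>G\<^esub> ?b) = ?c \<otimes>\<^bsub>G\<^esub> ?b"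
      using c by (simp flip: G.m_assoc)
    finally have "?a \<otimes>\<^bsub>G\<^esub> ?b \<otimes>\<^bsub>G\<^esub> inv\<^bsub>G\<^esub> (?c \<otimes>\<^bsub>G\<^esub> ?b) \<in> isolated n"
      by (intro isolated_mult[OF prod[of j]] isolated_inv)
    also have "?a \<otimes>\<^bsub>G\<^esub> ?b \<otimes>\<^bsub>G\<^esub> inv\<^bsub>G\<^esub> (?c \<otimes>\<^bsub>G\<^esub> ?b) = ?a \<otimes>\<^bsub>G\<^esub> (?b \<otimes>\<^bsub>G\<^esub> inv\<^bsub>G\<^esub> ?b) \<otimes>\<^bsub>G\<^esub> inv\<^bsub>G\<^esub> ?c"
      using c by (simp only: G.m_assoc G.inv_mult_group G.m_closed G.inv_closed)
    also have "\<dots> = ?a \<otimes>\<^bsub>G\<^esub> inv\<^bsub>G\<^esub> ?c" using c by simp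
    finally show ?thesis .
  qed
  have tele: "X n 0 \<otimes>\<^bsub>G\<^esub> inv\<^bsub>G\<^esub> (X n (2 * int m)) \<in> isolated n" for m
  proof (induction m)
    case 0
    have "inv\<^bsub>G\<^esub> (X n 0) \<in> carrier G" "X n 0 \<in> carrier G" using B_G by simp_all
    then have "X n 0 \<otimes>\<^bsub>G\<^esub> inv\<^bsub>G\<^esub> (X n 0) = \<one>\<^bsub>G\<^esub>" by simp
    moreover have "\<one>\<^bsub>G\<^esub> \<in> isolated n"
      using isolated_mult[OF step[of 0] isolated_inv[OF step[of 0]]] isolated_G[OF step[of 0]] by simp
    ultimately show ?case by simp
  next
    case (Suc m)
    let ?a = "X n 0" and ?b = "X n (2 * int m)" and ?c = "X n (2 * int m + 2)"
    have c: "?a \<in> carrier G" "?b \<in> carrier G" "?c \<in> carrier G" by (rule B_G)+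
    have "(?a \<otimes>\<^bsub>G\<^esub> inv\<^bsub>G\<^esub> ?b) \<otimes>\<^bsub>G\<^esub> (?b \<otimes>\<^bsub>G\<^esub> inv\<^bsub>G\<^esub> ?c) \<in> isolated n"
      using Suc step by (rule isolated_mult)
    also have "(?a \<otimes>\<^bsub>G\<^esub> inv\<^bsub>G\<^esub> ?b) \<otimes>\<^bsub>G\<^esub> (?b \<otimes>\<^bsub>G\<^esub> inv\<^bsub>G\<^esub> ?c) = ?a \<otimes>\<^bsub>G\<^esub> (inv\<^bsub>G\<^esub> ?b \<otimes>\<^bsub>G\<^esub> ?b) \<otimes>\<^bsub>G\<^esub> inv\<^bsub>G\<^esub> ?c"
      using c by (simp only: G.m_assoc G.m_closed G.inv_closed)
    also have "\<dots> = ?a \<otimes>\<^bsub>G\<^esub> inv\<^bsub>G\<^esub> ?c" using c by simp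
    finally show ?case by (simp add: algebra_simps)
  qed
  obtain m where m: "d n = 2 * m + 1" using odd_d[of n] by (metis oddE)
  let ?a = "X n 0" and ?b = "X n (2 * int m)" and ?c = "X n (2 * int m + 1)"
  have c: "?a \<in> carrier G" "?b \<in> carrier G" "?c \<in> carrier G" by (rule B_G)+
  have "(?a \<otimes>\<^bsub>G\<^esub> inv\<^bsub>G\<^esub> ?b) \<otimes>\<^bsub>G\<^esub> (?b \<otimes>\<^bsub>G\<^esub> ?c) \<in> isolated n"
    using tele prod by (rule isolated_mult)
  also have "(?a \<otimes>\<^bsub>G\<^esub> inv\<^bsub>G\<^esub> ?b) \<otimes>\<^bsub>G\<^esub> (?b \<otimes>\<^bsub>G\<^esub> ?c) = ?a \<otimes>\<^bsub>G\<^esub> (inv\<^bsub>G\<^esub> ?b \<otimes>\<^bsub>G\<^esub> ?b) \<otimes>\<^bsub>G\<^esub> ?c"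
    using c by (simp only: G.m_assoc G.m_closed G.inv_closed)
  also have "\<dots> = ?a \<otimes>\<^bsub>G\<^esub> ?c" using c by simp
  finally have ac: "?a \<otimes>\<^bsub>G\<^esub> ?c \<in> isolated n" .
  \<comment> \<open>The factor \<open>2 * int m + 1\<close> is \<open>d n\<close>, so
    \<open>?c\<close> arises from \<beta> by a rotation that is trivial in coordinate
    \<open>n\<close>.\<close>
  have "?c n = ?a n"
  proof -
    have "(2 * int m + 1) * int (r n) = 0 + int (d n) * int (r n)"
      "- ((2 * int m + 1) * int (r n)) = 0 + int (d n) * (- int (r n))" using m by simp_all
    then have "rot ((2 * int m + 1) * int (r n)) n = id" "rot (- ((2 * int m + 1) * int (r n))) n = id"
      by (simp_all only: rot_period rot_0)
    then show ?thesis unfolding B_def mult_G by (simp add: rot_0)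
  qed
  then have "?a \<otimes>\<^bsub>G\<^esub> ?a \<in> isolated n"
    using isolated_cong[OF ac G.m_closed[OF c(1) c(1)]] by (simp only: mult_G)
  \<comment> \<open>The fourth power of \<beta> is \<beta>, because the cube is trivial.\<close>
  then have "(?a \<otimes>\<^bsub>G\<^esub> ?a) \<otimes>\<^bsub>G\<^esub> (?a \<otimes>\<^bsub>G\<^esub> ?a) \<in> isolated n" by (rule isolated_mult) fact
  also have "(?a \<otimes>\<^bsub>G\<^esub> ?a) \<otimes>\<^bsub>G\<^esub> (?a \<otimes>\<^bsub>G\<^esub> ?a) = (?a \<otimes>\<^bsub>G\<^esub> ?a \<otimes>\<^bsub>G\<^esub> ?a) \<otimes>\<^bsub>G\<^esub> ?a"
    using c by (simp only: G.m_assoc G.m_closed)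
  also have "\<dots> = beta r" unfolding B_cube using beta_G by (simp add: B_0)
  finally show ?thesis .
qed

text \<open>The full cycle on the labels is the product of the 3-cycles \<open>X n 0, X n 2, X n 4, \<dots>\<close>.\<close>

primrec cyc :: "nat \<Rightarrow> nat \<Rightarrow> nat \<Rightarrow> nat \<Rightarrow> nat" where
  "cyc n 0 = \<one>\<^bsub>G\<^esub>"
| "cyc n (Suc k) = cyc n k \<otimes>\<^bsub>G\<^esub> X n (2 * int k)"

lemma cyc_G: "cyc n k \<in> carrier G"
  by (induction k) (simp_all add: B_G)

text \<open>The partial product is the cycle on the labels 0 to \<open>2 * k\<close>. The new
  3-cycle acts first, as products compose from right to left, and it shares only the label
  \<open>2 * k\<close> with the previous cycle.\<close>

lemma cyc_lab:
  assumes "2 * k < d n" "0 \<le> j" "j < int (d n)"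
  shows "cyc n k n (lab n j) =
    (if j < 2 * int k then lab n (j + 1) else if j = 2 * int k then lab n 0 else lab n j)"
  using assms
proof (induction k arbitrary: j)
  case 0
  then show ?case by (simp add: one_G)
next
  case (Suc k)
  note IH = Suc.IH
  let ?k = "2 * int k"
  have k: "?k + 2 < int (d n)" using Suc.prems by simp
  have step: "cyc n (Suc k) n (lab n j) = cyc n k n (X n ?k n (lab n j))" by (simp add: mult_G)
  consider "j < ?k" | "j = ?k" | "j = ?k + 1" | "j = ?k + 2" | "?k + 2 < j" by linarith
  then show ?case
  proof cases
    case 1
    then have "X n ?k n (lab n j) = lab n j" using Suc.prems k by (intro X_fix_lab) auto
    then show ?thesis using 1 step IH[of j] Suc.prems by simp
  next
    case 2
    then show ?thesis using step X_lab(1)[of ?k n] IH[of "?k + 1"] Suc.prems k by simp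
  next
    case 3
    then show ?thesis using step X_lab(2)[of ?k n] IH[of "?k + 2"] Suc.prems k by (simp add: add.assoc)
  next
    case 4
    then show ?thesis using step X_lab(3)[of ?k n] IH[of "?k"] Suc.prems k by simp
  next
    case 5
    then have "X n ?k n (lab n j) = lab n j" using Suc.prems k by (intro X_fix_lab) auto
    then show ?thesis using 5 step IH[of j] Suc.prems by simp
  qed
qed

text \<open>With half of \<open>d n - 1\<close> factors the cycle runs through all labels and is the
  rotation by \<open>r n\<close> in coordinate \<open>n\<close>. Raising it to an inverse of
  \<open>r n\<close> modulo \<open>d n\<close> gives \<alpha> there.\<close>

lemma alpha_isolated:
  assumes "\<And>g. g \<in> carrier G \<Longrightarrow> trunc n g \<in> carrier G"
  shows "alpha d \<in> isolated n"
proof -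
  have B: "B i \<in> isolated n" for i
    unfolding B_def by (intro isolated_rot_conj beta_isolated assms)
  have one: "\<one>\<^bsub>G\<^esub> \<in> isolated n"
    using isolated_mult[OF B[of 0] isolated_inv[OF B[of 0]]] B_G by simp
  have cyc: "cyc n k \<in> isolated n" for k
    by (induction k) (simp_all add: one B isolated_mult)
  obtain m where m: "d n = 2 * m + 1" using odd_d[of n] by (metis oddE)
  have "cyc n m n = rot (int (r n)) n"
  proof (rule G_coord_eqI[OF cyc_G rot_G])
    fix k assume k: "0 \<le> k" "k < int (d n)"
    have "rot (int (r n)) n (lab n k) = lab n (k + 1)"
      by (simp add: lab_def rot_pt algebra_simps)
    moreover have "lab n (2 * int m + 1) = lab n 0" using m by (simp add: lab_eq_iff add.commute)
    moreover have "k < 2 * int m \<or> k = 2 * int m" using k m by linarith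
    ultimately show "cyc n m n (lab n k) = rot (int (r n)) n (lab n k)"
      using cyc_lab[of m n k] k m by auto
  qed
  then have rot_r: "rot (int (r n)) \<in> isolated n"
    using isolated_cong[OF cyc rot_G] by metis
  have pow: "rot (int (r n) * int s) \<in> isolated n" for s
  proof (induction s)
    case 0
    then show ?case by (simp add: rot_zero one)
  next
    case (Suc s)
    then show ?case using isolated_mult[OF Suc rot_r] by (simp add: rot_mult algebra_simps)
  qed
  obtain s where s: "[int (r n) * s = 1] (mod int (d n))"
    using cong_solve_coprime_int[OF coprime_r_d[of n]] by blast
  \<comment> \<open>The inverse is made a natural number because \<open>pow\<close> is stated for
    natural multiples.\<close>
  define s' where "s' = nat (s mod int (d n))"
  have "int s' = s mod int (d n)" by (simp add: s'_def)
  then have "[int (r n) * int s' = 1] (mod int (d n))"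
    using s by (simp add: cong_def mod_mult_right_eq)
  then obtain k where "int (r n) * int s' = 1 + int (d n) * k"
    by (metis cong_iff_lin cong_sym)
  then have "rot (int (r n) * int s') n = alpha d n" by (simp only: rot_period rot_1)
  then show ?thesis using isolated_cong[OF pow alpha_G] by metis
qed

text \<open>The induction alternates between two facts: truncation at \<open>n\<close> isolates both
  generators in coordinate \<open>n\<close>, hence every element, and the isolated coordinate
  extends the truncation to \<open>Suc n\<close>.\<close>

lemma trunc_G: "g \<in> carrier G \<Longrightarrow> trunc n g \<in> carrier G"
proof (induction n arbitrary: g)
  case 0
  have "trunc 0 g = \<one>\<^bsub>G\<^esub>" by (simp add: trunc_def one_G)
  then show ?case by simp
next
  case (Suc n)
  have "g \<in> isolated n"
    using Suc.prems
  proof (induction rule: G_induct)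
    case one
    then show ?case
      using isolated_mult[of "beta r" n "inv\<^bsub>G\<^esub> (beta r)"] isolated_inv beta_isolated Suc.IH beta_G by simp
  qed (use Suc.IH in \<open>auto intro: alpha_isolated beta_isolated isolated_inv isolated_mult\<close>)
  then have "coord n g \<in> carrier G" by (simp add: isolated_def)
  moreover have "trunc (Suc n) g = trunc n g \<otimes>\<^bsub>G\<^esub> coord n g"
    by (auto simp: trunc_def coord_def mult_G less_Suc_eq)
  ultimately show ?case using Suc by simp
qed

subsection \<open>Lamp configurations\<close>

text \<open>\<open>lamps g e \<epsilon>\<close> says that \<open>g\<close> acts like the element of the lamplighter group
  \<open>\<int>/3 \<wr> \<int>\<close> with shift \<open>e\<close> and lamp configuration \<open>\<epsilon>\<close> in the limit \<open>n \<rightarrow> \<infinity>\<close>, where three copies of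
  the integers appear around the points \<open>1\<close>, \<open>1 + r n\<close>, \<open>1 + 2 * r n\<close>.\<close>

definition lamps :: "(nat \<Rightarrow> nat \<Rightarrow> nat) \<Rightarrow> int \<Rightarrow> (int \<Rightarrow> int) \<Rightarrow> bool" where
  "lamps g e \<epsilon> \<longleftrightarrow> finite {i. \<epsilon> i \<noteq> 0} \<and>
     (\<forall>i c. \<forall>\<^sub>F n in sequentially. g n (pt n i c) = pt n (i + e) (c + \<epsilon> i))"

lemma eventually_r_gt: "\<forall>\<^sub>F n in sequentially. k < int (r n)"
proof (rule eventually_sequentiallyI)
  fix n assume "nat k + 1 \<le> n"
  then show "k < int (r n)" using r_ge[of n] by linarith
qed

text \<open>A single coordinate with \<open>r n\<close> larger than the difference of the shifts
  suffices, since \<open>pt\<close> separates the positions there. The lamps are determined only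
  modulo 3 because \<open>c\<close> is.\<close>

lemma lamps_unique:
  assumes "lamps g e \<epsilon>" "lamps g e' \<epsilon>'"
  shows "e = e'" "\<epsilon> i mod 3 = \<epsilon>' i mod 3"
proof -
  have "\<forall>\<^sub>F n in sequentially. g n (pt n i 0) = pt n (i + e) (0 + \<epsilon> i) \<and>
      g n (pt n i 0) = pt n (i + e') (0 + \<epsilon>' i) \<and> \<bar>e - e'\<bar> < int (r n)"
    using assms unfolding lamps_def by (intro eventually_conj eventually_r_gt) blast+
  from eventually_happens'[OF sequentially_bot this]
  obtain n where "g n (pt n i 0) = pt n (i + e) (0 + \<epsilon> i)"
      "g n (pt n i 0) = pt n (i + e') (0 + \<epsilon>' i)" "\<bar>e - e'\<bar> < int (r n)"
    by blast
  then have "pt n (i + e) (\<epsilon> i) = pt n (i + e') (\<epsilon>' i)" "\<bar>(i + e) - (i + e')\<bar> < int (r n)" by simp_all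
  then have "i + e = i + e' \<and> \<epsilon> i mod 3 = \<epsilon>' i mod 3" using pt_eq_iff by blast
  then show "e = e'" "\<epsilon> i mod 3 = \<epsilon>' i mod 3" by simp_all
qed

lemma lamps_one: "lamps \<one>\<^bsub>G\<^esub> 0 (\<lambda>_. 0)"
  by (simp add: lamps_def one_G)

lemma lamps_rot: "lamps (rot i) i (\<lambda>_. 0)"
  by (simp add: lamps_def rot_pt)

lemma lamps_beta: "lamps (beta r) 0 (\<lambda>i. if i = 0 then 1 else 0)"
  unfolding lamps_def
proof (intro conjI allI)
  fix i c
  show "\<forall>\<^sub>F n in sequentially. beta r n (pt n i c) = pt n (i + 0) (c + (if i = 0 then 1 else 0))"
  proof (cases "i = 0")
    case False
    then show ?thesis
      using eventually_r_gt[of "\<bar>i\<bar>"] by (auto simp: beta_fix_pt elim: eventually_mono)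
  qed (simp add: beta_pt)
qed (simp add: if_distrib)

text \<open>This is multiplication in the wreath product: \<open>h\<close> acts first and moves
  position \<open>i\<close> to \<open>i + e'\<close>, where \<open>g\<close> reads its lamp.\<close>

lemma lamps_mult:
  assumes "lamps g e \<epsilon>" "lamps h e' \<epsilon>'"
  shows "lamps (g \<otimes>\<^bsub>G\<^esub> h) (e + e') (\<lambda>i. \<epsilon>' i + \<epsilon> (i + e'))"
  unfolding lamps_def
proof (intro conjI allI)
  have "finite ((\<lambda>i. i + e') -` {i. \<epsilon> i \<noteq> 0})"
    using assms(1) unfolding lamps_def by (intro finite_vimageI) auto
  then have "finite ({i. \<epsilon>' i \<noteq> 0} \<union> (\<lambda>i. i + e') -` {i. \<epsilon> i \<noteq> 0})"
    using assms(2) by (simp add: lamps_def)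
  then show "finite {i. \<epsilon>' i + \<epsilon> (i + e') \<noteq> 0}" by (rule rev_finite_subset) auto
  fix i c
  have "\<forall>\<^sub>F n in sequentially. h n (pt n i c) = pt n (i + e') (c + \<epsilon>' i)"
    using assms(2) unfolding lamps_def by blast
  moreover have "\<forall>\<^sub>F n in sequentially. g n (pt n (i + e') (c + \<epsilon>' i)) = pt n (i + e' + e) (c + \<epsilon>' i + \<epsilon> (i + e'))"
    using assms(1) unfolding lamps_def by blast
  ultimately show "\<forall>\<^sub>F n in sequentially. (g \<otimes>\<^bsub>G\<^esub> h) n (pt n i c) = pt n (i + (e + e')) (c + (\<epsilon>' i + \<epsilon> (i + e')))"
    by eventually_elim (simp add: mult_G ac_simps)
qed

lemma lamps_inv:
  assumes "g \<in> carrier G" "lamps g e \<epsilon>"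
  shows "lamps (inv\<^bsub>G\<^esub> g) (- e) (\<lambda>i. - \<epsilon> (i - e))"
  unfolding lamps_def
proof (intro conjI allI)
  have "finite ((\<lambda>i. i - e) -` {i. \<epsilon> i \<noteq> 0})"
    using assms(2) unfolding lamps_def by (intro finite_vimageI) (auto simp: inj_on_def)
  then show "finite {i. - \<epsilon> (i - e) \<noteq> 0}" by (simp add: vimage_def)
  fix i c
  have "\<forall>\<^sub>F n in sequentially. g n (pt n (i - e) (c - \<epsilon> (i - e))) = pt n (i - e + e) (c - \<epsilon> (i - e) + \<epsilon> (i - e))"
    using assms(2) unfolding lamps_def by blast
  then show "\<forall>\<^sub>F n in sequentially. (inv\<^bsub>G\<^esub> g) n (pt n i c) = pt n (i + - e) (c + - \<epsilon> (i - e))"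
  proof eventually_elim
    case (elim n)
    then have "g n (pt n (i - e) (c - \<epsilon> (i - e))) = pt n i c" by simp
    then have "inv' (g n) (pt n i c) = pt n (i - e) (c - \<epsilon> (i - e))"
      by (simp add: permutes_inv_eq[OF G_permutes[OF assms(1)]])
    then show ?case by (simp add: inv_G[OF assms(1)])
  qed
qed

lemma lamps_exists: "g \<in> carrier G \<Longrightarrow> \<exists>e \<epsilon>. lamps g e \<epsilon>"
proof (induction rule: G_induct)
  case alpha
  then show ?case using lamps_rot[of 1] unfolding rot_1 by blast
qed (blast intro: lamps_one lamps_beta lamps_inv lamps_mult)+

definition shift :: "(nat \<Rightarrow> nat \<Rightarrow> nat) \<Rightarrow> int" where
  "shift g = (SOME e. \<exists>\<epsilon>. lamps g e \<epsilon>)"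

text \<open>A choice among configurations that agree modulo 3 at every position; the ambiguity
  disappears in \<open>res\<close>.\<close>

definition lamp :: "(nat \<Rightarrow> nat \<Rightarrow> nat) \<Rightarrow> int \<Rightarrow> int" where
  "lamp g = (SOME \<epsilon>. lamps g (shift g) \<epsilon>)"

text \<open>The lamp configuration folded onto the residues modulo \<open>w\<close>: all lamps in
  the class of \<open>c\<close> are added, a finite sum for positive \<open>w\<close>. Together with
  the shift modulo \<open>w\<close> this is the image in the finite lamplighter group.\<close>

definition res :: "nat \<Rightarrow> (nat \<Rightarrow> nat \<Rightarrow> nat) \<Rightarrow> int \<Rightarrow> int" where
  "res w g c = (Sum_any (\<lambda>k. lamp g (c + int w * k))) mod 3"

lemma lamps_lamp:
  assumes "g \<in> carrier G" shows "lamps g (shift g) (lamp g)"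
proof -
  have "\<exists>\<epsilon>. lamps g (shift g) \<epsilon>"
    unfolding shift_def using lamps_exists[OF assms] by (rule someI_ex)
  then show ?thesis unfolding lamp_def by (rule someI_ex)
qed

lemma shift_eq: "g \<in> carrier G \<Longrightarrow> lamps g e \<epsilon> \<Longrightarrow> shift g = e"
  using lamps_lamp lamps_unique(1) by blast

lemma shift_mult:
  "g \<in> carrier G \<Longrightarrow> h \<in> carrier G \<Longrightarrow> shift (g \<otimes>\<^bsub>G\<^esub> h) = shift g + shift h"
  by (rule shift_eq[OF _ lamps_mult[OF lamps_lamp lamps_lamp]]) simp_all

lemma shift_inv: "g \<in> carrier G \<Longrightarrow> shift (inv\<^bsub>G\<^esub> g) = - shift g"
  by (rule shift_eq[OF _ lamps_inv[OF _ lamps_lamp]]) simp_all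

lemma shift_rot: "shift (rot i) = i"
  by (rule shift_eq[OF rot_G lamps_rot])

lemma shift_beta: "shift (beta r) = 0"
  by (rule shift_eq[OF beta_G lamps_beta])

lemma finite_residue_support:
  assumes "finite {i. \<epsilon> i \<noteq> (0::int)}" "0 < w"
  shows "finite {k. \<epsilon> (c + int w * k) \<noteq> 0}"
proof -
  have "finite ((\<lambda>k. c + int w * k) -` {i. \<epsilon> i \<noteq> 0})"
    using assms by (intro finite_vimageI) (auto simp: inj_on_def)
  then show ?thesis by (simp add: vimage_def)
qed

lemma res_eq:
  assumes "g \<in> carrier G" "lamps g e \<epsilon>" "0 < w"
  shows "res w g c = (Sum_any (\<lambda>k. \<epsilon> (c + int w * k))) mod 3"
proof -
  let ?l = "\<lambda>k. lamp g (c + int w * k)" and ?e = "\<lambda>k. \<epsilon> (c + int w * k)"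
  let ?A = "{k. ?l k \<noteq> 0} \<union> {k. ?e k \<noteq> 0}"
  have "finite {k. ?l k \<noteq> 0}" "finite {k. ?e k \<noteq> 0}"
    using assms lamps_lamp[OF assms(1)] by (auto simp: lamps_def intro!: finite_residue_support)
  then have A: "finite ?A" by simp
  have "(\<Sum>k\<in>?A. ?l k) mod 3 = (\<Sum>k\<in>?A. ?l k mod 3) mod 3" by (simp add: mod_sum_eq)
  also have "(\<Sum>k\<in>?A. ?l k mod 3) = (\<Sum>k\<in>?A. ?e k mod 3)"
    by (rule sum.cong[OF refl]) (rule lamps_unique(2)[OF lamps_lamp[OF assms(1)] assms(2)])
  also have "\<dots> mod 3 = (\<Sum>k\<in>?A. ?e k) mod 3" by (simp add: mod_sum_eq)
  finally show ?thesis
    unfolding res_def using Sum_any.expand_superset[OF A, of ?l] Sum_any.expand_superset[OF A, of ?e]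
    by simp
qed

text \<open>The rule of \<open>lamps_mult\<close> survives the folding, because translation by
  \<open>shift h\<close> maps residue classes to residue classes.\<close>

lemma res_mult:
  assumes "g \<in> carrier G" "h \<in> carrier G" "0 < w"
  shows "res w (g \<otimes>\<^bsub>G\<^esub> h) c = (res w h c + res w g (c + shift h)) mod 3"
proof -
  have fin: "finite {i. lamp g i \<noteq> 0}" "finite {i. lamp h i \<noteq> 0}"
    using lamps_lamp assms(1,2) by (auto simp: lamps_def)
  have "res w (g \<otimes>\<^bsub>G\<^esub> h) c =
      Sum_any (\<lambda>k. lamp h (c + int w * k) + lamp g (c + int w * k + shift h)) mod 3"
    using assms by (intro res_eq[OF _ lamps_mult[OF lamps_lamp lamps_lamp]]) simp_all
  also have "Sum_any (\<lambda>k. lamp h (c + int w * k) + lamp g (c + int w * k + shift h)) =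
      Sum_any (\<lambda>k. lamp h (c + int w * k) + lamp g ((c + shift h) + int w * k))"
    by (simp add: ac_simps)
  also have "\<dots> = Sum_any (\<lambda>k. lamp h (c + int w * k)) + Sum_any (\<lambda>k. lamp g ((c + shift h) + int w * k))"
    using fin assms(3) by (intro Sum_any.distrib finite_residue_support)
  finally show ?thesis by (simp add: res_def mod_add_eq)
qed

lemma res_period: "res w g (c + int w * m) = res w g c"
proof -
  have "Sum_any (\<lambda>k. lamp g (c + int w * k)) = Sum_any (\<lambda>k. lamp g (c + int w * m + int w * k))"
  proof (rule Sum_any.reindex_cong[of "\<lambda>k. m + k"])
    show "bij (\<lambda>k. m + k)" by (rule o_bij[of "\<lambda>k. k - m"]) auto
  qed (simp add: o_def algebra_simps)
  then show ?thesis by (simp add: res_def)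
qed

lemma res_dvd:
  assumes "int w dvd m" shows "res w g (c + m) = res w g c"
  using assms by (auto simp: res_period elim: dvdE)

lemma res_one: "0 < w \<Longrightarrow> res w \<one>\<^bsub>G\<^esub> c = 0"
  by (subst res_eq[OF _ lamps_one]) simp_all

lemma res_bounds: "0 \<le> res w g c" "res w g c < 3"
  by (simp_all add: res_def)

section \<open>The kernel of the finite quotient\<close>

definition Ker :: "nat \<Rightarrow> nat \<Rightarrow> (nat \<Rightarrow> nat \<Rightarrow> nat) set" where
  "Ker N w = {g \<in> carrier G. (\<forall>n<N. g n = id) \<and> int w dvd shift g \<and> (\<forall>c. res w g c = 0)}"

lemma Ker_mult_inv:
  assumes w: "0 < w" and gh: "g \<in> carrier G" "h \<in> carrier G"
    and eq: "\<And>n. n < N \<Longrightarrow> g n = h n" "int w dvd shift g - shift h" "\<And>c. res w g c = res w h c"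
  shows "g \<otimes>\<^bsub>G\<^esub> inv\<^bsub>G\<^esub> h \<in> Ker N w"
proof -
  \<comment> \<open>In \<open>res_mult\<close> the left factor enters only through its residues, so
    \<open>g\<close> may be replaced by \<open>h\<close> and no configuration of an inverse has to
    be computed.\<close>
  have "res w (g \<otimes>\<^bsub>G\<^esub> inv\<^bsub>G\<^esub> h) c = res w (h \<otimes>\<^bsub>G\<^esub> inv\<^bsub>G\<^esub> h) c" for c
    using gh w by (simp only: res_mult G.inv_closed eq(3))
  then have "res w (g \<otimes>\<^bsub>G\<^esub> inv\<^bsub>G\<^esub> h) c = 0" for c
    using gh w by (simp add: res_one)
  moreover have "(g \<otimes>\<^bsub>G\<^esub> inv\<^bsub>G\<^esub> h) n = id" if "n < N" for n
    using permutes_inv_o(1)[OF G_permutes[OF gh(2), of n]] by (simp add: mult_G inv_G[OF gh(2)] eq(1)[OF that])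
  moreover have "int w dvd shift (g \<otimes>\<^bsub>G\<^esub> inv\<^bsub>G\<^esub> h)"
    using gh eq(2) by (simp add: shift_mult shift_inv)
  ultimately show ?thesis using gh by (simp add: Ker_def)
qed

lemma Ker_mult_right:
  assumes "0 < w" "g \<in> carrier G" "k \<in> Ker N w"
  shows "res w (g \<otimes>\<^bsub>G\<^esub> k) c = res w g c" "int w dvd shift (g \<otimes>\<^bsub>G\<^esub> k) - shift g"
    "n < N \<Longrightarrow> (g \<otimes>\<^bsub>G\<^esub> k) n = g n"
proof -
  have k: "k \<in> carrier G" "int w dvd shift k" "\<And>c. res w k c = 0" using assms(3) by (auto simp: Ker_def)
  show "res w (g \<otimes>\<^bsub>G\<^esub> k) c = res w g c"
    using k assms(1,2) res_bounds[of w g c] by (simp add: res_mult res_dvd)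
  show "int w dvd shift (g \<otimes>\<^bsub>G\<^esub> k) - shift g" using k assms(2) by (simp add: shift_mult)
  show "(g \<otimes>\<^bsub>G\<^esub> k) n = g n" if "n < N" using assms(3) that by (simp add: Ker_def mult_G)
qed

lemma Ker_subgroup: "0 < w \<Longrightarrow> subgroup (Ker N w) G"
proof (rule G.subgroupI)
  assume w: "0 < w"
  have one: "\<one>\<^bsub>G\<^esub> \<in> Ker N w"
    using Ker_mult_inv[OF w, of "\<one>\<^bsub>G\<^esub>" "\<one>\<^bsub>G\<^esub>" N] by simp
  then show "Ker N w \<noteq> {}" by blast
  show "Ker N w \<subseteq> carrier G" by (auto simp: Ker_def)
  show "inv\<^bsub>G\<^esub> k \<in> Ker N w" if "k \<in> Ker N w" for k
  proof -
    have "\<one>\<^bsub>G\<^esub> \<otimes>\<^bsub>G\<^esub> inv\<^bsub>G\<^esub> k \<in> Ker N w"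
      using that one by (intro Ker_mult_inv[OF w]) (auto simp: Ker_def)
    then show ?thesis using that by (simp add: Ker_def)
  qed
  show "k \<otimes>\<^bsub>G\<^esub> k' \<in> Ker N w" if "k \<in> Ker N w" "k' \<in> Ker N w" for k k'
  proof -
    have k: "k \<in> carrier G" "k' \<in> carrier G" using that by (auto simp: Ker_def)
    note right = Ker_mult_right[OF w k(1) that(2)]
    have "int w dvd shift (k \<otimes>\<^bsub>G\<^esub> k')" using that k by (simp add: Ker_def shift_mult)
    moreover have "\<forall>n<N. (k \<otimes>\<^bsub>G\<^esub> k') n = id" using right(3) that(1) by (simp add: Ker_def)
    moreover have "\<forall>c. res w (k \<otimes>\<^bsub>G\<^esub> k') c = 0" using right(1) that(1) by (simp add: Ker_def)
    ultimately show ?thesis using k unfolding Ker_def by simp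
  qed
qed

text \<open>Right multiplication by \<open>k\<close> changes none of the data recorded for
  \<open>g\<close>. So \<open>g k\<close> and \<open>g\<close> are indistinguishable in the
  quotient, and \<open>g k g^-1\<close> lies in the kernel.\<close>

lemma Ker_normal:
  assumes w: "0 < w" shows "Ker N w \<lhd> G"
proof (rule G.normalI[OF Ker_subgroup[OF w]], rule ballI)
  fix g assume g: "g \<in> carrier G"
  have conj: "g \<otimes>\<^bsub>G\<^esub> k \<otimes>\<^bsub>G\<^esub> inv\<^bsub>G\<^esub> g \<in> Ker N w" if "k \<in> Ker N w" "g \<in> carrier G" for g k
    using that by (intro Ker_mult_inv[OF w] Ker_mult_right[OF w that(2,1)]) (auto simp: Ker_def)
  show "Ker N w #>\<^bsub>G\<^esub> g = g <#\<^bsub>G\<^esub> Ker N w"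
  proof
    show "g <#\<^bsub>G\<^esub> Ker N w \<subseteq> Ker N w #>\<^bsub>G\<^esub> g"
    proof
      fix x assume "x \<in> g <#\<^bsub>G\<^esub> Ker N w"
      then obtain k where k: "k \<in> Ker N w" "x = g \<otimes>\<^bsub>G\<^esub> k" by (auto simp: l_coset_def)
      then have "k \<in> carrier G" by (simp add: Ker_def)
      then have "x = (g \<otimes>\<^bsub>G\<^esub> k \<otimes>\<^bsub>G\<^esub> inv\<^bsub>G\<^esub> g) \<otimes>\<^bsub>G\<^esub> g" using k g by (simp add: G.m_assoc)
      then show "x \<in> Ker N w #>\<^bsub>G\<^esub> g" using conj[OF k(1) g] unfolding r_coset_def by blast
    qed
    show "Ker N w #>\<^bsub>G\<^esub> g \<subseteq> g <#\<^bsub>G\<^esub> Ker N w"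
    proof
      fix x assume "x \<in> Ker N w #>\<^bsub>G\<^esub> g"
      then obtain k where k: "k \<in> Ker N w" "x = k \<otimes>\<^bsub>G\<^esub> g" by (auto simp: r_coset_def)
      then have "k \<in> carrier G" by (simp add: Ker_def)
      then have "x = g \<otimes>\<^bsub>G\<^esub> (inv\<^bsub>G\<^esub> g \<otimes>\<^bsub>G\<^esub> k \<otimes>\<^bsub>G\<^esub> inv\<^bsub>G\<^esub> (inv\<^bsub>G\<^esub> g))" using k g by (simp add: G.m_assoc)
      then show "x \<in> g <#\<^bsub>G\<^esub> Ker N w" using conj[OF k(1) G.inv_closed[OF g]] unfolding l_coset_def by blast
    qed
  qed
qed

text \<open>The invariants are the first \<open>N\<close> coordinates, the shift modulo
  \<open>w\<close> and one period of the folded lamps. The restrictions to finite domains make the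
  set of their values finite.\<close>

lemma Ker_finite_index:
  assumes w: "0 < w" shows "finite (rcosets\<^bsub>G\<^esub> (Ker N w))"
proof (rule G.finite_rcosets_factor[OF Ker_subgroup[OF w]])
  let ?\<phi> = "\<lambda>g. (restrict g {..<N}, shift g mod int w, restrict (res w g) {0..<int w})"
  have "?\<phi> ` carrier G \<subseteq> PiE {..<N} (\<lambda>n. {p. p permutes {1..d n}}) \<times> {0..<int w} \<times> PiE {0..<int w} (\<lambda>_. {0..<3})"
    using w G_permutes res_bounds by (auto simp: PiE_iff)
  moreover have "finite (PiE {..<N} (\<lambda>n. {p. p permutes {1..d n}}) \<times> {0..<int w} \<times> PiE {0..<int w} (\<lambda>_. {0..<3::int}))"
    by (intro finite_cartesian_product finite_PiE finite_permutations) auto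
  ultimately show "finite (?\<phi> ` carrier G)" by (rule finite_subset)
  fix g h assume gh: "g \<in> carrier G" "h \<in> carrier G" "?\<phi> g = ?\<phi> h"
  show "g \<otimes>\<^bsub>G\<^esub> inv\<^bsub>G\<^esub> h \<in> Ker N w"
  proof (rule Ker_mult_inv[OF w gh(1,2)])
    fix n assume "n < N"
    then show "g n = h n" using gh(3) by (metis (no_types, lifting) lessThan_iff prod.inject restrict_apply')
  next
    show "int w dvd shift g - shift h" using gh(3) by (simp add: mod_eq_dvd_iff)
  next
    fix c
    have "restrict (res w g) {0..<int w} (c mod int w) = restrict (res w h) {0..<int w} (c mod int w)"
      using gh(3) by simp
    then have "res w g (c mod int w) = res w h (c mod int w)" using w by simp
    moreover have "res w f c = res w f (c mod int w)" for f
      using res_period[of w f "c mod int w" "c div int w"] by simp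
    ultimately show "res w g c = res w h c" by simp
  qed
qed

section \<open>Elements supported in a window\<close>

definition window :: "nat \<Rightarrow> (nat \<Rightarrow> nat \<Rightarrow> nat) \<Rightarrow> (int \<Rightarrow> int) \<Rightarrow> bool" where
  "window N g \<epsilon> \<longleftrightarrow> (\<forall>n\<ge>N. (\<forall>i c. 0 \<le> i \<and> i < int (r N) \<longrightarrow> g n (pt n i c) = pt n i (c + \<epsilon> i)) \<and>
     (\<forall>x. (\<forall>i c. 0 \<le> i \<and> i < int (r N) \<longrightarrow> x \<noteq> pt n i c) \<longrightarrow> g n x = x))"

text \<open>This is the finite group \<open>Y\<close> of the overview. In contrast to
  \<open>lamps\<close>, the condition \<open>window\<close> is exact from coordinate
  \<open>N\<close> on, with one configuration for all these coordinates and all points outside the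
  window fixed; the coordinates before \<open>N\<close> are left free.\<close>

definition Win :: "nat \<Rightarrow> (nat \<Rightarrow> nat \<Rightarrow> nat) set" where
  "Win N = {g \<in> carrier G. \<exists>\<epsilon>. window N g \<epsilon>}"

lemma window_mult:
  assumes "window N g \<epsilon>" "window N h \<epsilon>'"
  shows "window N (g \<otimes>\<^bsub>G\<^esub> h) (\<lambda>i. \<epsilon> i + \<epsilon>' i)"
  using assms unfolding window_def mult_G by (auto simp: ac_simps)

lemma window_inv:
  assumes "g \<in> carrier G" "window N g \<epsilon>"
  shows "window N (inv\<^bsub>G\<^esub> g) (\<lambda>i. - \<epsilon> i)"
  unfolding window_def inv_G[OF assms(1)] permutes_inv_eq[OF G_permutes[OF assms(1)]]
proof (intro allI impI conjI)
  fix n i c assume n: "N \<le> n" and i: "0 \<le> i \<and> i < int (r N)"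
  then have "g n (pt n i (c + - \<epsilon> i)) = pt n i (c + - \<epsilon> i + \<epsilon> i)"
    using assms(2) unfolding window_def by blast
  then show "g n (pt n i (c + - \<epsilon> i)) = pt n i c" by simp
next
  fix n x assume "N \<le> n" "\<forall>i c. 0 \<le> i \<and> i < int (r N) \<longrightarrow> x \<noteq> pt n i c"
  then show "g n x = x" using assms(2) unfolding window_def by blast
qed

lemma window_one: "window N \<one>\<^bsub>G\<^esub> (\<lambda>_. 0)"
  by (simp add: window_def one_G)

lemma r_mono_le: "N \<le> n \<Longrightarrow> r N \<le> r n"
  using strict_mono_r by (simp add: strict_mono_less_eq)

lemma window_B:
  assumes "0 \<le> i" "i < int (r N)"
  shows "window N (B i) (\<lambda>j. if j = i then 1 else 0)"
  unfolding window_def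
proof (intro allI impI conjI)
  fix n j c assume n: "N \<le> n" and j: "0 \<le> j \<and> j < int (r N)"
  show "B i n (pt n j c) = pt n j (c + (if j = i then 1 else 0))"
  proof (cases "j = i")
    case False
    then have "B i n (pt n j c) = pt n j c"
    proof (intro B_fix)
      fix c'
      have "\<bar>j - i\<bar> < int (r n)" using j assms r_mono_le[OF n] by linarith
      then show "pt n j c \<noteq> pt n i c'" using False by (simp add: pt_eq_iff)
    qed
    then show ?thesis using False by simp
  qed (simp add: B_pt)
next
  fix n x assume "\<forall>j c. 0 \<le> j \<and> j < int (r N) \<longrightarrow> x \<noteq> pt n j c"
  then show "B i n x = x" using assms by (intro B_fix) blast
qed

lemma Win_subgroup: "subgroup (Win N) G"
proof (rule G.subgroupI)
  have "\<one>\<^bsub>G\<^esub> \<in> Win N" using window_one by (auto simp: Win_def)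
  then show "Win N \<noteq> {}" by blast
qed (auto simp: Win_def intro: window_mult window_inv)

lemma window_lamps:
  assumes "window N g \<epsilon>"
  shows "lamps g 0 (\<lambda>i. if 0 \<le> i \<and> i < int (r N) then \<epsilon> i else 0)"
  unfolding lamps_def
proof (intro conjI allI)
  have "finite {0..<int (r N)}" by simp
  then show "finite {i. (if 0 \<le> i \<and> i < int (r N) then \<epsilon> i else 0) \<noteq> 0}"
    by (rule rev_finite_subset) (auto split: if_splits)
  fix i c
  have "\<forall>\<^sub>F n in sequentially. N \<le> n \<and> \<bar>i\<bar> + int (r N) < int (r n)"
    by (intro eventually_conj eventually_r_gt eventually_ge_at_top)
  then show "\<forall>\<^sub>F n in sequentially. g n (pt n i c) =
      pt n (i + 0) (c + (if 0 \<le> i \<and> i < int (r N) then \<epsilon> i else 0))"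
  proof eventually_elim
    case (elim n)
    show ?case
    proof (cases "0 \<le> i \<and> i < int (r N)")
      case True
      then show ?thesis using assms elim unfolding window_def by simp
    next
      case False
      have "pt n i c \<noteq> pt n i' c'" if "0 \<le> i' \<and> i' < int (r N)" for i' c'
      proof -
        have "\<bar>i - i'\<bar> < int (r n)" using that elim by linarith
        then show ?thesis using that False by (auto simp: pt_eq_iff)
      qed
      then have "g n (pt n i c) = pt n i c" using assms elim unfolding window_def by blast
      then show ?thesis using False by auto
    qed
  qed
qed

lemma window_shift: "g \<in> carrier G \<Longrightarrow> window N g \<epsilon> \<Longrightarrow> shift g = 0"
  using shift_eq window_lamps by blast

text \<open>A window contains exactly one position of each residue class modulo \<open>r N\<close>,
  so the folded sum has a single term.\<close>

lemma window_res:
  assumes "g \<in> carrier G" "window N g \<epsilon>" "0 \<le> c" "c < int (r N)"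
  shows "res (r N) g c = \<epsilon> c mod 3"
proof -
  have w: "0 < r N" using r_pos[of N] by simp
  let ?\<epsilon> = "\<lambda>i. if 0 \<le> i \<and> i < int (r N) then \<epsilon> i else 0"
  have "{k. ?\<epsilon> (c + int (r N) * k) \<noteq> 0} \<subseteq> {0}"
  proof
    fix k assume "k \<in> {k. ?\<epsilon> (c + int (r N) * k) \<noteq> 0}"
    then have k: "0 \<le> c + int (r N) * k" "c + int (r N) * k < int (r N)" by (auto split: if_splits)
    have "k = (c + int (r N) * k) div int (r N)" using assms(3,4) w by simp
    also have "\<dots> = 0" using k by simp
    finally show "k \<in> {0}" by simp
  qed
  then have "Sum_any (\<lambda>k. ?\<epsilon> (c + int (r N) * k)) = (\<Sum>k\<in>{0}. ?\<epsilon> (c + int (r N) * k))"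
    by (intro Sum_any.expand_superset) simp_all
  then show ?thesis using res_eq[OF assms(1) window_lamps[OF assms(2)] w, of c] assms(3,4) by simp
qed

text \<open>Vanishing residues make all lamps of the window 0 modulo 3, which settles the
  coordinates from \<open>N\<close> on; the earlier ones are trivial by the definition of the
  kernel.\<close>

lemma Win_Ker: "Win N \<inter> Ker N (r N) = {\<one>\<^bsub>G\<^esub>}"
proof
  have "g = \<one>\<^bsub>G\<^esub>" if g: "g \<in> Win N" "g \<in> Ker N (r N)" for g
  proof -
    obtain \<epsilon> where \<epsilon>: "g \<in> carrier G" "window N g \<epsilon>" using g by (auto simp: Win_def)
    have "g n x = x" if n: "N \<le> n" for n x
    proof (cases "\<exists>i c. 0 \<le> i \<and> i < int (r N) \<and> x = pt n i c")
      case True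
      then obtain i c where ic: "0 \<le> i" "i < int (r N)" "x = pt n i c" by blast
      then have "\<epsilon> i mod 3 = 0" using window_res[OF \<epsilon> ic(1,2)] g(2) by (simp add: Ker_def)
      then have "pt n i (c + \<epsilon> i) = pt n i c" by (intro pt_cong) presburger
      then show ?thesis using \<epsilon>(2) n ic unfolding window_def by simp
    next
      case False
      then show ?thesis using \<epsilon>(2) n unfolding window_def by blast
    qed
    moreover have "g n = id" if "n < N" for n using g(2) that by (simp add: Ker_def)
    ultimately have "g n = id" for n by (cases "n < N") (auto simp: fun_eq_iff)
    then show ?thesis by (auto simp: one_G)
  qed
  then show "Win N \<inter> Ker N (r N) \<subseteq> {\<one>\<^bsub>G\<^esub>}" by blast
  show "{\<one>\<^bsub>G\<^esub>} \<subseteq> Win N \<inter> Ker N (r N)"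
    using subgroup.one_closed[OF Win_subgroup] subgroup.one_closed[OF Ker_subgroup] r_pos[of N] by simp
qed

lemma window_B_pow:
  assumes "0 \<le> i" "i < int (r N)"
  shows "\<exists>b\<in>carrier G. window N b (\<lambda>j. if j = i then int k else 0)"
proof (induction k)
  case 0
  have "(\<lambda>j. if j = i then int 0 else 0) = (\<lambda>_. 0)" by auto
  then show ?case using window_one[of N] by (intro bexI[of _ "\<one>\<^bsub>G\<^esub>"]) simp_all
next
  case (Suc k)
  then obtain b where b: "b \<in> carrier G" "window N b (\<lambda>j. if j = i then int k else 0)" by blast
  have "(\<lambda>j. (if j = i then int k else 0) + (if j = i then 1 else 0)) = (\<lambda>j. if j = i then int (Suc k) else 0)"
    by auto
  then show ?case using window_mult[OF b(2) window_B[OF assms]] b(1) B_G by (intro bexI[of _ "b \<otimes>\<^bsub>G\<^esub> B i"]) simp_all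
qed

text \<open>The element is a product of natural powers of the \<open>B i\<close>, hence the
  nonnegative values; it is applied to residues 0, 1 and 2.\<close>

lemma window_realize:
  assumes "\<And>i. 0 \<le> \<epsilon> i" "m \<le> r N"
  shows "\<exists>b\<in>carrier G. window N b (\<lambda>j. if 0 \<le> j \<and> j < int m then \<epsilon> j else 0)"
  using assms(2)
proof (induction m)
  case 0
  have "(\<lambda>j. if 0 \<le> j \<and> j < int 0 then \<epsilon> j else 0) = (\<lambda>_. 0)" by auto
  then show ?case using window_one[of N] by (intro bexI[of _ "\<one>\<^bsub>G\<^esub>"]) simp_all
next
  case (Suc m)
  then obtain b where b: "b \<in> carrier G" "window N b (\<lambda>j. if 0 \<le> j \<and> j < int m then \<epsilon> j else 0)" by auto
  obtain b' where b': "b' \<in> carrier G" "window N b' (\<lambda>j. if j = int m then int (nat (\<epsilon> (int m))) else 0)"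
    using window_B_pow[of "int m" N] Suc.prems by auto
  have "(\<lambda>j. (if 0 \<le> j \<and> j < int m then \<epsilon> j else 0) + (if j = int m then int (nat (\<epsilon> (int m))) else 0)) =
      (\<lambda>j. if 0 \<le> j \<and> j < int (Suc m) then \<epsilon> j else 0)"
    using assms(1) by auto
  then show ?case using window_mult[OF b(2) b'(2)] b(1) b'(1) by (intro bexI[of _ "b \<otimes>\<^bsub>G\<^esub> b'"]) simp_all
qed

text \<open>Lamps and first coordinates are prescribed separately: \<open>b\<close> realizes the
  folded lamps, and the factor \<open>q\<close>, trivial from coordinate \<open>N\<close> on, then
  corrects the first coordinates without touching the lamps. That \<open>q\<close> lies in
  \<open>G\<close> is \<open>trunc_G\<close>.\<close>

lemma Win_realize:
  assumes g: "g \<in> carrier G"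
  shows "\<exists>y\<in>Win N. (\<forall>n<N. y n = g n) \<and> (\<forall>c. res (r N) y c = res (r N) g c)"
proof -
  let ?w = "r N"
  have w: "0 < ?w" using r_pos[of N] by simp
  obtain b where b: "b \<in> carrier G" "window N b (\<lambda>j. if 0 \<le> j \<and> j < int ?w then res ?w g j else 0)"
    using window_realize[of "res ?w g" ?w N] res_bounds by auto
  define q where "q = trunc N (g \<otimes>\<^bsub>G\<^esub> inv\<^bsub>G\<^esub> b)"
  have q: "q \<in> carrier G" unfolding q_def using g b by (intro trunc_G) simp
  have "window N q (\<lambda>_. 0)" by (simp add: window_def q_def trunc_def)
  from window_mult[OF this b(2)]
  have y: "window N (q \<otimes>\<^bsub>G\<^esub> b) (\<lambda>j. if 0 \<le> j \<and> j < int ?w then res ?w g j else 0)" by simp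
  have yc: "q \<otimes>\<^bsub>G\<^esub> b \<in> carrier G" using q b by simp
  show ?thesis
  proof (intro bexI[of _ "q \<otimes>\<^bsub>G\<^esub> b"] conjI allI impI)
    show "q \<otimes>\<^bsub>G\<^esub> b \<in> Win N" using y yc by (auto simp: Win_def)
    fix n assume "n < N"
    then show "(q \<otimes>\<^bsub>G\<^esub> b) n = g n"
      using permutes_inv_o(2)[OF G_permutes[OF b(1), of n]]
      by (simp add: mult_G q_def trunc_def inv_G[OF b(1)] comp_assoc)
  next
    fix c
    have "res ?w (q \<otimes>\<^bsub>G\<^esub> b) (c mod int ?w) = res ?w g (c mod int ?w)"
      using window_res[OF yc y, of "c mod int ?w"] w res_bounds[of ?w g] by simp
    moreover have "res ?w f c = res ?w f (c mod int ?w)" for f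
      using res_period[of ?w f "c mod int ?w" "c div int ?w"] by simp
    ultimately show "res ?w (q \<otimes>\<^bsub>G\<^esub> b) c = res ?w g c" by simp
  qed
qed

lemma Win_cover:
  assumes g: "g \<in> carrier G"
  shows "\<exists>j<r N. \<exists>y\<in>Win N. \<exists>k\<in>Ker N (r N). g = rot (- int j) \<otimes>\<^bsub>G\<^esub> y \<otimes>\<^bsub>G\<^esub> k"
proof -
  let ?w = "r N"
  have w: "0 < ?w" using r_pos[of N] by simp
  \<comment> \<open>With this \<open>j\<close> the shift of \<open>rot (int j) \<otimes> g\<close>
    is a multiple of \<open>r N\<close>, so that an element of \<open>Win N\<close>, which has shift
    0, can match the remaining data.\<close>
  define j where "j = nat ((- shift g) mod int ?w)"
  have j: "int j = (- shift g) mod int ?w" "j < ?w" using w by (simp_all add: j_def nat_less_iff)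
  define g1 where "g1 = rot (int j) \<otimes>\<^bsub>G\<^esub> g"
  have g1: "g1 \<in> carrier G" unfolding g1_def using g rot_G by simp
  have "shift g1 = int j + shift g" unfolding g1_def using g rot_G by (simp add: shift_mult shift_rot)
  also have "int j = - shift g - int ?w * (- shift g div int ?w)"
    unfolding j(1) by (simp add: minus_mult_div_eq_mod)
  finally have s1: "int ?w dvd shift g1" by simp
  obtain y where y: "y \<in> Win N" "\<forall>n<N. y n = g1 n" "\<forall>c. res ?w y c = res ?w g1 c"
    using Win_realize[OF g1] by blast
  have yc: "y \<in> carrier G" using y by (simp add: Win_def)
  have sy: "shift y = 0" using y(1) window_shift by (auto simp: Win_def)
  have "g1 \<otimes>\<^bsub>G\<^esub> inv\<^bsub>G\<^esub> y \<in> Ker N ?w"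
    using y s1 sy by (intro Ker_mult_inv[OF w g1 yc]) simp_all
  \<comment> \<open>The kernel element arises on the left of \<open>y\<close>; conjugation by
    \<open>y\<close> moves it to the right.\<close>
  then have k: "inv\<^bsub>G\<^esub> y \<otimes>\<^bsub>G\<^esub> (g1 \<otimes>\<^bsub>G\<^esub> inv\<^bsub>G\<^esub> y) \<otimes>\<^bsub>G\<^esub> y \<in> Ker N ?w"
    by (rule normal.inv_op_closed1[OF Ker_normal[OF w] yc])
  have "g = rot (- int j) \<otimes>\<^bsub>G\<^esub> g1"
    unfolding g1_def inv_rot[symmetric] using g rot_G by simp
  also have "g1 = y \<otimes>\<^bsub>G\<^esub> (inv\<^bsub>G\<^esub> y \<otimes>\<^bsub>G\<^esub> (g1 \<otimes>\<^bsub>G\<^esub> inv\<^bsub>G\<^esub> y) \<otimes>\<^bsub>G\<^esub> y)"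
    using yc g1 by (simp add: G.m_assoc)
  also have "rot (- int j) \<otimes>\<^bsub>G\<^esub> (y \<otimes>\<^bsub>G\<^esub> (inv\<^bsub>G\<^esub> y \<otimes>\<^bsub>G\<^esub> (g1 \<otimes>\<^bsub>G\<^esub> inv\<^bsub>G\<^esub> y) \<otimes>\<^bsub>G\<^esub> y)) =
      rot (- int j) \<otimes>\<^bsub>G\<^esub> y \<otimes>\<^bsub>G\<^esub> (inv\<^bsub>G\<^esub> y \<otimes>\<^bsub>G\<^esub> (g1 \<otimes>\<^bsub>G\<^esub> inv\<^bsub>G\<^esub> y) \<otimes>\<^bsub>G\<^esub> y)"
    by (simp only: mult_G comp_assoc)
  finally show ?thesis using j(2) y(1) k by blast
qed

text \<open>The shift of \<open>y\<close> is 0 and that of \<open>k\<close> is a multiple of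
  \<open>r N\<close>, whereas \<open>i\<close> and \<open>j\<close> differ by less than
  \<open>r N\<close>.\<close>

lemma Win_uniq:
  assumes "i < r N" "j < r N" "y \<in> Win N" "k \<in> Ker N (r N)"
    "rot (- int j) = rot (- int i) \<otimes>\<^bsub>G\<^esub> y \<otimes>\<^bsub>G\<^esub> k"
  shows "i = j"
proof -
  have c: "y \<in> carrier G" "k \<in> carrier G" using assms by (auto simp: Win_def Ker_def)
  have "shift y = 0" using assms(3) window_shift by (auto simp: Win_def)
  then have "- int j = - int i + shift k"
    using arg_cong[OF assms(5), of shift] c rot_G by (simp add: shift_mult shift_rot)
  then have "int i - int j = shift k" by simp
  then have "int (r N) dvd int i - int j" using assms(4) by (simp add: Ker_def)
  moreover have "\<bar>int i - int j\<bar> < int (r N)" using assms(1,2) by linarith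
  ultimately have "int i - int j = 0" using dvd_imp_le_int[of "int i - int j" "int (r N)"] by linarith
  then show ?thesis by simp
qed

section \<open>Elements of shift zero and their conjugates in windows\<close>

lemma Linf_shift:
  assumes "g \<in> Linf d r" shows "g \<in> carrier G \<and> shift g = 0"
  using assms unfolding Linf_def
proof (induction rule: generate.induct)
  case one
  then show ?case using shift_eq[OF _ lamps_one] by simp
next
  case (incl h)
  then show ?case using beta_G by (auto simp: shift_mult shift_inv shift_beta)
next
  case (inv h)
  then show ?case using beta_G by (auto simp: shift_mult shift_inv shift_beta)
next
  case (eng h1 h2)
  then show ?case by (simp add: shift_mult)
qed

text \<open>The number \<open>m\<close> bounds the extent of the lamps on both sides of position 0,
  uniformly in \<open>N\<close>: every translation that keeps this distance from the ends of the
  window carries \<open>l\<close> into \<open>Win N\<close>.\<close>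

definition localized :: "nat \<Rightarrow> (nat \<Rightarrow> nat \<Rightarrow> nat) \<Rightarrow> bool" where
  "localized m l \<longleftrightarrow> l \<in> carrier G \<and>
     (\<forall>N j. int m \<le> j \<and> j + int m < int (r N) \<longrightarrow> rot j \<otimes>\<^bsub>G\<^esub> l \<otimes>\<^bsub>G\<^esub> rot (- j) \<in> Win N)"

lemma localized_mono: "localized m l \<Longrightarrow> m \<le> m' \<Longrightarrow> localized m' l"
  unfolding localized_def by auto

lemma localized_mult:
  assumes "localized m l" "localized m' l'" shows "localized (max m m') (l \<otimes>\<^bsub>G\<^esub> l')"
proof -
  have l: "localized (max m m') l" "localized (max m m') l'" using assms localized_mono by auto
  have "rot j \<otimes>\<^bsub>G\<^esub> (l \<otimes>\<^bsub>G\<^esub> l') \<otimes>\<^bsub>G\<^esub> rot (- j) =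
      (rot j \<otimes>\<^bsub>G\<^esub> l \<otimes>\<^bsub>G\<^esub> rot (- j)) \<otimes>\<^bsub>G\<^esub> (rot j \<otimes>\<^bsub>G\<^esub> l' \<otimes>\<^bsub>G\<^esub> rot (- j))" for j
    unfolding inv_rot[symmetric] using l rot_G[of j] by (simp add: localized_def G.m_assoc)
  then show ?thesis
    using l subgroup.m_closed[OF Win_subgroup] unfolding localized_def by simp
qed

lemma localized_inv:
  assumes "localized m l" shows "localized m (inv\<^bsub>G\<^esub> l)"
proof -
  have l: "l \<in> carrier G" using assms by (simp add: localized_def)
  have "rot j \<otimes>\<^bsub>G\<^esub> inv\<^bsub>G\<^esub> l \<otimes>\<^bsub>G\<^esub> rot (- j) = inv\<^bsub>G\<^esub> (rot j \<otimes>\<^bsub>G\<^esub> l \<otimes>\<^bsub>G\<^esub> rot (- j))" for j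
    unfolding inv_rot[symmetric] using l rot_G[of j] by (simp add: G.m_assoc G.inv_mult_group)
  then show ?thesis
    using assms subgroup.m_inv_closed[OF Win_subgroup] unfolding localized_def by simp
qed

lemma localized_conj:
  assumes "localized m l" shows "localized (m + nat \<bar>i\<bar>) (rot i \<otimes>\<^bsub>G\<^esub> l \<otimes>\<^bsub>G\<^esub> rot (- i))"
proof -
  have l: "l \<in> carrier G" using assms by (simp add: localized_def)
  have eq: "rot j \<otimes>\<^bsub>G\<^esub> (rot i \<otimes>\<^bsub>G\<^esub> l \<otimes>\<^bsub>G\<^esub> rot (- i)) \<otimes>\<^bsub>G\<^esub> rot (- j) =
      rot (j + i) \<otimes>\<^bsub>G\<^esub> l \<otimes>\<^bsub>G\<^esub> rot (- (j + i))" for j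
  proof -
    have "rot j \<otimes>\<^bsub>G\<^esub> (rot i \<otimes>\<^bsub>G\<^esub> l \<otimes>\<^bsub>G\<^esub> rot (- i)) \<otimes>\<^bsub>G\<^esub> rot (- j) =
        (rot j \<otimes>\<^bsub>G\<^esub> rot i) \<otimes>\<^bsub>G\<^esub> l \<otimes>\<^bsub>G\<^esub> (rot (- i) \<otimes>\<^bsub>G\<^esub> rot (- j))"
      by (simp only: mult_G comp_assoc)
    then show ?thesis by (simp add: rot_mult add.commute)
  qed
  show ?thesis unfolding localized_def
  proof (intro conjI allI impI)
    show "rot i \<otimes>\<^bsub>G\<^esub> l \<otimes>\<^bsub>G\<^esub> rot (- i) \<in> carrier G" using l rot_G by simp
    fix N j assume "int (m + nat \<bar>i\<bar>) \<le> j \<and> j + int (m + nat \<bar>i\<bar>) < int (r N)"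
    then have "int m \<le> j + i \<and> (j + i) + int m < int (r N)" by linarith
    then show "rot j \<otimes>\<^bsub>G\<^esub> (rot i \<otimes>\<^bsub>G\<^esub> l \<otimes>\<^bsub>G\<^esub> rot (- i)) \<otimes>\<^bsub>G\<^esub> rot (- j) \<in> Win N"
      unfolding eq using assms unfolding localized_def by blast
  qed
qed

text \<open>Localized elements are closed under products, inverses and conjugation by rotations, so
  in any word all rotations can be collected on the left.\<close>

lemma localized_decompose: "g \<in> carrier G \<Longrightarrow> \<exists>e l m. localized m l \<and> g = rot e \<otimes>\<^bsub>G\<^esub> l"
proof (induction rule: G_induct)
  case one
  have "localized 0 \<one>\<^bsub>G\<^esub>"
    using subgroup.one_closed[OF Win_subgroup] rot_G unfolding localized_def by (simp add: rot_mult rot_zero)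
  then show ?case by (intro exI[of _ 0] exI[of _ "\<one>\<^bsub>G\<^esub>"]) (simp add: rot_zero)
next
  case alpha
  have "localized 0 \<one>\<^bsub>G\<^esub>"
    using subgroup.one_closed[OF Win_subgroup] rot_G unfolding localized_def by (simp add: rot_mult rot_zero)
  moreover have "alpha d = rot 1 \<otimes>\<^bsub>G\<^esub> \<one>\<^bsub>G\<^esub>" using alpha_G by (simp add: rot_1)
  ultimately show ?case by blast
next
  case beta
  have "localized 0 (beta r)"
    unfolding localized_def using beta_G window_B B_G by (auto simp: Win_def B_def[symmetric])
  then show ?case using beta_G by (intro exI[of _ 0] exI[of _ "beta r"]) (simp add: rot_zero)
next
  case (inv g)
  then obtain e l m where l: "localized m l" "g = rot e \<otimes>\<^bsub>G\<^esub> l" by blast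
  then have "localized (m + nat \<bar>e\<bar>) (rot e \<otimes>\<^bsub>G\<^esub> inv\<^bsub>G\<^esub> l \<otimes>\<^bsub>G\<^esub> rot (- e))"
    by (intro localized_conj localized_inv)
  moreover have "inv\<^bsub>G\<^esub> g = rot (- e) \<otimes>\<^bsub>G\<^esub> (rot e \<otimes>\<^bsub>G\<^esub> inv\<^bsub>G\<^esub> l \<otimes>\<^bsub>G\<^esub> rot (- e))"
    unfolding l(2) inv_rot[symmetric] using l(1) rot_G[of e]
    by (simp add: localized_def G.m_assoc G.inv_mult_group)
  ultimately show ?case by blast
next
  case (mult g h)
  then obtain e l m e' l' m' where l: "localized m l" "g = rot e \<otimes>\<^bsub>G\<^esub> l"
      and l': "localized m' l'" "h = rot e' \<otimes>\<^bsub>G\<^esub> l'" by blast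
  have "localized (max (m + nat \<bar>- e'\<bar>) m') ((rot (- e') \<otimes>\<^bsub>G\<^esub> l \<otimes>\<^bsub>G\<^esub> rot (- (- e'))) \<otimes>\<^bsub>G\<^esub> l')"
    using l l' by (intro localized_mult localized_conj)
  moreover have "g \<otimes>\<^bsub>G\<^esub> h = rot (e + e') \<otimes>\<^bsub>G\<^esub> ((rot (- e') \<otimes>\<^bsub>G\<^esub> l \<otimes>\<^bsub>G\<^esub> rot (- (- e'))) \<otimes>\<^bsub>G\<^esub> l')"
    unfolding l(2) l'(2) rot_mult[symmetric] inv_rot[symmetric] using l(1) l'(1) rot_G[of e] rot_G[of e']
    by (simp add: localized_def G.m_assoc)
  ultimately show ?case by blast
qed

lemma localized_shift:
  assumes "localized m l" shows "shift l = 0"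
proof -
  \<comment> \<open>Window \<open>2 * m + 1\<close> is long enough for the translate by
    \<open>m\<close>, because \<open>n \<le> r n\<close>.\<close>
  have "int m + int m < int (r (2 * m + 1))" using r_ge[of "2 * m + 1"] by linarith
  then have "rot (int m) \<otimes>\<^bsub>G\<^esub> l \<otimes>\<^bsub>G\<^esub> rot (- int m) \<in> Win (2 * m + 1)"
    using assms unfolding localized_def by blast
  then have "shift (rot (int m) \<otimes>\<^bsub>G\<^esub> l \<otimes>\<^bsub>G\<^esub> rot (- int m)) = 0"
    using window_shift by (auto simp: Win_def)
  then show ?thesis using assms rot_G by (simp add: localized_def shift_mult shift_rot)
qed

lemma shift_zero_localized:
  assumes "g \<in> carrier G" "shift g = 0" shows "\<exists>m. localized m g"
proof -
  obtain e l m where l: "localized m l" "g = rot e \<otimes>\<^bsub>G\<^esub> l" using localized_decompose[OF assms(1)] by blast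
  then have "e = 0" using assms(2) localized_shift[OF l(1)] rot_G by (simp add: localized_def shift_mult shift_rot)
  then have "g = l" using l by (simp add: rot_zero localized_def)
  then show ?thesis using l by blast
qed

section \<open>Choice of the window for a finite set of elements\<close>

lemma cosofic_of_Linf:
  assumes "IRS G \<mu>" "measure_support (Sub_topology G) \<mu> \<subseteq> {H. H \<subseteq> Linf d r}"
  shows "cosofic G \<mu>"
proof (rule cosofic_by_windows[OF G.is_group])
  fix E and \<delta> :: real
  assume E: "finite E" "E \<subseteq> carrier G" and \<delta>: "\<delta> > 0"
  have "\<exists>m. (shift x = 0 \<longrightarrow> localized m x) \<and> nat \<bar>shift x\<bar> \<le> m" if x: "x \<in> E" for x
  proof (cases "shift x = 0")
    case True
    then show ?thesis using shift_zero_localized[of x] E(2) x by auto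
  qed auto
  then have "\<forall>x\<in>E. \<exists>m. (shift x = 0 \<longrightarrow> localized m x) \<and> nat \<bar>shift x\<bar> \<le> m" by blast
  from bchoice[OF this] obtain f where f: "\<forall>x\<in>E. (shift x = 0 \<longrightarrow> localized (f x) x) \<and> nat \<bar>shift x\<bar> \<le> f x" ..
  \<comment> \<open>One bound serves two purposes: the extent of the elements of shift 0 and the
    size of the nonzero shifts.\<close>
  define m where "m = (\<Sum>x\<in>E. f x)"
  have "f x \<le> m" if "x \<in> E" for x unfolding m_def using E(1) that by (intro member_le_sum) auto
  then have m: "shift x = 0 \<Longrightarrow> localized m x" "nat \<bar>shift x\<bar> \<le> m" if "x \<in> E" for x
    using f localized_mono that order_trans by blast+
  \<comment> \<open>As \<open>N \<le> r N\<close>, the first summand brings the proportion of bad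
    indices below \<open>\<delta>\<close>, the second yields \<open>m < r N\<close>, and the final 1
    makes both inequalities strict.\<close>
  define N where "N = nat \<lceil>2 * real m / \<delta>\<rceil> + m + 1"
  let ?w = "r N"
  have w: "0 < ?w" using r_pos[of N] by simp
  have wm: "m < ?w" using r_ge[of N] by (simp add: N_def)
  \<comment> \<open>These are the translations that come too close to one of the two ends of the
    window.\<close>
  define J where "J = {..<m} \<union> {?w - m..<?w}"
  have win: "irs_window G \<mu> (Ker N ?w) (Win N) (\<lambda>j. rot (- int j)) ?w"
    by (intro irs_window.intro G.is_group irs_window_axioms.intro assms(1) Ker_normal[OF w]
        Ker_finite_index[OF w] Win_subgroup Win_Ker w rot_G Win_cover) (auto intro: Win_uniq)
  have J: "J \<subseteq> {..<?w}" using wm by (auto simp: J_def)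
  have "card J \<le> 2 * m"
    unfolding J_def using card_Un_le[of "{..<m}" "{?w - m..<?w}"] by simp
  then have "real (card J) \<le> 2 * real m" by linarith
  moreover have "2 * real m < \<delta> * real ?w"
  proof -
    have "2 * real m / \<delta> \<le> real (nat \<lceil>2 * real m / \<delta>\<rceil>)" by (rule real_nat_ceiling_ge)
    also have "\<dots> < real N" by (simp add: N_def)
    also have "\<dots> \<le> real ?w" using r_ge[of N] by simp
    finally show ?thesis using \<delta> by (simp add: field_simps)
  qed
  ultimately have small: "card J / ?w < \<delta>" using w by (simp add: field_simps)
  have good: "inv\<^bsub>G\<^esub> (rot (- int j)) \<otimes>\<^bsub>G\<^esub> x \<otimes>\<^bsub>G\<^esub> rot (- int j) \<in> Win N \<or>
      (AE H in \<mu>. x \<notin> H) \<and> inv\<^bsub>G\<^esub> (rot (- int j)) \<otimes>\<^bsub>G\<^esub> x \<otimes>\<^bsub>G\<^esub> rot (- int j) \<notin> Ker N ?w <#>\<^bsub>G\<^esub> Win N"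
    if j: "j < ?w" "j \<notin> J" and x: "x \<in> E" for j x
  proof (cases "shift x = 0")
    case True
    have "int m \<le> int j \<and> int j + int m < int ?w" using j by (auto simp: J_def)
    then show ?thesis using m(1)[OF x True] by (simp add: inv_rot localized_def)
  next
    case False
    have xc: "x \<in> carrier G" using x E by blast
    have "AE H in \<mu>. x \<notin> H"
      using assms(2) Linf_shift False by (intro IRS_AE_in_support[OF G.is_group assms(1) xc]) blast
    \<comment> \<open>Every element of the product set has a shift divisible by \<open>r N\<close>,
      while conjugation keeps the shift of \<open>x\<close>, which is nonzero and at most
      \<open>m\<close> in absolute value.\<close>
    moreover have "inv\<^bsub>G\<^esub> (rot (- int j)) \<otimes>\<^bsub>G\<^esub> x \<otimes>\<^bsub>G\<^esub> rot (- int j) \<notin> Ker N ?w <#>\<^bsub>G\<^esub> Win N"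
    proof
      assume "inv\<^bsub>G\<^esub> (rot (- int j)) \<otimes>\<^bsub>G\<^esub> x \<otimes>\<^bsub>G\<^esub> rot (- int j) \<in> Ker N ?w <#>\<^bsub>G\<^esub> Win N"
      then obtain k y where ky: "k \<in> Ker N ?w" "y \<in> Win N"
          "inv\<^bsub>G\<^esub> (rot (- int j)) \<otimes>\<^bsub>G\<^esub> x \<otimes>\<^bsub>G\<^esub> rot (- int j) = k \<otimes>\<^bsub>G\<^esub> y"
        unfolding set_mult_def by blast
      have "shift y = 0" using ky(2) window_shift by (auto simp: Win_def)
      moreover have "shift (inv\<^bsub>G\<^esub> (rot (- int j)) \<otimes>\<^bsub>G\<^esub> x \<otimes>\<^bsub>G\<^esub> rot (- int j)) = shift x"
        using xc rot_G by (simp add: inv_rot shift_mult shift_rot)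
      moreover have "shift (k \<otimes>\<^bsub>G\<^esub> y) = shift k + shift y"
        using ky by (intro shift_mult) (auto simp: Ker_def Win_def)
      ultimately have "int ?w dvd shift x" using ky(1,3) by (simp add: Ker_def)
      then have "int ?w \<le> \<bar>shift x\<bar>" using dvd_imp_le_int[OF False, of "int ?w"] by simp
      then show False using m(2)[OF x] wm by linarith
    qed
    ultimately show ?thesis by blast
  qed
  show "\<exists>K Y t w J. irs_window G \<mu> K Y t w \<and> J \<subseteq> {..<w} \<and> card J / w < \<delta> \<and>
        (\<forall>j x. j < w \<longrightarrow> j \<notin> J \<longrightarrow> x \<in> E \<longrightarrow>
           inv\<^bsub>G\<^esub> (t j) \<otimes>\<^bsub>G\<^esub> x \<otimes>\<^bsub>G\<^esub> t j \<in> Y \<or>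
           (AE H in \<mu>. x \<notin> H) \<and> inv\<^bsub>G\<^esub> (t j) \<otimes>\<^bsub>G\<^esub> x \<otimes>\<^bsub>G\<^esub> t j \<notin> K <#>\<^bsub>G\<^esub> Y)"
    using win J small good
    by (intro exI[of _ "Ker N ?w"] exI[of _ "Win N"] exI[of _ "\<lambda>j. rot (- int j)"] exI[of _ ?w] exI[of _ J] conjI allI impI)
qed

end

theorem theorem4p4:
  fixes d r :: "nat \<Rightarrow> nat" and \<mu> :: "(nat \<Rightarrow> nat \<Rightarrow> nat) set measure"
  assumes "mono d"
    and "\<forall>n. prime (d n) \<and> d n \<ge> 5"
    and "strict_mono r"
    and "\<forall>n. r n \<ge> 1"
    and "\<forall>n. 3 * r n \<le> d n"
    and "ergodic_IRS (Ggrp d r) \<mu>"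
    and "measure_support (Sub_topology (Ggrp d r)) \<mu> \<subseteq> {H. H \<subseteq> Linf d r}"
  shows "cosofic (Ggrp d r) \<mu>"
proof -
  interpret neumann_group d r using assms by unfold_locales auto
  show ?thesis using assms by (intro cosofic_of_Linf) (auto simp: ergodic_IRS_def)
qed

end
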